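(* Let $\mathfrak A\subseteq\mathcal W$ be a $\star$-preideal. Then $\leq_{\mathrm W}^{\mathfrak A}$ is a preorder on $\mathcal W$. Denote by $\mathcal W/\mathfrak A$ the set of its degrees (equivalence classes of the equivalence relation induced by $\leq_{\mathrm W}^{\mathfrak A}$). Then $\sqcap$, $\sqcup$ and $\times$ all induce operations on $\mathcal W/\mathfrak A$. In particular, $(\mathcal W/\mathfrak A,\sqcap,\sqcup)$ is a lattice. If $\mathfrak A$ is etheric, then also $\star$ and $\rightarrow$ induce operations on $\mathcal W/\mathfrak A$.
   Context: A represented space $\mathbf X=(X,\delta_X)$ is a set $X$ with a partial surjection $\delta_X:\subseteq\mathbb N^{\mathbb N}\to X$ (the symbol $\subseteq$ marks possibly partial functions). A multi-valued function $f:\subseteq\mathbf X\rightrightarrows\mathbf Y$ assigns to each $x\in\mathrm{dom}(f)\subseteq X$ a nonempty set $f(x)\subseteq Y$. Composition: $z\in(f\circ g)(x)$ iff $g(x)\subseteq\mathrm{dom}(f)$ and $z\in f(y)$ for some $y\in g(x)$ (with $x\in\mathrm{dom}(g)$). $F:\subseteq\mathbb N^{\mathbb N}\to\mathbb N^{\mathbb N}$ is a realizer of $f$, $F\vdash f$, if $\delta_YF(p)\in f\delta_X(p)$ for all $p\in\mathrm{dom}(f\delta_X)$. $f\leq_{\mathrm W}g$ iff there are computable $K,H:\subseteq\mathbb N^{\mathbb N}\to\mathbb N^{\mathbb N}$ with $K\langle\mathrm{id},GH\rangle\vdash f$ for all $G\vdash g$. $\mathcal W$ is the partially ordered set of equivalence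 classes (Weihrauch degrees), extended by an additional top element $\infty$ (the Axiom of Choice for Baire space is assumed). $0$ is the degree of the nowhere defined multi-valued function, $1$ the degree of $\mathrm{id}_{\mathbb N^{\mathbb N}}$. Operations (well defined on degrees), for $f:\subseteq\mathbf X\rightrightarrows\mathbf Y$, $g:\subseteq\mathbf U\rightrightarrows\mathbf V$: $(f\times g)(x,u)=f(x)\times g(u)$; $f\sqcup g:\subseteq\mathbf X\sqcup\mathbf U\rightrightarrows\mathbf Y\sqcup\mathbf V$, $(f\sqcup g)(0,x)=\{0\}\times f(x)$, $(f\sqcup g)(1,u)=\{1\}\times g(u)$; $f\sqcap g:\subseteq\mathbf X\times\mathbf U\rightrightarrows\mathbf Y\sqcup\mathbf V$, $(f\sqcap g)(x,u)=(\{0\}\times f(x))\cup(\{1\}\times g(u))$ (with the canonical representations of products and coproducts). Space $\mathcal M(\mathbf X,\mathbf Y)$: fix a universal Turing machine; $\Phi_p:\subseteq\mathbb N^{\mathbb N}\to\mathbb N^{\mathbb N}$ is the partial function it computes with first input $p$, i.e. $\Phi_p(q)=r$ iff on input $\langle p,q\rangle$ it produces the infinite output $r$. Let $\delta_X^{\mathrm{cyl}}\langle p,q\rangle:=\delta_X(p)$, $\Phi_p^{\mathbf X,\mathbf Y}:=\delta_Y\circ\Phi_p\circ(\delta_X^{\mathrm{cyl}})^{-1}$. $\mathcal M(\mathbf X,\mathbf Y)$ is the represented space of all $\Phi_p^{\mathbf X,\mathbf Y}$, with $p$ as a name. Compositional product: with $g^{\mathrm t}_{\mathbf Z}:\subseteq\mathcal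 M(\mathbf Y,\mathbf Z)\times\mathbf X\rightrightarrows\mathbf Z$, $g^{\mathrm t}_{\mathbf Z}(h,x):=(h\circ g)(x)$ for $g:\subseteq\mathbf X\rightrightarrows\mathbf Y$, and $f:\subseteq\mathbf U\rightrightarrows\mathbf V$, put $f\star g:=(\mathrm{id}_{\mathbb N^{\mathbb N}}\times f)\circ g^{\mathrm t}_{\mathbb N^{\mathbb N}\times\mathbf U}$. Implication: for such $f,g$ with $\mathrm{dom}(g)\neq\emptyset$ or $\mathrm{dom}(f)=\emptyset$, $(g\rightarrow f):\subseteq\mathbf U\rightrightarrows\mathcal M(\mathbf Y,\mathbf V)\times\mathbf X$ has domain $\mathrm{dom}(f)$ and $(H,x)\in(g\rightarrow f)(u)$ iff $(H\circ g)(x)\subseteq f(u)$ (where $x\in\mathrm{dom}(H\circ g)$); if $\mathrm{dom}(g)=\emptyset$ and $\mathrm{dom}(f)\neq\emptyset$, then $(g\rightarrow f):=\infty$. Both operations are well defined on degrees. Conventions for $\infty$: $\mathbf a\times\infty=\infty\times\mathbf a=\mathbf a\star\infty=\infty\star\mathbf a=\mathbf a\sqcup\infty=\infty\sqcup\mathbf a=\infty$, $\mathbf a\sqcap\infty=\infty\sqcap\mathbf a=\mathbf a$, $(\infty\rightarrow\mathbf a)=0$ for all $\mathbf a$; $(\mathbf a\rightarrow\infty)=\infty$ for $\mathbf a\neq\infty$. Ideals: $\mathfrak A\subseteq\mathcal W$ is a $\star$-ideal if it is downwards closed with respect to $\leq_{\mathrm W}$, $1\in\mathfrak A$, and $\mathbf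 a,\mathbf b\in\mathfrak A$ implies $\mathbf a\star\mathbf b,\ \mathbf a\sqcup\mathbf b\in\mathfrak A$. A $\star$-ideal $\mathfrak A$ is etheric if for any $\mathbf a\in\mathfrak A$, $\mathbf b\in\mathcal W$ there is $\mathbf a'\in\mathfrak A$ with $\mathbf a\star\mathbf b\leq_{\mathrm W}\mathbf b\star\mathbf a'$. $\mathfrak B\subseteq\mathcal W$ is a $\star$-preideal if its downwards closure is a $\star$-ideal; it is etheric if its downwards closure is. For $\mathfrak A\subseteq\mathcal W$, $\mathbf a\leq_{\mathrm W}^{\mathfrak A}\mathbf b$ means $(\exists\mathbf c\in\mathfrak A)\ \mathbf a\leq_{\mathrm W}\mathbf b\star\mathbf c$. An operation on $\mathcal W$ induces an operation on $\mathcal W/\mathfrak A$ if it respects the equivalence relation induced by $\leq_{\mathrm W}^{\mathfrak A}$ in both arguments; $\mathcal W/\mathfrak A$ is partially ordered by the order induced by $\leq_{\mathrm W}^{\mathfrak A}$. *)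

theory Defs
  imports "HOL-Library.Nat_Bijection" "HOL-Algebra.Lattice"
begin

section \<open>Computability on Baire space\<close>

type_synonym baire = "nat \<Rightarrow> nat"

definition bpair :: "baire \<Rightarrow> baire \<Rightarrow> baire" where
  "bpair p q = (\<lambda>n. if even n then p (n div 2) else q (n div 2))"

definition bfst :: "baire \<Rightarrow> baire" where
  "bfst r = (\<lambda>n. r (2 * n))"

definition bsnd :: "baire \<Rightarrow> baire" where
  "bsnd r = (\<lambda>n. r (2 * n + 1))"

definition btl :: "baire \<Rightarrow> baire" where
  "btl r = (\<lambda>n. r (Suc n))"

text \<open>
  Programs with an oracle: the partial recursive functions relative to a point of Baire space,
  presented as unary functions on the natural numbers, with several arguments packed
  by \<^const>\<open>prod_encode\<close>.
\<close>

datatype prog =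
    Zero
  | Succ
  | Left
  | Right
  | Oracle
  | Pairing prog prog
  | Compose prog prog
  | PrimRec prog prog
  | Minimize prog

primrec run :: "baire \<Rightarrow> prog \<Rightarrow> nat \<Rightarrow> nat option" where
  "run r Zero = (\<lambda>x. Some 0)"
| "run r Succ = (\<lambda>x. Some (Suc x))"
| "run r Left = (\<lambda>x. Some (fst (prod_decode x)))"
| "run r Right = (\<lambda>x. Some (snd (prod_decode x)))"
| "run r Oracle = (\<lambda>x. Some (r x))"
| "run r (Pairing c d) = (\<lambda>x. case (run r c x, run r d x) of
       (Some y, Some z) \<Rightarrow> Some (prod_encode (y, z))
     | _ \<Rightarrow> None)"
| "run r (Compose c d) = (\<lambda>x. Option.bind (run r d x) (run r c))"
| "run r (PrimRec c d) = (\<lambda>x. case prod_decode x of (a, n) \<Rightarrow>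
       rec_nat (run r c a)
         (\<lambda>i v. Option.bind v (\<lambda>y. run r d (prod_encode (a, prod_encode (i, y))))) n)"
| "run r (Minimize c) = (\<lambda>x.
       let found = (\<lambda>k. run r c (prod_encode (x, k)) = Some 0 \<and>
                        (\<forall>j<k. \<exists>y. run r c (prod_encode (x, j)) = Some (Suc y)))
       in if \<exists>k. found k then Some (LEAST k. found k) else None)"

text \<open>
  On input \<open>r\<close> the machine with program \<open>c\<close> produces the infinite output whose \<open>n\<close>-th symbol is
  the value of \<open>c\<close> at \<open>n\<close> with oracle \<open>r\<close>; the output is undefined unless all these computations
  halt.
\<close>

definition machine :: "prog \<Rightarrow> baire \<Rightarrow> baire option" where
  "machine c r = (if \<forall>n. run r c n \<noteq> None then Some (\<lambda>n. the (run r c n)) else None)"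

text \<open>
  Nothing is required outside the domain of \<open>F\<close>: a restriction of a computable function is
  computable.
\<close>

definition computable :: "(baire \<Rightarrow> baire option) \<Rightarrow> bool" where
  "computable F \<longleftrightarrow> (\<exists>c. F \<subseteq>\<^sub>m machine c)"

primrec code :: "prog \<Rightarrow> nat" where
  "code Zero = prod_encode (0, 0)"
| "code Succ = prod_encode (1, 0)"
| "code Left = prod_encode (2, 0)"
| "code Right = prod_encode (3, 0)"
| "code Oracle = prod_encode (4, 0)"
| "code (Pairing c d) = prod_encode (5, prod_encode (code c, code d))"
| "code (Compose c d) = prod_encode (6, prod_encode (code c, code d))"
| "code (PrimRec c d) = prod_encode (7, prod_encode (code c, code d))"
| "code (Minimize c) = prod_encode (8, code c)"

lemma code_inject: "code c = code d \<longleftrightarrow> c = d"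
proof (induction c arbitrary: d)
  case Zero show ?case by (cases d) auto
next
  case Succ show ?case by (cases d) auto
next
  case Left show ?case by (cases d) auto
next
  case Right show ?case by (cases d) auto
next
  case Oracle show ?case by (cases d) auto
next
  case Pairing then show ?case by (cases d) auto
next
  case Compose then show ?case by (cases d) auto
next
  case PrimRec then show ?case by (cases d) auto
next
  case Minimize then show ?case by (cases d) auto
qed

text \<open>
  The universal machine: on input \<open>\<langle>p, q\<rangle>\<close> it runs the program coded by the first symbol of \<open>p\<close>
  on the whole input \<open>\<langle>p, q\<rangle>\<close>, so the rest of \<open>p\<close> serves as a parameter of that program.
  It diverges if \<open>p 0\<close> is not the code of a program.
\<close>

definition Phi :: "baire \<Rightarrow> baire \<Rightarrow> baire option" where
  "Phi p q = (if p 0 \<in> range code then machine (inv code (p 0)) (bpair p q) else None)"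

section \<open>Represented spaces\<close>

text \<open>
  A represented space is given by its representation, a partial function \<open>\<delta>\<close> from Baire space;
  the underlying set is \<^term>\<open>ran \<delta>\<close>, so that \<open>\<delta>\<close> is surjective by definition.
\<close>

type_synonym 'a rep_space = "baire \<Rightarrow> 'a option"

definition baire_space :: "baire rep_space" where
  "baire_space = Some"

definition prod_space :: "'a rep_space \<Rightarrow> 'b rep_space \<Rightarrow> ('a \<times> 'b) rep_space" where
  "prod_space dX dY r =
     (case (dX (bfst r), dY (bsnd r)) of (Some x, Some y) \<Rightarrow> Some (x, y) | _ \<Rightarrow> None)"

definition sum_space :: "'a rep_space \<Rightarrow> 'b rep_space \<Rightarrow> ('a + 'b) rep_space" where
  "sum_space dX dY r =
     (if r 0 = 0 then map_option Inl (dX (btl r))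
      else if r 0 = 1 then map_option Inr (dY (btl r))
      else None)"

section \<open>Multi-valued functions\<close>

text \<open>
  A partial multi-valued function is a set-valued function, undefined exactly where its value is
  empty.
\<close>

type_synonym ('a, 'b) mvfun = "'a \<Rightarrow> 'b set"

definition mdom :: "('a, 'b) mvfun \<Rightarrow> 'a set" where
  "mdom f = {x. f x \<noteq> {}}"

definition mcomp :: "('b, 'c) mvfun \<Rightarrow> ('a, 'b) mvfun \<Rightarrow> ('a, 'c) mvfun" where
  "mcomp f g x = (if g x \<subseteq> mdom f then (\<Union>y\<in>g x. f y) else {})"

definition mv_of :: "('a \<Rightarrow> 'b option) \<Rightarrow> ('a, 'b) mvfun" where
  "mv_of F x = set_option (F x)"

definition cyl :: "'a rep_space \<Rightarrow> 'a rep_space" where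
  "cyl dX r = dX (bfst r)"

definition PhiXY :: "'a rep_space \<Rightarrow> 'b rep_space \<Rightarrow> baire \<Rightarrow> ('a, 'b) mvfun" where
  "PhiXY dX dY p =
     mcomp (mv_of dY) (mcomp (mv_of (Phi p)) (\<lambda>x. {r. cyl dX r = Some x}))"

definition M_space :: "'a rep_space \<Rightarrow> 'b rep_space \<Rightarrow> ('a, 'b) mvfun rep_space" where
  "M_space dX dY p = Some (PhiXY dX dY p)"

text \<open>A problem is a multi-valued function together with its source and target space.\<close>

record ('a, 'b) problem =
  src :: "'a rep_space"
  trg :: "'b rep_space"
  val :: "('a, 'b) mvfun"

definition is_problem :: "('a, 'b) problem \<Rightarrow> bool" where
  "is_problem f \<longleftrightarrow> mdom (val f) \<subseteq> ran (src f) \<and> (\<forall>x. val f x \<subseteq> ran (trg f))"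

section \<open>Weihrauch reducibility\<close>

definition realizes :: "(baire \<Rightarrow> baire option) \<Rightarrow> ('a, 'b) problem \<Rightarrow> bool" where
  "realizes F f \<longleftrightarrow>
     (\<forall>p x. src f p = Some x \<and> x \<in> mdom (val f) \<longrightarrow>
        (\<exists>q y. F p = Some q \<and> trg f q = Some y \<and> y \<in> val f x))"

definition weihrauch_le :: "('a, 'b) problem \<Rightarrow> ('c, 'd) problem \<Rightarrow> bool" where
  "weihrauch_le f g \<longleftrightarrow>
     (\<exists>K H. computable K \<and> computable H \<and>
        (\<forall>G. realizes G g \<longrightarrow>
           realizes (\<lambda>p. Option.bind ((G \<circ>\<^sub>m H) p) (\<lambda>r. K (bpair p r))) f))"

section \<open>Operations on problems\<close>

definition prob_id :: "(baire, baire) problem" where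
  "prob_id = \<lparr>src = baire_space, trg = baire_space, val = (\<lambda>x. {x})\<rparr>"

definition prob_zero :: "(baire, baire) problem" where
  "prob_zero = \<lparr>src = baire_space, trg = baire_space, val = (\<lambda>x. {})\<rparr>"

definition prob_comp :: "('b, 'c) problem \<Rightarrow> ('a, 'b) problem \<Rightarrow> ('a, 'c) problem" where
  "prob_comp f g = \<lparr>src = src g, trg = trg f, val = mcomp (val f) (val g)\<rparr>"

definition prob_times ::
  "('a, 'b) problem \<Rightarrow> ('c, 'd) problem \<Rightarrow> ('a \<times> 'c, 'b \<times> 'd) problem" where
  "prob_times f g =
     \<lparr>src = prod_space (src f) (src g), trg = prod_space (trg f) (trg g),
      val = (\<lambda>(x, u). val f x \<times> val g u)\<rparr>"

definition prob_sqcup ::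
  "('a, 'b) problem \<Rightarrow> ('c, 'd) problem \<Rightarrow> ('a + 'c, 'b + 'd) problem" where
  "prob_sqcup f g =
     \<lparr>src = sum_space (src f) (src g), trg = sum_space (trg f) (trg g),
      val = case_sum (\<lambda>x. Inl ` val f x) (\<lambda>u. Inr ` val g u)\<rparr>"

text \<open>The domain is the product of the domains, which the union alone would not ensure.\<close>

definition prob_sqcap ::
  "('a, 'b) problem \<Rightarrow> ('c, 'd) problem \<Rightarrow> ('a \<times> 'c, 'b + 'd) problem" where
  "prob_sqcap f g =
     \<lparr>src = prod_space (src f) (src g), trg = sum_space (trg f) (trg g),
      val = (\<lambda>(x, u). if x \<in> mdom (val f) \<and> u \<in> mdom (val g)
                       then Inl ` val f x \<union> Inr ` val g u else {})\<rparr>"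

definition prob_transpose ::
  "'c rep_space \<Rightarrow> ('a, 'b) problem \<Rightarrow> (('b, 'c) mvfun \<times> 'a, 'c) problem" where
  "prob_transpose dZ g =
     \<lparr>src = prod_space (M_space (trg g) dZ) (src g), trg = dZ,
      val = (\<lambda>(h, x). if h \<in> ran (M_space (trg g) dZ) then mcomp h (val g) x else {})\<rparr>"

definition prob_star ::
  "('u, 'v) problem \<Rightarrow> ('x, 'y) problem \<Rightarrow>
   (('y, baire \<times> 'u) mvfun \<times> 'x, baire \<times> 'v) problem" where
  "prob_star f g =
     prob_comp (prob_times prob_id f) (prob_transpose (prod_space baire_space (src f)) g)"

text \<open>
  \<open>prob_impl g f\<close> is the implication \<open>g \<rightarrow> f\<close> in the case that \<open>g\<close> has a nonempty or \<open>f\<close> an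
  empty domain.  Outside the domain of \<open>f\<close> the value is automatically empty.
\<close>

definition prob_impl ::
  "('x, 'y) problem \<Rightarrow> ('u, 'v) problem \<Rightarrow> ('u, ('y, 'v) mvfun \<times> 'x) problem" where
  "prob_impl g f =
     \<lparr>src = src f, trg = prod_space (M_space (trg g) (trg f)) (src g),
      val = (\<lambda>u. {(H, x). H \<in> ran (M_space (trg g) (trg f)) \<and>
                          x \<in> mdom (mcomp H (val g)) \<and> mcomp H (val g) x \<subseteq> val f u})\<rparr>"

section \<open>Weihrauch degrees\<close>

text \<open>
  A represented space has at most as many points as Baire space, and realizers refer only to
  names.  Hence every problem has an equivalent copy on spaces whose underlying sets consist of
  points of Baire space (lemma \<open>baire_copy\<close> below), and the degree of a problem of any type
  is represented by the class of its copies.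
\<close>

definition degree_class :: "('a, 'b) problem \<Rightarrow> (baire, baire) problem set" where
  "degree_class f = {g. is_problem g \<and> weihrauch_le g f \<and> weihrauch_le f g}"

typedef degree = "{degree_class f | f :: (baire, baire) problem. is_problem f}"
proof -
  have "is_problem prob_id"
    by (auto simp: is_problem_def prob_id_def baire_space_def mdom_def ran_def)
  then show ?thesis by blast
qed

lemma baire_copy:
  fixes f :: "('a, 'b) problem"
  assumes "is_problem f"
  shows "\<exists>g :: (baire, baire) problem.
    is_problem g \<and> (\<forall>G. realizes G g \<longleftrightarrow> realizes G f) \<and> degree_class g = degree_class f"
proof -
  define i where "i = (\<lambda>x. SOME p. src f p = Some x)"
  define j where "j = (\<lambda>y. SOME q. trg f q = Some y)"
  have i: "src f (i x) = Some x" if "x \<in> ran (src f)" for x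
    using that unfolding i_def ran_def mem_Collect_eq by (rule someI_ex)
  have j: "trg f (j y) = Some y" if "y \<in> ran (trg f)" for y
    using that unfolding j_def ran_def mem_Collect_eq by (rule someI_ex)
  define g :: "(baire, baire) problem" where
    "g = \<lparr>src = map_option i \<circ> src f, trg = map_option j \<circ> trg f,
          val = (\<lambda>p. \<Union>x \<in> {x \<in> ran (src f). i x = p}. j ` val f x)\<rparr>"
  have inj_i: "inj_on i (ran (src f))"
    by (rule inj_on_inverseI[of _ "the \<circ> src f"]) (simp add: i)
  have inj_j: "inj_on j (ran (trg f))"
    by (rule inj_on_inverseI[of _ "the \<circ> trg f"]) (simp add: j)
  have val_f: "val f x \<subseteq> ran (trg f)" for x
    using assms unfolding is_problem_def by (elim conjE allE)
  have val_g: "val g (i x) = j ` val f x" if "x \<in> ran (src f)" for x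
  proof -
    have "{z \<in> ran (src f). i z = i x} = {x}"
      using inj_on_eq_iff[OF inj_i _ that] that by auto
    then show ?thesis unfolding g_def by simp
  qed
  have 1: "is_problem g"
  proof -
    have v: "val g = (\<lambda>p. \<Union>x \<in> {x \<in> ran (src f). i x = p}. j ` val f x)"
      by (simp add: g_def)
    have r: "ran (src g) = i ` ran (src f)" "ran (trg g) = j ` ran (trg f)"
      by (auto simp: g_def ran_def)
    show ?thesis
      unfolding is_problem_def mdom_def v r using val_f by blast
  qed
  have j_iff: "j y \<in> j ` val f x \<longleftrightarrow> y \<in> val f x" if "y \<in> ran (trg f)" for x y
    by (rule inj_on_image_mem_iff[OF inj_j that val_f])
  have c: "src g p = Some z \<longleftrightarrow> (\<exists>x. src f p = Some x \<and> z = i x)" for p z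
    by (auto simp: g_def)
  have d: "trg g q = Some z \<longleftrightarrow> (\<exists>y. trg f q = Some y \<and> z = j y)" for q z
    by (auto simp: g_def)
  have 2: "realizes G g \<longleftrightarrow> realizes G f" for G
  proof -
    have a: "(\<exists>q z. G p = Some q \<and> trg g q = Some z \<and> z \<in> val g (i x)) \<longleftrightarrow>
        (\<exists>q y. G p = Some q \<and> trg f q = Some y \<and> y \<in> val f x)"
      if "src f p = Some x" for p x
    proof -
      have x: "x \<in> ran (src f)" by (rule ranI[of "src f" p x, OF that])
      have "(trg f q = Some y \<and> j y \<in> j ` val f x) \<longleftrightarrow> (trg f q = Some y \<and> y \<in> val f x)" for q y
        using j_iff[OF ranI[of "trg f" q y]] by blast
      then show ?thesis unfolding d val_g[OF x] by blast
    qed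
    have b: "i x \<in> mdom (val g) \<longleftrightarrow> x \<in> mdom (val f)" if "src f p = Some x" for p x
      using val_g[OF ranI[of "src f" p x, OF that]] by (simp add: mdom_def)
    show ?thesis
    proof
      assume g: "realizes G g"
      show "realizes G f" unfolding realizes_def
      proof (intro allI impI)
        fix p x assume px: "src f p = Some x \<and> x \<in> mdom (val f)"
        then have "src g p = Some (i x) \<and> i x \<in> mdom (val g)" using b c by blast
        with g have "\<exists>q z. G p = Some q \<and> trg g q = Some z \<and> z \<in> val g (i x)"
          unfolding realizes_def by blast
        then show "\<exists>q y. G p = Some q \<and> trg f q = Some y \<and> y \<in> val f x"
          using a px by blast
      qed
    next
      assume f: "realizes G f"
      show "realizes G g" unfolding realizes_def
      proof (intro allI impI)
        fix p z assume pz: "src g p = Some z \<and> z \<in> mdom (val g)"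
        then obtain x where x: "src f p = Some x" "z = i x" using c by blast
        with pz b have "x \<in> mdom (val f)" by blast
        with f x have "\<exists>q y. G p = Some q \<and> trg f q = Some y \<and> y \<in> val f x"
          unfolding realizes_def by blast
        then show "\<exists>q y. G p = Some q \<and> trg g q = Some y \<and> y \<in> val g z"
          using a[OF x(1)] x(2) by blast
      qed
    qed
  qed
  then have "degree_class g = degree_class f"
    by (simp add: degree_class_def weihrauch_le_def)
  with 1 2 show ?thesis by blast
qed

lemma degree_class_in_range:
  "is_problem f \<Longrightarrow>
   degree_class f \<in> {degree_class g | g :: (baire, baire) problem. is_problem g}"
  using baire_copy[of f] by blast

text \<open>Weihrauch degrees with the additional top element \<open>\<infinity>\<close>.\<close>

datatype wdegree = Deg degree | Infty

definition wdeg :: "('a, 'b) problem \<Rightarrow> wdegree" where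
  "wdeg f = Deg (Abs_degree (degree_class f))"

definition repr :: "degree \<Rightarrow> (baire, baire) problem" where
  "repr a = (SOME f. f \<in> Rep_degree a)"

fun wle :: "wdegree \<Rightarrow> wdegree \<Rightarrow> bool" (infix \<open>\<le>\<^sub>W\<close> 50) where
  "a \<le>\<^sub>W Infty \<longleftrightarrow> True"
| "Infty \<le>\<^sub>W Deg b \<longleftrightarrow> False"
| "Deg a \<le>\<^sub>W Deg b \<longleftrightarrow> weihrauch_le (repr a) (repr b)"

definition wzero :: wdegree where
  "wzero = wdeg prob_zero"

definition wone :: wdegree where
  "wone = wdeg prob_id"

fun wtimes :: "wdegree \<Rightarrow> wdegree \<Rightarrow> wdegree" where
  "wtimes (Deg a) (Deg b) = wdeg (prob_times (repr a) (repr b))"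
| "wtimes _ _ = Infty"

fun wsqcup :: "wdegree \<Rightarrow> wdegree \<Rightarrow> wdegree" where
  "wsqcup (Deg a) (Deg b) = wdeg (prob_sqcup (repr a) (repr b))"
| "wsqcup _ _ = Infty"

fun wsqcap :: "wdegree \<Rightarrow> wdegree \<Rightarrow> wdegree" where
  "wsqcap (Deg a) (Deg b) = wdeg (prob_sqcap (repr a) (repr b))"
| "wsqcap Infty b = b"
| "wsqcap a Infty = a"

fun wstar :: "wdegree \<Rightarrow> wdegree \<Rightarrow> wdegree" where
  "wstar (Deg a) (Deg b) = wdeg (prob_star (repr a) (repr b))"
| "wstar _ _ = Infty"

fun wimpl :: "wdegree \<Rightarrow> wdegree \<Rightarrow> wdegree" where
  "wimpl Infty b = wzero"
| "wimpl (Deg a) Infty = Infty"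
| "wimpl (Deg a) (Deg b) =
     (if mdom (val (repr a)) = {} \<and> mdom (val (repr b)) \<noteq> {} then Infty
      else wdeg (prob_impl (repr a) (repr b)))"

section \<open>Ideals and quotients\<close>

definition star_ideal :: "wdegree set \<Rightarrow> bool" where
  "star_ideal A \<longleftrightarrow>
     (\<forall>a b. b \<in> A \<longrightarrow> a \<le>\<^sub>W b \<longrightarrow> a \<in> A) \<and>
     wone \<in> A \<and>
     (\<forall>a\<in>A. \<forall>b\<in>A. wstar a b \<in> A \<and> wsqcup a b \<in> A)"

definition etheric_star_ideal :: "wdegree set \<Rightarrow> bool" where
  "etheric_star_ideal A \<longleftrightarrow>
     star_ideal A \<and> (\<forall>a\<in>A. \<forall>b. \<exists>a'\<in>A. wstar a b \<le>\<^sub>W wstar b a')"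

definition down_closure :: "wdegree set \<Rightarrow> wdegree set" where
  "down_closure B = {a. \<exists>b\<in>B. a \<le>\<^sub>W b}"

definition star_preideal :: "wdegree set \<Rightarrow> bool" where
  "star_preideal B \<longleftrightarrow> star_ideal (down_closure B)"

definition etheric_star_preideal :: "wdegree set \<Rightarrow> bool" where
  "etheric_star_preideal B \<longleftrightarrow> etheric_star_ideal (down_closure B)"

definition rel_le :: "wdegree set \<Rightarrow> wdegree rel" where
  "rel_le A = {(a, b). \<exists>c\<in>A. a \<le>\<^sub>W wstar b c}"

definition rel_equiv :: "wdegree set \<Rightarrow> wdegree rel" where
  "rel_equiv A = {(a, b). (a, b) \<in> rel_le A \<and> (b, a) \<in> rel_le A}"

definition induces_operation ::
  "wdegree set \<Rightarrow> (wdegree \<Rightarrow> wdegree \<Rightarrow> wdegree) \<Rightarrow> bool" where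
  "induces_operation A f \<longleftrightarrow>
     (\<forall>a a' b b'. (a, a') \<in> rel_equiv A \<longrightarrow> (b, b') \<in> rel_equiv A \<longrightarrow>
        (f a b, f a' b') \<in> rel_equiv A)"

definition induced_operation ::
  "wdegree set \<Rightarrow> (wdegree \<Rightarrow> wdegree \<Rightarrow> wdegree) \<Rightarrow>
   wdegree set \<Rightarrow> wdegree set \<Rightarrow> wdegree set" where
  "induced_operation A f C D = (\<Union>a\<in>C. \<Union>b\<in>D. rel_equiv A `` {f a b})"

definition quotient_order :: "wdegree set \<Rightarrow> wdegree set gorder" where
  "quotient_order A =
     \<lparr>carrier = UNIV // rel_equiv A, eq = (=),
      le = (\<lambda>C D. \<exists>a\<in>C. \<exists>b\<in>D. (a, b) \<in> rel_le A)\<rparr>"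

end

(*
Every problem is determined up to reducibility by the relation between names of its instances and
names of their solutions, and all operations act on these relations. A reduction to F * G amounts
to a uniform protocol that queries G first and F afterwards; monotonicity and associativity of *
and the inequalities

  (a * c) x (b * c) <= (a x b) * (c x c),   (a * c) meet (b * c) <= (a meet b) * (c x c)

are then read off from the protocols. Since c x c <= c * c, ideals are closed under x, so meet, join
and x descend to the quotient. In the etheric case elements of the ideal can be moved to the right
end of a product, and the implication descends because it is a residual:
b <= a * x iff (a -> b) <= x.

Evaluating a function given by its name inside such a protocol needs a universal program.
*)

theory Submission
  imports Defs
begin

section \<open>Recursive functionals\<close>

text \<open>Two features of the definitions shape the proof. A reduction quantifies over arbitrary
  realizers, computable or not; choice supplies one, and changing it at a single point makes it
  return any prescribed solution, so realizers can be traded for relations. The compositional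
  product takes as input a name of the function applied between the two problems, and this function
  sees a name together with the free half added by the cylinder, so it may be many-valued. The
  protocols of \<open>red2\<close> mention neither function names nor free halves: the s-m-n theorem
  turns the input of a protocol into the parameter of a function name, and the identity factor of
  the product carries the first answer past the second query. Reflexivity at F * G yields a protocol
  for F * G itself, and this is how a product on the left of an inequality is decoded. The universal
  program has a second use: a case distinction on the tag of a coproduct must run one branch without
  running the other. On degrees, the conventions for the top element are checked separately in each
  law.\<close>

definition recf :: "(baire \<Rightarrow> nat \<Rightarrow> nat) \<Rightarrow> bool" where
  "recf f \<longleftrightarrow> (\<exists>c. \<forall>r x. run r c x = Some (f r x))"

named_theorems recf_intros

lemma recf_id [recf_intros]: "recf (\<lambda>r x. x)"
  \<comment> \<open>\<open>Left\<close> and \<open>Right\<close> decode the argument and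
    \<open>Pairing\<close> encodes it again.\<close>
  unfolding recf_def by (rule exI[of _ "Pairing Left Right"]) simp

lemma recf_comp:
  assumes "recf g" "recf f"
  shows "recf (\<lambda>r x. g r (f r x))"
proof -
  obtain c d where "\<forall>r x. run r c x = Some (g r x)" "\<forall>r x. run r d x = Some (f r x)"
    using assms unfolding recf_def by blast
  then show ?thesis
    unfolding recf_def by (intro exI[of _ "Compose c d"]) simp
qed

lemma recf_Suc [recf_intros]: "recf f \<Longrightarrow> recf (\<lambda>r x. Suc (f r x))"
  by (rule recf_comp[of "\<lambda>r. Suc"]) (auto simp: recf_def intro: exI[of _ Succ])

lemma recf_const [recf_intros]: "recf (\<lambda>r x. k)"
proof (induction k)
  case 0
  show ?case unfolding recf_def by (rule exI[of _ Zero]) simp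
qed (rule recf_Suc)

lemma recf_fst [recf_intros]: "recf f \<Longrightarrow> recf (\<lambda>r x. fst (prod_decode (f r x)))"
  by (rule recf_comp[of "\<lambda>r x. fst (prod_decode x)"]) (auto simp: recf_def intro: exI[of _ Left])

lemma recf_snd [recf_intros]: "recf f \<Longrightarrow> recf (\<lambda>r x. snd (prod_decode (f r x)))"
  by (rule recf_comp[of "\<lambda>r x. snd (prod_decode x)"]) (auto simp: recf_def intro: exI[of _ Right])

lemma recf_oracle [recf_intros]: "recf f \<Longrightarrow> recf (\<lambda>r x. r (f r x))"
  by (rule recf_comp[of "\<lambda>r. r"]) (auto simp: recf_def intro: exI[of _ Oracle])

lemma recf_pair [recf_intros]:
  assumes "recf f" "recf g"
  shows "recf (\<lambda>r x. prod_encode (f r x, g r x))"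
proof -
  obtain c d where "\<forall>r x. run r c x = Some (f r x)" "\<forall>r x. run r d x = Some (g r x)"
    using assms unfolding recf_def by blast
  then show ?thesis
    unfolding recf_def by (intro exI[of _ "Pairing c d"]) simp
qed

text \<open>The whole argument x is passed to \<open>PrimRec\<close> as its parameter, so that base,
  step and number of iterations may all depend on it. The assumption on h has the packed form in
  which \<open>PrimRec\<close> presents parameter, counter and previous value, and the introduction
  rules can work on it further.\<close>

lemma recf_rec_nat [recf_intros]:
  assumes f: "recf f" and g: "recf g"
    and h: "recf (\<lambda>r z. h r (fst (prod_decode z)) (fst (prod_decode (snd (prod_decode z))))
                         (snd (prod_decode (snd (prod_decode z)))))"
  shows "recf (\<lambda>r x. rec_nat (f r x) (\<lambda>i v. h r x i v) (g r x))"
proof -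
  obtain c where c: "\<forall>r x. run r c x = Some (f r x)"
    using f unfolding recf_def by blast
  obtain d where d: "\<forall>r z. run r d z = Some (h r (fst (prod_decode z))
      (fst (prod_decode (snd (prod_decode z)))) (snd (prod_decode (snd (prod_decode z)))))"
    using h unfolding recf_def by blast
  have "run r (PrimRec c d) (prod_encode (x, n)) = Some (rec_nat (f r x) (h r x) n)" for r x n
    by (induction n) (simp_all add: c d)
  then have "recf (\<lambda>r z. rec_nat (f r (fst (prod_decode z))) (h r (fst (prod_decode z)))
      (snd (prod_decode z)))"
    unfolding recf_def by (metis prod.collapse prod_decode_inverse)
  from recf_comp[OF this recf_pair[OF recf_id g]] show ?thesis by simp
qed

lemma recf_case_nat [recf_intros]:
  assumes "recf f" "recf g"
    and h: "recf (\<lambda>r z. h r (fst (prod_decode z)) (snd (prod_decode z)))"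
  shows "recf (\<lambda>r x. case g r x of 0 \<Rightarrow> f r x | Suc i \<Rightarrow> h r x i)"
proof -
  \<comment> \<open>A case distinction is a recursion whose step ignores the previous value.\<close>
  have "recf (\<lambda>r x. rec_nat (f r x) (\<lambda>i v. h r x i) (g r x))"
    using assms(1,2) recf_comp[OF h, of "\<lambda>r z. prod_encode (fst (prod_decode z), fst (prod_decode (snd (prod_decode z))))"]
    by (intro recf_rec_nat) (simp_all add: recf_intros)
  moreover have "rec_nat (f r x) (\<lambda>i v. h r x i) (g r x) = (case g r x of 0 \<Rightarrow> f r x | Suc i \<Rightarrow> h r x i)"
    for r x by (cases "g r x") simp_all
  ultimately show ?thesis by simp
qed

section \<open>Truncated subtraction, tests and binary shifts\<close>

lemma recf_diff [recf_intros]: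
  assumes "recf f" "recf g"
  shows "recf (\<lambda>r x. f r x - g r x)"
proof -
  have "rec_nat a (\<lambda>i v. case v of 0 \<Rightarrow> 0 | Suc i \<Rightarrow> i) b = a - b" for a b :: nat
    by (induction b) (auto split: nat.split)
  moreover have "recf (\<lambda>r x. rec_nat (f r x) (\<lambda>i v. case v of 0 \<Rightarrow> 0 | Suc i \<Rightarrow> i) (g r x))"
    by (intro recf_intros assms)
  ultimately show ?thesis by simp
qed

lemma recf_if_eq [recf_intros]:
  assumes "recf a" "recf b" "recf f" "recf g"
  shows "recf (\<lambda>r x. if a r x = b r x then f r x else g r x)"
proof -
  \<comment> \<open>Two numbers agree iff both truncated differences vanish.\<close>
  have eq: "(if a r x = b r x then f r x else g r x) =
     (case a r x - b r x of Suc _ \<Rightarrow> g r x | 0 \<Rightarrow> (case b r x - a r x of Suc _ \<Rightarrow> g r x | 0 \<Rightarrow> f r x))"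
    for r x by (auto split: nat.split)
  have g': "recf (\<lambda>r z. g r (fst (prod_decode z)))"
    by (rule recf_comp[OF assms(4)]) (intro recf_intros)
  show ?thesis unfolding eq by (intro recf_intros assms g')
qed

lemma recf_if_even [recf_intros]:
  assumes "recf a" "recf f" "recf g"
  shows "recf (\<lambda>r x. if even (a r x) then f r x else g r x)"
proof -
  have "rec_nat 0 (\<lambda>i v. Suc 0 - v) n = (if even n then 0 else Suc 0)" for n
    by (induction n) simp_all
  then have eq: "(if even (a r x) then f r x else g r x) =
     (if rec_nat 0 (\<lambda>i v. Suc 0 - v) (a r x) = 0 then f r x else g r x)" for r x
    by simp
  show ?thesis unfolding eq by (intro recf_intros assms)
qed

lemma recf_half [recf_intros]:
  assumes "recf f"
  shows "recf (\<lambda>r x. f r x div 2)"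
proof -
  \<comment> \<open>The half grows by one exactly in the steps that start from an odd
    number.\<close>
  have eq: "n div 2 = rec_nat 0 (\<lambda>i v. if even i then v else Suc v) n" for n :: nat
    by (induction n) simp_all
  show ?thesis unfolding eq by (intro recf_intros assms)
qed

lemma recf_double [recf_intros]:
  assumes "recf f"
  shows "recf (\<lambda>r x. 2 * f r x)"
proof -
  have eq: "2 * n = rec_nat 0 (\<lambda>i v. Suc (Suc v)) n" for n :: nat
    by (induction n) simp_all
  show ?thesis unfolding eq by (intro recf_intros assms)
qed

section \<open>A universal program\<close>

text \<open>
  The universal program searches through a growing table of evaluation facts. A table is an
  association list coded as in \<^const>\<open>list_encode\<close>, its entries are pairs of a key \<open>\<langle>e, x\<rangle>\<close> and the
  value of the program with code \<open>e\<close> at \<open>x\<close>. Partial results are coded by \<open>0\<close> (unknown) and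
  \<open>Suc y\<close> (the value is \<open>y\<close>).
\<close>

lemma snd_prod_decode_le [termination_simp]: "snd (prod_decode u) \<le> u"
  by (metis le_prod_encode_2 prod.collapse prod_decode_inverse)

fun look :: "nat \<Rightarrow> nat \<Rightarrow> nat" where
  "look 0 k = 0"
| "look (Suc u) k =
     (if fst (prod_decode (fst (prod_decode u))) = k
      then Suc (snd (prod_decode (fst (prod_decode u))))
      else look (snd (prod_decode u)) k)"

text \<open>\<open>look\<close> recurses on the tail of a coded list, not on the predecessor of its
  code. It is replaced by an iteration of \<open>next_entry\<close>, which drops a head with the
  wrong key and otherwise stays where it is. T iterations suffice, since the code T bounds the
  length of the list.\<close>

lemma recf_look [recf_intros]:
  assumes "recf f" "recf g"
  shows "recf (\<lambda>r x. look (f r x) (g r x))"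
proof -
  define next_entry where "next_entry k T = (case T of 0 \<Rightarrow> 0 | Suc u \<Rightarrow>
    (if fst (prod_decode (fst (prod_decode u))) = k then T else snd (prod_decode u)))" for k T
  define entry where "entry T = (case T of 0 \<Rightarrow> 0 | Suc u \<Rightarrow> Suc (snd (prod_decode (fst (prod_decode u)))))" for T
  have *: "entry ((next_entry k ^^ n) T) = look T k" if "T \<le> n" for T n k
    using that
  proof (induction T k arbitrary: n rule: look.induct)
    case (1 k)
    have "(next_entry k ^^ n) 0 = 0"
      by (induction n) (simp_all add: next_entry_def)
    then show ?case by (simp add: entry_def)
  next
    case (2 u k)
    show ?case
    proof (cases "fst (prod_decode (fst (prod_decode u))) = k")
      case True
      have "(next_entry k ^^ n) (Suc u) = Suc u"
        by (induction n) (simp_all add: next_entry_def True)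
      then show ?thesis using True by (simp add: entry_def)
    next
      case False
      obtain m where m: "n = Suc m" "u \<le> m"
        using 2 by (cases n) auto
      have "(next_entry k ^^ n) (Suc u) = (next_entry k ^^ m) (snd (prod_decode u))"
        using m False by (simp add: funpow_swap1 next_entry_def)
      then show ?thesis
        using False 2(1)[OF False, of m] m snd_prod_decode_le[of u] by simp
    qed
  qed
  have "rec_nat T (\<lambda>i. next_entry k) n = (next_entry k ^^ n) T" for T k n
    by (induction n) simp_all
  with * have eq: "look T k = entry (rec_nat T (\<lambda>i. next_entry k) T)" for T k
    by simp
  have "recf (\<lambda>r z. look (fst (prod_decode z)) (snd (prod_decode z)))"
    unfolding eq entry_def next_entry_def by (intro recf_intros)
  from recf_comp[OF this recf_pair[OF assms]] show ?thesis by simp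
qed

text \<open>
  Tag \<open>9\<close> is not used by \<^const>\<open>code\<close>: the key \<open>\<langle>\<langle>9, code c\<rangle>, \<langle>x, j\<rangle>\<rangle>\<close> stands for the
  search of \<open>Minimize c\<close> at \<open>x\<close> started at \<open>j\<close>.
\<close>

definition infer :: "baire \<Rightarrow> nat \<Rightarrow> nat \<Rightarrow> nat \<Rightarrow> nat \<Rightarrow> nat" where
  "infer r T t a x =
    (if t = 0 then Suc 0
     else if t = 1 then Suc (Suc x)
     else if t = 2 then Suc (fst (prod_decode x))
     else if t = 3 then Suc (snd (prod_decode x))
     else if t = 4 then Suc (r x)
     else if t = 5 then
       (case look T (prod_encode (fst (prod_decode a), x)) of 0 \<Rightarrow> 0 | Suc y \<Rightarrow>
         (case look T (prod_encode (snd (prod_decode a), x)) of 0 \<Rightarrow> 0 | Suc z \<Rightarrow>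
           Suc (prod_encode (y, z))))
     else if t = 6 then
       (case look T (prod_encode (snd (prod_decode a), x)) of 0 \<Rightarrow> 0 | Suc y \<Rightarrow>
         look T (prod_encode (fst (prod_decode a), y)))
     else if t = 7 then
       (case snd (prod_decode x) of
         0 \<Rightarrow> look T (prod_encode (fst (prod_decode a), fst (prod_decode x)))
       | Suc n \<Rightarrow>
         (case look T (prod_encode (prod_encode (7, a), prod_encode (fst (prod_decode x), n))) of
           0 \<Rightarrow> 0
         | Suc v \<Rightarrow> look T (prod_encode (snd (prod_decode a),
             prod_encode (fst (prod_decode x), prod_encode (n, v))))))
     else if t = 8 then look T (prod_encode (prod_encode (9, a), prod_encode (x, 0)))
     else if t = 9 then
       (case look T (prod_encode (a, x)) of 0 \<Rightarrow> 0 | Suc y \<Rightarrow>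
         (if y = 0 then Suc (snd (prod_decode x))
          else look T (prod_encode (prod_encode (9, a),
            prod_encode (fst (prod_decode x), Suc (snd (prod_decode x)))))))
     else 0)"


text \<open>
  Facts are never overwritten, so tables only grow; stage \<open>i\<close> of the table tries the key
  \<open>fst (prod_decode i)\<close>, so every key is tried infinitely often.
\<close>

definition add_fact :: "baire \<Rightarrow> nat \<Rightarrow> nat \<Rightarrow> nat" where
  "add_fact r T k =
    (case look T k of
       0 \<Rightarrow>
         (case infer r T (fst (prod_decode (fst (prod_decode k))))
              (snd (prod_decode (fst (prod_decode k)))) (snd (prod_decode k)) of
            0 \<Rightarrow> T
          | Suc y \<Rightarrow> Suc (prod_encode (prod_encode (k, y), T)))
     | Suc _ \<Rightarrow> T)"

primrec table :: "baire \<Rightarrow> nat \<Rightarrow> nat" where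
  "table r 0 = 0"
| "table r (Suc i) = add_fact r (table r i) (fst (prod_decode i))"

lemma recf_table [recf_intros]:
  assumes "recf f"
  shows "recf (\<lambda>r x. table r (f r x))"
proof -
  have eq: "table r n = rec_nat 0 (\<lambda>i T. add_fact r T (fst (prod_decode i))) n" for r n
    by (induction n) simp_all
  show ?thesis
    unfolding eq add_fact_def infer_def by (intro recf_intros assms)
qed

section \<open>Soundness of the table\<close>

text \<open>Numbers that code no program can also acquire facts, and nothing is claimed about those;
  the premises that \<open>infer\<close> consults for a genuine key are genuine again. In the second
  clause y is the first zero of c from j on, with defined nonzero values in between.\<close>

definition sound_fact :: "baire \<Rightarrow> nat \<Rightarrow> nat \<Rightarrow> bool" where
  "sound_fact r k y \<longleftrightarrow>
     (\<forall>c x. k = prod_encode (code c, x) \<longrightarrow> run r c x = Some y) \<and>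
     (\<forall>c x j. k = prod_encode (prod_encode (9, code c), prod_encode (x, j)) \<longrightarrow>
        j \<le> y \<and> run r c (prod_encode (x, y)) = Some 0 \<and>
        (\<forall>i. j \<le> i \<longrightarrow> i < y \<longrightarrow> (\<exists>z. run r c (prod_encode (x, i)) = Some (Suc z))))"

lemma sound_fact_code:
  "sound_fact r (prod_encode (code c, x)) y \<Longrightarrow> run r c x = Some y"
  by (simp add: sound_fact_def)

lemma sound_fact_search:
  "sound_fact r (prod_encode (prod_encode (9, code c), prod_encode (x, j))) y \<Longrightarrow>
     j \<le> y \<and> run r c (prod_encode (x, y)) = Some 0 \<and>
     (\<forall>i. j \<le> i \<longrightarrow> i < y \<longrightarrow> (\<exists>z. run r c (prod_encode (x, i)) = Some (Suc z)))"
  by (simp add: sound_fact_def)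

lemma run_Minimize_Some:
  assumes "run r c (prod_encode (x, y)) = Some 0"
    and "\<And>i. i < y \<Longrightarrow> \<exists>z. run r c (prod_encode (x, i)) = Some (Suc z)"
  shows "run r (Minimize c) x = Some y"
proof -
  let ?found = "\<lambda>k. run r c (prod_encode (x, k)) = Some 0 \<and>
    (\<forall>j<k. \<exists>y. run r c (prod_encode (x, j)) = Some (Suc y))"
  have *: "?found y" using assms by blast
  have "(LEAST k. ?found k) = y"
  proof (rule Least_equality[where P = ?found, OF *])
    fix k assume "?found k"
    then show "y \<le> k"
      using assms(2)[of k] by (metis leI nat.distinct(1) option.inject)
  qed
  moreover have "\<exists>k. ?found k" using * by (rule exI)
  ultimately show ?thesis by (simp only: run.simps Let_def if_True)
qed

lemma run_Minimize_SomeD: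
  assumes "run r (Minimize c) x = Some y"
  shows "run r c (prod_encode (x, y)) = Some 0"
    and "i < y \<Longrightarrow> \<exists>z. run r c (prod_encode (x, i)) = Some (Suc z)"
proof -
  let ?found = "\<lambda>k. run r c (prod_encode (x, k)) = Some 0 \<and>
    (\<forall>j<k. \<exists>y. run r c (prod_encode (x, j)) = Some (Suc y))"
  have *: "(if \<exists>k. ?found k then Some (LEAST k. ?found k) else None) = Some y"
    using assms by (simp only: run.simps Let_def)
  then have ex: "\<exists>k. ?found k"
    by (rule contrapos_pp) (simp only: if_False option.distinct not_False_eq_True)
  with * have "y = (LEAST k. ?found k)"
    by (simp only: if_True option.inject)
  with ex have "?found y" using LeastI_ex[of ?found] by blast
  then show "run r c (prod_encode (x, y)) = Some 0"
    and "i < y \<Longrightarrow> \<exists>z. run r c (prod_encode (x, i)) = Some (Suc z)" by blast+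
qed

text \<open>A case distinction on c replaces an induction: soundness for the subprograms is part of
  the assumption on the table T.\<close>

lemma infer_sound_code:
  assumes T: "\<And>k y. look T k = Suc y \<Longrightarrow> sound_fact r k y"
    and d: "infer r T (fst (prod_decode (code c))) (snd (prod_decode (code c))) x = Suc y"
  shows "run r c x = Some y"
proof (cases c)
  case (Pairing c1 c2)
  then show ?thesis using d
    by (auto simp: infer_def split: nat.splits dest!: T sound_fact_code)
next
  case (Compose c1 c2)
  then show ?thesis using d
    by (auto simp: infer_def split: nat.splits dest!: T sound_fact_code)
next
  case (PrimRec c1 c2)
  \<comment> \<open>The value at the preceding counter is stored under a key of the same program, so
    it is sound by assumption as well.\<close>
  have T': "run r c x = Some y"
    if "look T (prod_encode (prod_encode (7, prod_encode (code c1, code c2)), x)) = Suc y" for x y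
    using sound_fact_code[of r "PrimRec c1 c2"] T[OF that] PrimRec by simp
  obtain a n where x: "x = prod_encode (a, n)"
    by (metis prod.collapse prod_decode_inverse)
  show ?thesis
  proof (cases n)
    case 0
    then show ?thesis using d PrimRec x
      by (auto simp: infer_def dest!: T sound_fact_code)
  next
    case (Suc m)
    then obtain v where v: "look T (prod_encode (prod_encode (7, prod_encode (code c1, code c2)),
        prod_encode (a, m))) = Suc v"
      and d': "look T (prod_encode (code c2, prod_encode (a, prod_encode (m, v)))) = Suc y"
      using d PrimRec x by (auto simp: infer_def split: nat.splits)
    show ?thesis
      using T'[OF v] T[OF d', THEN sound_fact_code] PrimRec x Suc by simp
  qed
next
  case (Minimize c1)
  then have "look T (prod_encode (prod_encode (9, code c1), prod_encode (x, 0))) = Suc y"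
    using d by (simp add: infer_def)
  note sound_fact_search[OF T[OF this]]
  then show ?thesis unfolding Minimize by (intro run_Minimize_Some) auto
qed (use d in \<open>simp_all add: infer_def\<close>)

lemma infer_sound:
  assumes T: "\<And>k y. look T k = Suc y \<Longrightarrow> sound_fact r k y"
    and d: "infer r T (fst (prod_decode (fst (prod_decode k))))
              (snd (prod_decode (fst (prod_decode k)))) (snd (prod_decode k)) = Suc y"
  shows "sound_fact r k y"
  unfolding sound_fact_def
proof (intro conjI allI impI)
  fix c x assume "k = prod_encode (code c, x)"
  then show "run r c x = Some y"
    using infer_sound_code[OF T] d by simp
next
  fix c x j assume k: "k = prod_encode (prod_encode (9, code c), prod_encode (x, j))"
  from d k obtain v where v: "look T (prod_encode (code c, prod_encode (x, j))) = Suc v"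
    by (auto simp: infer_def split: nat.splits)
  note v' = sound_fact_code[OF T[OF v]]
  have *: "j \<le> y \<and> run r c (prod_encode (x, y)) = Some 0 \<and>
     (\<forall>i. j \<le> i \<longrightarrow> i < y \<longrightarrow> (\<exists>z. run r c (prod_encode (x, i)) = Some (Suc z)))"
  \<comment> \<open>If c vanishes at j, the search ends there; otherwise y is the result of the
    search started at j + 1, and the nonzero value at j extends its range by one.\<close>
  proof (cases v)
    case 0
    then show ?thesis using d k v v' by (auto simp: infer_def)
  next
    case (Suc w)
    then have "look T (prod_encode (prod_encode (9, code c), prod_encode (x, Suc j))) = Suc y"
      using d k v by (simp add: infer_def)
    from sound_fact_search[OF T[OF this]] show ?thesis
      using v' Suc by (metis Suc_leD Suc_leI le_neq_implies_less)
  qed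
  then show "j \<le> y" "run r c (prod_encode (x, y)) = Some 0"
    and "\<And>i. j \<le> i \<Longrightarrow> i < y \<Longrightarrow> \<exists>z. run r c (prod_encode (x, i)) = Some (Suc z)"
    by blast+
qed

lemma table_sound: "look (table r n) k = Suc y \<Longrightarrow> sound_fact r k y"
proof (induction n arbitrary: k y)
  case (Suc n)
  then show ?case
    using infer_sound[of "table r n" r "fst (prod_decode n)", OF Suc.IH]
    by (auto simp: add_fact_def split: nat.splits if_splits)
qed simp

section \<open>Completeness of the table\<close>

lemma table_mono: "n \<le> m \<Longrightarrow> look (table r n) k = Suc y \<Longrightarrow> look (table r m) k = Suc y"
  by (induction m rule: dec_induct) (auto simp: add_fact_def split: nat.splits)

lemma table_progress:
  assumes "\<And>m. n \<le> m \<Longrightarrow> infer r (table r m) t a x \<noteq> 0"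
  shows "\<exists>m. look (table r m) (prod_encode (prod_encode (t, a), x)) \<noteq> 0"
proof -
  define k where "k = prod_encode (prod_encode (t, a), x)"
  \<comment> \<open>The stage \<open>prod_encode (k, n)\<close> tries the key k and is at least n,
    so the assumption applies to the table of that stage.\<close>
  have "look (table r (Suc (prod_encode (k, n)))) k \<noteq> 0"
    using assms[OF le_prod_encode_2, of k]
    by (auto simp: add_fact_def k_def split: nat.splits)
  then show ?thesis unfolding k_def by blast
qed

text \<open>Any fact for the key will do: soundness forces its value to be y, and later tables keep
  it.\<close>

lemma look_code_complete:
  assumes "look (table r n) (prod_encode (code c, x)) \<noteq> 0" "run r c x = Some y"
  shows "\<exists>n. \<forall>m\<ge>n. look (table r m) (prod_encode (code c, x)) = Suc y"
proof -
  obtain z where z: "look (table r n) (prod_encode (code c, x)) = Suc z"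
    using assms(1) not0_implies_Suc by blast
  with sound_fact_code[OF table_sound[OF z]] assms(2) table_mono[OF _ z] show ?thesis by auto
qed

text \<open>The conclusion is about all late stages, not a single one. Thus the premises of an
  inference are jointly present from the maximum of their stages on, and they are still there when
  the key is tried next.\<close>

lemma table_complete:
  "run r c x = Some y \<Longrightarrow> \<exists>n. \<forall>m\<ge>n. look (table r m) (prod_encode (code c, x)) = Suc y"
proof (induction c arbitrary: x y)
  case (Pairing c d)
  then obtain y1 y2 where y: "run r c x = Some y1" "run r d x = Some y2"
    by (auto split: option.splits)
  from Pairing.IH(1)[OF y(1)] Pairing.IH(2)[OF y(2)] obtain n1 n2
    where n: "\<forall>m\<ge>n1. look (table r m) (prod_encode (code c, x)) = Suc y1"
      "\<forall>m\<ge>n2. look (table r m) (prod_encode (code d, x)) = Suc y2" by blast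
  have "\<exists>m. look (table r m) (prod_encode (code (Pairing c d), x)) \<noteq> 0"
    using table_progress[of "max n1 n2"] n by (simp add: infer_def)
  with Pairing.prems show ?case using look_code_complete by blast
next
  case (Compose c d)
  then obtain z where y: "run r d x = Some z" "run r c z = Some y"
    by (auto simp: bind_eq_Some_conv)
  from Compose.IH(2)[OF y(1)] Compose.IH(1)[OF y(2)] obtain n1 n2
    where n: "\<forall>m\<ge>n1. look (table r m) (prod_encode (code d, x)) = Suc z"
      "\<forall>m\<ge>n2. look (table r m) (prod_encode (code c, z)) = Suc y" by blast
  have "\<exists>m. look (table r m) (prod_encode (code (Compose c d), x)) \<noteq> 0"
    using table_progress[of "max n1 n2"] n by (simp add: infer_def)
  with Compose.prems show ?case using look_code_complete by blast
next
  case (PrimRec c d)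
  obtain a n where x: "x = prod_encode (a, n)"
    by (metis prod.collapse prod_decode_inverse)
  have "\<exists>n'. \<forall>m\<ge>n'. look (table r m) (prod_encode (code (PrimRec c d), prod_encode (a, n))) = Suc y"
    using PrimRec.prems unfolding x
  \<comment> \<open>The value at k + 1 refers to the same program at k, which the induction on
    programs does not cover; hence the inner induction on the counter.\<close>
  proof (induction n arbitrary: y)
    case 0
    then have "run r c a = Some y" by simp
    from PrimRec.IH(1)[OF this] obtain n1
      where n: "\<forall>m\<ge>n1. look (table r m) (prod_encode (code c, a)) = Suc y" by blast
    have "\<exists>m. look (table r m) (prod_encode (code (PrimRec c d), prod_encode (a, 0))) \<noteq> 0"
      using table_progress[of n1] n by (simp add: infer_def)
    then show ?case using 0 look_code_complete by blast
  next
    case (Suc k)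
    then obtain v where v: "run r (PrimRec c d) (prod_encode (a, k)) = Some v"
      and y: "run r d (prod_encode (a, prod_encode (k, v))) = Some y"
      by (auto simp: bind_eq_Some_conv)
    from Suc.IH[OF v] PrimRec.IH(2)[OF y] obtain n1 n2 where
      n: "\<forall>m\<ge>n1. look (table r m) (prod_encode (code (PrimRec c d), prod_encode (a, k))) = Suc v"
        "\<forall>m\<ge>n2. look (table r m) (prod_encode (code d, prod_encode (a, prod_encode (k, v)))) = Suc y"
      by blast
    have "\<exists>m. look (table r m) (prod_encode (code (PrimRec c d), prod_encode (a, Suc k))) \<noteq> 0"
      using table_progress[of "max n1 n2"] n by (simp add: infer_def)
    with Suc.prems show ?case using look_code_complete by blast
  qed
  then show ?case unfolding x .
next
  case (Minimize c)
  let ?k = "\<lambda>j. prod_encode (prod_encode (9, code c), prod_encode (x, j))"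
  note y = run_Minimize_SomeD[OF Minimize.prems]
  have "\<exists>n. look (table r n) (?k j) \<noteq> 0" if "j \<le> y" for j
    using that
  \<comment> \<open>Downwards from the least zero y: the search started at y succeeds at once, and
    the search started at j copies the result of the one started at j + 1.\<close>
  proof (induction j rule: inc_induct)
    case base
    from Minimize.IH[OF y(1)] obtain n1
      where n: "\<forall>m\<ge>n1. look (table r m) (prod_encode (code c, prod_encode (x, y))) = Suc 0"
      by blast
    show ?case
      using table_progress[of n1 r 9] n by (simp add: infer_def)
  next
    case (step j)
    from y(2)[OF step(2)] obtain z
      where z: "run r c (prod_encode (x, j)) = Some (Suc z)" by blast
    from Minimize.IH[OF z] obtain n1
      where n: "\<forall>m\<ge>n1. look (table r m) (prod_encode (code c, prod_encode (x, j))) = Suc (Suc z)"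
      by blast
    from step.IH obtain n2 w where n2: "look (table r n2) (?k (Suc j)) = Suc w"
      using not0_implies_Suc by blast
    show ?case
      using table_progress[of "max n1 n2" r 9] n table_mono[OF _ n2] by (simp add: infer_def)
  qed
  from this[of 0] obtain n w where n: "look (table r n) (?k 0) = Suc w"
    using not0_implies_Suc by blast
  have "\<exists>m. look (table r m) (prod_encode (code (Minimize c), x)) \<noteq> 0"
    using table_progress[of n r 8] table_mono[OF _ n] by (simp add: infer_def)
  with Minimize.prems show ?case using look_code_complete by blast
next
  case Zero
  have "\<exists>m. look (table r m) (prod_encode (code Zero, x)) \<noteq> 0"
    using table_progress[of 0] by (simp add: infer_def)
  with Zero show ?case using look_code_complete by blast
next
  case Succ
  have "\<exists>m. look (table r m) (prod_encode (code Succ, x)) \<noteq> 0"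
    using table_progress[of 0] by (simp add: infer_def)
  with Succ show ?case using look_code_complete by blast
next
  case Left
  have "\<exists>m. look (table r m) (prod_encode (code Left, x)) \<noteq> 0"
    using table_progress[of 0] by (simp add: infer_def)
  with Left show ?case using look_code_complete by blast
next
  case Right
  have "\<exists>m. look (table r m) (prod_encode (code Right, x)) \<noteq> 0"
    using table_progress[of 0] by (simp add: infer_def)
  with Right show ?case using look_code_complete by blast
next
  case Oracle
  have "\<exists>m. look (table r m) (prod_encode (code Oracle, x)) \<noteq> 0"
    using table_progress[of 0] by (simp add: infer_def)
  with Oracle show ?case using look_code_complete by blast
qed

text \<open>The test t vanishes exactly at the stages whose table has a value for the key, so
  \<open>Minimize t\<close> finds the first of them, and e reads off the value, with the
  \<open>Suc\<close> of a known result removed. One implication is enough, because a computable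
  function may be a restriction of what its program computes.\<close>

theorem universal_program:
  "\<exists>U. \<forall>r c x y. run r c x = Some y \<longrightarrow> run r U (prod_encode (code c, x)) = Some y"
proof -
  have "recf (\<lambda>r z. if look (table r (snd (prod_decode z))) (fst (prod_decode z)) = 0 then 1 else 0)"
    by (intro recf_intros)
  then obtain t where "\<forall>r z. run r t z = Some (if look (table r (snd (prod_decode z))) (fst (prod_decode z)) = 0 then 1 else 0)"
    unfolding recf_def by (elim exE)
  then have t: "run r t (prod_encode (x, n)) = Some (if look (table r n) x = 0 then 1 else 0)" for r x n
    by simp
  have "recf (\<lambda>r z. look (table r (snd (prod_decode z))) (fst (prod_decode z)) - 1)"
    by (intro recf_intros)
  then obtain e where "\<forall>r z. run r e z = Some (look (table r (snd (prod_decode z))) (fst (prod_decode z)) - 1)"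
    unfolding recf_def by (elim exE)
  then have e: "run r e (prod_encode (x, n)) = Some (look (table r n) x - 1)" for r x n
    by simp
  obtain i where i: "\<And>r x. run r i x = Some x"
    using recf_id unfolding recf_def by blast
  show ?thesis
  proof (intro exI allI impI)
    fix r c x y assume y: "run r c x = Some y"
    let ?k = "prod_encode (code c, x)"
    let ?n = "LEAST n. look (table r n) ?k \<noteq> 0"
    from table_complete[OF y] have ex: "\<exists>n. look (table r n) ?k \<noteq> 0"
      by (metis order_refl nat.distinct(1))
    have "run r (Minimize t) ?k = Some ?n"
      using LeastI_ex[OF ex] not_less_Least[of _ "\<lambda>n. look (table r n) ?k \<noteq> 0"]
      by (intro run_Minimize_Some) (auto simp: t)
    moreover obtain z where z: "look (table r ?n) ?k = Suc z"
      using LeastI_ex[OF ex] not0_implies_Suc by blast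
    ultimately show "run r (Compose e (Pairing i (Minimize t))) ?k = Some y"
      using sound_fact_code[OF table_sound[OF z]] y by (simp del: run.simps(9) add: i e)
  qed
qed

section \<open>Computable functions on Baire space\<close>

text \<open>Substitution of a functional into another: each query to an inner point s is answered by
  running e, which computes s from the outer oracle.\<close>

primrec subst_oracle :: "prog \<Rightarrow> prog \<Rightarrow> prog" where
  "subst_oracle e Zero = Zero"
| "subst_oracle e Succ = Succ"
| "subst_oracle e Left = Left"
| "subst_oracle e Right = Right"
| "subst_oracle e Oracle = e"
| "subst_oracle e (Pairing c d) = Pairing (subst_oracle e c) (subst_oracle e d)"
| "subst_oracle e (Compose c d) = Compose (subst_oracle e c) (subst_oracle e d)"
| "subst_oracle e (PrimRec c d) = PrimRec (subst_oracle e c) (subst_oracle e d)"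
| "subst_oracle e (Minimize c) = Minimize (subst_oracle e c)"

lemma run_subst_oracle:
  assumes "\<And>n. run r e n = Some (s n)"
  shows "run r (subst_oracle e c) = run s c"
proof -
  have e: "run r e = (\<lambda>n. Some (s n))" using assms by (rule ext)
  show ?thesis by (induction c) (simp_all add: e)
qed

lemma machine_eq_Some: "machine c r = Some q \<longleftrightarrow> (\<forall>n. run r c n = Some (q n))"
proof
  assume m: "machine c r = Some q"
  show "\<forall>n. run r c n = Some (q n)"
  proof
    fix n
    have "run r c n \<noteq> None" "q n = the (run r c n)"
      using m by (auto simp: machine_def split: if_splits)
    then show "run r c n = Some (q n)" by simp
  qed
qed (simp add: machine_def)

lemma computable_iff:
  "computable F \<longleftrightarrow> (\<exists>c. \<forall>r q. F r = Some q \<longrightarrow> (\<forall>n. run r c n = Some (q n)))"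
proof -
  have "F \<subseteq>\<^sub>m G \<longleftrightarrow> (\<forall>r q. F r = Some q \<longrightarrow> G r = Some q)" for G
    by (auto simp: map_le_def dom_def)
  then show ?thesis
    unfolding computable_def machine_eq_Some[symmetric] by simp
qed

section \<open>Closure properties of computable functions and the s-m-n theorem\<close>

lemma bfst_bpair [simp]: "bfst (bpair p q) = p"
  by (simp add: bfst_def bpair_def)

lemma bsnd_bpair [simp]: "bsnd (bpair p q) = q"
  by (simp add: bsnd_def bpair_def)

lemma bpair_bfst_bsnd [simp]: "bpair (bfst r) (bsnd r) = r"
  by (auto simp: bfst_def bsnd_def bpair_def fun_eq_iff)

lemma btl_case_nat [simp]: "btl (case_nat k p) = p"
  by (simp add: btl_def)

named_theorems computable_intros

text \<open>For f applied to its first argument alone, \<open>recf f\<close> says that f is a total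
  computable map of Baire space into itself. The rules that follow use this reading.\<close>

lemma recf_ident [computable_intros]: "recf (\<lambda>r. r)"
  using recf_oracle[OF recf_id] by simp

lemma recf_bfst [computable_intros]: "recf f \<Longrightarrow> recf (\<lambda>r. bfst (f r))"
  unfolding bfst_def by (rule recf_comp[of f "\<lambda>r x. 2 * x"]) (simp_all add: recf_intros)

lemma recf_bsnd [computable_intros]: "recf f \<Longrightarrow> recf (\<lambda>r. bsnd (f r))"
  unfolding bsnd_def by (rule recf_comp[of f "\<lambda>r x. 2 * x + 1"]) (simp_all add: recf_intros)

lemma recf_btl [computable_intros]: "recf f \<Longrightarrow> recf (\<lambda>r. btl (f r))"
  unfolding btl_def by (rule recf_comp[of f "\<lambda>r x. Suc x"]) (simp_all add: recf_intros)

lemma recf_bpair [computable_intros]: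
  assumes "recf f" "recf g"
  shows "recf (\<lambda>r. bpair (f r) (g r))"
  unfolding bpair_def
  by (intro recf_intros recf_comp[OF assms(1), of "\<lambda>r x. x div 2"]
      recf_comp[OF assms(2), of "\<lambda>r x. x div 2"])

lemma recf_cons [computable_intros]:
  assumes "recf f"
  shows "recf (\<lambda>r. case_nat k (f r))"
proof -
  have "recf (\<lambda>r z. f r (snd (prod_decode z)))"
    by (rule recf_comp[OF assms, of "\<lambda>r z. snd (prod_decode z)"]) (intro recf_intros)
  from recf_case_nat[OF recf_const recf_id this] show ?thesis by simp
qed

lemma computable_Some [computable_intros]: "recf f \<Longrightarrow> computable (\<lambda>r. Some (f r))"
  unfolding recf_def computable_iff by auto

lemma computable_bind [computable_intros]:
  assumes "computable A" "computable (\<lambda>z. B (bfst z) (bsnd z))"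
  shows "computable (\<lambda>r. Option.bind (A r) (\<lambda>y. B r y))"
proof -
  obtain c where c: "\<And>r q n. A r = Some q \<Longrightarrow> run r c n = Some (q n)"
    using assms(1) unfolding computable_iff by blast
  obtain d where d: "\<And>z q n. B (bfst z) (bsnd z) = Some q \<Longrightarrow> run z d n = Some (q n)"
    using assms(2) unfolding computable_iff by blast
  have "recf (\<lambda>r z. if even (fst (prod_decode z)) then r (fst (prod_decode z) div 2)
      else snd (prod_decode z))"
    by (intro recf_intros)
  then obtain e where e: "\<And>r z. run r e z = Some (if even (fst (prod_decode z))
      then r (fst (prod_decode z) div 2) else snd (prod_decode z))"
    unfolding recf_def by blast
  obtain h where h: "\<And>r x. run r h x = Some (x div 2)"
    using recf_half[OF recf_id] unfolding recf_def by blast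
  obtain i where i: "\<And>r x. run r i x = Some x"
    using recf_id unfolding recf_def by blast
  show ?thesis unfolding computable_iff
  proof (intro exI allI impI)
    fix r q n assume "Option.bind (A r) (\<lambda>y. B r y) = Some q"
    then obtain y where y: "A r = Some y" "B r y = Some q"
      by (auto simp: bind_eq_Some_conv)
    \<comment> \<open>The intermediate point y is never stored: even positions of
      \<open>bpair r y\<close> are read from the oracle r, odd ones are recomputed by c.\<close>
    have "run r (Compose e (Pairing i (Compose c h))) n = Some (bpair r y n)" for n
      using c[OF y(1)] by (simp add: i h e bpair_def)
    with d[of "bpair r y" q n] y(2)
    show "run r (subst_oracle (Compose e (Pairing i (Compose c h))) d) n = Some (q n)"
      by (subst run_subst_oracle[of r _ "bpair r y"]) simp_all
  qed
qed

lemma computable_app: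
  assumes "computable F" "recf e"
  shows "computable (\<lambda>r. F (e r))"
proof -
  obtain c where c: "\<And>r q n. F r = Some q \<Longrightarrow> run r c n = Some (q n)"
    using assms(1) unfolding computable_iff by blast
  obtain d where d: "\<And>r n. run r d n = Some (e r n)"
    using assms(2) unfolding recf_def by blast
  show ?thesis
    unfolding computable_iff using c by (intro exI[of _ "subst_oracle d c"]) (simp add: run_subst_oracle[OF d])
qed

text \<open>
  Both branches may diverge and programs have no lazy conditional, so the universal program is
  applied to the code of the selected branch.
\<close>

lemma computable_if [computable_intros]:
  assumes "recf f" "computable F" "computable G"
  shows "computable (\<lambda>r. if f r k = 0 then F r else G r)"
proof -
  obtain c where c: "\<And>r q n. F r = Some q \<Longrightarrow> run r c n = Some (q n)"
    using assms(2) unfolding computable_iff by blast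
  obtain d where d: "\<And>r q n. G r = Some q \<Longrightarrow> run r d n = Some (q n)"
    using assms(3) unfolding computable_iff by blast
  obtain U where U: "\<And>r c x y. run r c x = Some y \<Longrightarrow> run r U (prod_encode (code c, x)) = Some y"
    using universal_program by blast
  have "recf (\<lambda>r x. prod_encode (if f r k = 0 then code c else code d, x))"
    by (intro recf_intros recf_comp[OF assms(1), of "\<lambda>r x. k"])
  then obtain e where e: "\<And>r x. run r e x = Some (prod_encode (if f r k = 0 then code c else code d, x))"
    unfolding recf_def by blast
  show ?thesis unfolding computable_iff
    by (rule exI[of _ "Compose U e"]) (auto simp: e c d U split: if_splits)
qed

lemma computable_Phi [computable_intros]:
  assumes "recf a" "recf b"
  shows "computable (\<lambda>r. Phi (a r) (b r))"
proof -
  obtain U where U: "\<And>r c x y. run r c x = Some y \<Longrightarrow> run r U (prod_encode (code c, x)) = Some y"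
    using universal_program by blast
  \<comment> \<open>Symbol 0 of the combined input is symbol 0 of its first half, which is where
    \<open>Phi\<close> expects the code.\<close>
  have "recf (\<lambda>r x. prod_encode (r 0, x))"
    by (intro recf_intros)
  then obtain e where e: "\<And>r x. run r e x = Some (prod_encode (r 0, x))"
    unfolding recf_def by blast
  have inj: "inj code" by (simp add: inj_def code_inject)
  have "computable (\<lambda>r. Phi (bfst r) (bsnd r))"
    unfolding computable_iff
  proof (intro exI allI impI)
    fix r q n assume "Phi (bfst r) (bsnd r) = Some q"
    then obtain c where "r 0 = code c" "machine c r = Some q"
      using fun_cong[OF bfst_def, of r 0] by (auto simp: Phi_def inv_f_f[OF inj] split: if_splits)
    then show "run r (Compose U e) n = Some (q n)"
      by (auto simp: e machine_def intro!: U split: if_splits)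
  qed
  from computable_app[OF this recf_bpair[OF assms]] show ?thesis by simp
qed

text \<open>The s-m-n theorem for \<open>Phi\<close>: T puts the code of a fixed program in front of
  x, and that program recovers the parameter x as \<open>btl\<close> of the first half of its
  input.\<close>

lemma Phi_param:
  assumes "computable F"
  obtains T where "recf T" "\<And>x y z. F (bpair x y) = Some z \<Longrightarrow> Phi (T x) y = Some z"
proof -
  have "computable (\<lambda>r. F (bpair (btl (bfst r)) (bsnd r)))"
    by (intro computable_intros computable_app[OF assms])
  then obtain c where c: "\<And>r q n. F (bpair (btl (bfst r)) (bsnd r)) = Some q \<Longrightarrow> run r c n = Some (q n)"
    unfolding computable_iff by blast
  have inj: "inj code" by (simp add: inj_def code_inject)
  show ?thesis
  proof (rule that[of "\<lambda>r. case_nat (code c) r"])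
    show "recf (\<lambda>r. case_nat (code c) r)"
      by (intro computable_intros)
    fix x y z assume "F (bpair x y) = Some z"
    then have "run (bpair (case_nat (code c) x) y) c n = Some (z n)" for n
      using c[of "bpair (case_nat (code c) x) y" z] by simp
    then have "machine c (bpair (case_nat (code c) x) y) = Some z"
      by (simp add: machine_def)
    then show "Phi (case_nat (code c) x) y = Some z"
      by (simp add: Phi_def inv_f_f[OF inj])
  qed
qed

section \<open>Problems as relations between names\<close>

type_synonym baire_rel = "baire \<Rightarrow> baire \<Rightarrow> bool"

definition name_rel :: "('a, 'b) problem \<Rightarrow> baire_rel" where
  "name_rel f p q \<longleftrightarrow> (\<exists>x y. src f p = Some x \<and> trg f q = Some y \<and> y \<in> val f x)"

definition red :: "baire_rel \<Rightarrow> baire_rel \<Rightarrow> bool" where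
  "red R S \<longleftrightarrow> (\<exists>H K. computable H \<and> computable K \<and>
     (\<forall>p. Domainp R p \<longrightarrow> (\<exists>q. H p = Some q \<and> Domainp S q \<and>
        (\<forall>s. S q s \<longrightarrow> (\<exists>t. K (bpair p s) = Some t \<and> R p t)))))"

definition solves :: "(baire \<Rightarrow> baire option) \<Rightarrow> baire_rel \<Rightarrow> bool" where
  "solves F R \<longleftrightarrow> (\<forall>p. Domainp R p \<longrightarrow> (\<exists>q. F p = Some q \<and> R p q))"

lemma is_problem_iff:
  "is_problem f \<longleftrightarrow> (\<forall>x. \<forall>y\<in>val f x. \<exists>p q. src f p = Some x \<and> trg f q = Some y)"
  by (auto simp: is_problem_def ran_def mdom_def subset_iff)

lemma is_problemD: "is_problem f \<Longrightarrow> y \<in> val f x \<Longrightarrow> \<exists>p q. src f p = Some x \<and> trg f q = Some y"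
  by (simp add: is_problem_iff)

lemma is_problemI:
  "(\<And>x y. y \<in> val f x \<Longrightarrow> \<exists>p q. src f p = Some x \<and> trg f q = Some y) \<Longrightarrow> is_problem f"
  by (simp add: is_problem_iff)

lemma Domainp_name_rel:
  assumes "is_problem f"
  shows "Domainp (name_rel f) p \<longleftrightarrow> (\<exists>x. src f p = Some x \<and> x \<in> mdom (val f))"
proof
  assume "Domainp (name_rel f) p"
  then show "\<exists>x. src f p = Some x \<and> x \<in> mdom (val f)"
    by (auto simp: name_rel_def mdom_def elim!: DomainpE)
next
  assume "\<exists>x. src f p = Some x \<and> x \<in> mdom (val f)"
  then obtain x y where x: "src f p = Some x" "y \<in> val f x"
    by (auto simp: mdom_def)
  then obtain q where "trg f q = Some y"
    using is_problemD[OF assms] by blast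
  with x have "name_rel f p q"
    by (auto simp: name_rel_def)
  then show "Domainp (name_rel f) p" by (rule DomainPI[of "name_rel f"])
qed

lemma realizes_iff_solves:
  assumes "is_problem f"
  shows "realizes F f \<longleftrightarrow> solves F (name_rel f)"
proof -
  have "name_rel f p q \<longleftrightarrow> (\<exists>y. trg f q = Some y \<and> y \<in> val f x)" if "src f p = Some x" for p q x
    using that by (simp add: name_rel_def)
  then show ?thesis
    unfolding realizes_def solves_def Domainp_name_rel[OF assms] by (auto; blast)
qed

text \<open>The equivalence holds for each fixed pair H, K. From realizers to relations, a realizer
  obtained by choice is changed at the one point queried, so that \<open>K\<close> is tested on
  every possible answer.\<close>

lemma red_iff_solves:
  "red R S \<longleftrightarrow> (\<exists>K H. computable K \<and> computable H \<and>
     (\<forall>G. solves G S \<longrightarrow> solves (\<lambda>p. Option.bind ((G \<circ>\<^sub>m H) p) (\<lambda>r. K (bpair p r))) R))"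
proof -
  have "(\<forall>p. Domainp R p \<longrightarrow> (\<exists>q. H p = Some q \<and> Domainp S q \<and>
          (\<forall>s. S q s \<longrightarrow> (\<exists>t. K (bpair p s) = Some t \<and> R p t)))) \<longleftrightarrow>
        (\<forall>G. solves G S \<longrightarrow> solves (\<lambda>p. Option.bind ((G \<circ>\<^sub>m H) p) (\<lambda>r. K (bpair p r))) R)"
    (is "?L \<longleftrightarrow> ?R") for K H
  proof
    assume L: ?L
    show ?R
      unfolding solves_def
    proof (intro allI impI)
      fix G p assume G: "\<forall>p. Domainp S p \<longrightarrow> (\<exists>q. G p = Some q \<and> S p q)" and "Domainp R p"
      then obtain q where q: "H p = Some q" "Domainp S q"
        "\<And>s. S q s \<Longrightarrow> \<exists>t. K (bpair p s) = Some t \<and> R p t" using L by blast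
      then obtain s where "G q = Some s" "S q s" using G by blast
      then show "\<exists>q. Option.bind ((G \<circ>\<^sub>m H) p) (\<lambda>r. K (bpair p r)) = Some q \<and> R p q"
        using q by (simp add: map_comp_def)
    qed
  next
    assume R: ?R
    \<comment> \<open>Undefined off the domain of S, so a successful run shows that the query is an
      instance of S.\<close>
    define G where "G = (\<lambda>q. if Domainp S q then Some (SOME s. S q s) else None)"
    have "S q (SOME s. S q s)" if "Domainp S q" for q
      using that by (rule DomainpE) (rule someI[of "S q"])
    then have G: "solves G S"
      unfolding solves_def G_def by simp
    show ?L
    proof (intro allI impI)
      fix p assume p: "Domainp R p"
      then obtain t where t: "Option.bind ((G \<circ>\<^sub>m H) p) (\<lambda>r. K (bpair p r)) = Some t"
        using R[rule_format, OF G] unfolding solves_def by blast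
      then obtain q where q: "H p = Some q" "Domainp S q"
        by (auto simp: map_comp_def G_def bind_eq_Some_conv split: option.splits if_splits)
      moreover have "\<exists>t. K (bpair p s) = Some t \<and> R p t" if s: "S q s" for s
      proof -
        \<comment> \<open>The realizer that returns the prescribed solution s at the query
          q.\<close>
        have "solves (G(q \<mapsto> s)) S"
          using G s unfolding solves_def by simp
        from R[rule_format, OF this] p
        obtain t where "Option.bind ((G(q \<mapsto> s) \<circ>\<^sub>m H) p) (\<lambda>r. K (bpair p r)) = Some t" "R p t"
          unfolding solves_def by blast
        then show ?thesis using q by (simp add: map_comp_def)
      qed
      ultimately show "\<exists>q. H p = Some q \<and> Domainp S q \<and>
          (\<forall>s. S q s \<longrightarrow> (\<exists>t. K (bpair p s) = Some t \<and> R p t))" by blast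
    qed
  qed
  then show ?thesis unfolding red_def by blast
qed

lemma weihrauch_le_iff_red:
  assumes "is_problem f" "is_problem g"
  shows "weihrauch_le f g \<longleftrightarrow> red (name_rel f) (name_rel g)"
  unfolding weihrauch_le_def red_iff_solves assms[THEN realizes_iff_solves] ..

section \<open>The operations as relations between names\<close>

definition rtimes :: "baire_rel \<Rightarrow> baire_rel \<Rightarrow> baire_rel" where
  "rtimes F G p q \<longleftrightarrow> F (bfst p) (bfst q) \<and> G (bsnd p) (bsnd q)"

definition rsqcup :: "baire_rel \<Rightarrow> baire_rel \<Rightarrow> baire_rel" where
  "rsqcup F G p q \<longleftrightarrow>
     p 0 = 0 \<and> q 0 = 0 \<and> F (btl p) (btl q) \<or> p 0 = 1 \<and> q 0 = 1 \<and> G (btl p) (btl q)"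

definition rsqcap :: "baire_rel \<Rightarrow> baire_rel \<Rightarrow> baire_rel" where
  "rsqcap F G p q \<longleftrightarrow> Domainp F (bfst p) \<and> Domainp G (bsnd p) \<and>
     (q 0 = 0 \<and> F (bfst p) (btl q) \<or> q 0 = 1 \<and> G (bsnd p) (btl q))"

text \<open>\<open>bfst p\<close> names the intermediate function and \<open>bsnd p\<close> the
  instance of G. The second half of r is the free half from the cylinder. The first clause merges
  the domain conditions of the two nested compositions: every run of the named function, on every
  solution and every free half, must end in an instance of F.\<close>

definition rstar :: "baire_rel \<Rightarrow> baire_rel \<Rightarrow> baire_rel" where
  "rstar F G p q \<longleftrightarrow>
     (\<forall>r. G (bsnd p) (bfst r) \<longrightarrow> (\<exists>w. Phi (bfst p) r = Some w \<and> Domainp F (bsnd w))) \<and>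
     (\<exists>r w. G (bsnd p) (bfst r) \<and> Phi (bfst p) r = Some w \<and>
        bfst q = bfst w \<and> F (bsnd w) (bsnd q))"

definition rimpl :: "baire_rel \<Rightarrow> baire_rel \<Rightarrow> baire_rel" where
  "rimpl G F p q \<longleftrightarrow> Domainp G (bsnd q) \<and> Domainp F p \<and>
     (\<forall>r. G (bsnd q) (bfst r) \<longrightarrow> (\<exists>w. Phi (bfst q) r = Some w \<and> F p w))"

lemma prod_space_eq_Some:
  "prod_space dX dY r = Some z \<longleftrightarrow> dX (bfst r) = Some (fst z) \<and> dY (bsnd r) = Some (snd z)"
  by (cases z) (auto simp: prod_space_def split: option.splits)

lemma sum_space_eq_Some:
  "sum_space dX dY r = Some z \<longleftrightarrow>
     (\<exists>x. z = Inl x \<and> r 0 = 0 \<and> dX (btl r) = Some x) \<or>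
     (\<exists>y. z = Inr y \<and> r 0 = 1 \<and> dY (btl r) = Some y)"
  by (auto simp: sum_space_def)

lemma is_problem_prob_times:
  assumes "is_problem f" "is_problem g"
  shows "is_problem (prob_times f g)"
proof (rule is_problemI)
  fix x y assume "y \<in> val (prob_times f g) x"
  then have "fst y \<in> val f (fst x)" "snd y \<in> val g (snd x)"
    by (auto simp: prob_times_def split: prod.splits)
  then obtain p q p' q' where "src f p = Some (fst x)" "trg f q = Some (fst y)"
    "src g p' = Some (snd x)" "trg g q' = Some (snd y)"
    using assms[THEN is_problemD] by blast
  then have "src (prob_times f g) (bpair p p') = Some x" "trg (prob_times f g) (bpair q q') = Some y"
    by (simp_all add: prob_times_def prod_space_eq_Some)
  then show "\<exists>p q. src (prob_times f g) p = Some x \<and> trg (prob_times f g) q = Some y"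
    by blast
qed

lemma name_rel_prob_times: "name_rel (prob_times f g) = rtimes (name_rel f) (name_rel g)"
  by (auto simp: fun_eq_iff name_rel_def prob_times_def rtimes_def prod_space_eq_Some)

lemma is_problem_prob_sqcup:
  assumes "is_problem f" "is_problem g"
  shows "is_problem (prob_sqcup f g)"
proof (rule is_problemI)
  fix x y assume y: "y \<in> val (prob_sqcup f g) x"
  have *: "sum_space dX dY (case_nat 0 p) = map_option Inl (dX p)"
    "sum_space dX dY (case_nat 1 p) = map_option Inr (dY p)" for dX dY p
    by (simp_all add: sum_space_def)
  show "\<exists>p q. src (prob_sqcup f g) p = Some x \<and> trg (prob_sqcup f g) q = Some y"
  proof (cases x)
    case (Inl a)
    then obtain b where b: "y = Inl b" "b \<in> val f a"
      using y by (auto simp: prob_sqcup_def)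
    obtain p q where "src f p = Some a" "trg f q = Some b"
      using is_problemD[OF assms(1) b(2)] by blast
    then show ?thesis using Inl b(1)
      by (intro exI[of _ "case_nat 0 p"] exI[of _ "case_nat 0 q"]) (simp add: prob_sqcup_def *)
  next
    case (Inr a)
    then obtain b where b: "y = Inr b" "b \<in> val g a"
      using y by (auto simp: prob_sqcup_def)
    obtain p q where "src g p = Some a" "trg g q = Some b"
      using is_problemD[OF assms(2) b(2)] by blast
    then show ?thesis using Inr b(1)
      by (intro exI[of _ "case_nat 1 p"] exI[of _ "case_nat 1 q"]) (simp add: prob_sqcup_def * del: One_nat_def)
  qed
qed

lemma name_rel_prob_sqcup: "name_rel (prob_sqcup f g) = rsqcup (name_rel f) (name_rel g)"
  by (auto simp: fun_eq_iff name_rel_def prob_sqcup_def rsqcup_def sum_space_eq_Some)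

lemma is_problem_prob_sqcap:
  assumes "is_problem f" "is_problem g"
  shows "is_problem (prob_sqcap f g)"
proof (rule is_problemI)
  fix x y assume y: "y \<in> val (prob_sqcap f g) x"
  have *: "sum_space dX dY (case_nat 0 p) = map_option Inl (dX p)"
    "sum_space dX dY (case_nat 1 p) = map_option Inr (dY p)" for dX dY p
    by (simp_all add: sum_space_def)
  from y have d: "fst x \<in> mdom (val f)" "snd x \<in> mdom (val g)"
    and y': "(\<exists>b. y = Inl b \<and> b \<in> val f (fst x)) \<or> (\<exists>b. y = Inr b \<and> b \<in> val g (snd x))"
    by (auto simp: prob_sqcap_def split: prod.splits if_splits)
  from d obtain p q where "src f p = Some (fst x)" "src g q = Some (snd x)"
    using assms[THEN is_problemD] unfolding mdom_def by blast
  then have "src (prob_sqcap f g) (bpair p q) = Some x"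
    by (simp add: prob_sqcap_def prod_space_eq_Some)
  moreover have "\<exists>q. trg (prob_sqcap f g) q = Some y"
    using y'
  proof (elim disjE exE conjE)
    fix b assume "y = Inl b" "b \<in> val f (fst x)"
    then show ?thesis using is_problemD[OF assms(1), of b "fst x"]
      by (fastforce simp: prob_sqcap_def intro: *(1)[THEN trans])
  next
    fix b assume "y = Inr b" "b \<in> val g (snd x)"
    then show ?thesis using is_problemD[OF assms(2), of b "snd x"]
      by (fastforce simp: prob_sqcap_def simp del: One_nat_def intro: *(2)[THEN trans])
  qed
  ultimately show "\<exists>p q. src (prob_sqcap f g) p = Some x \<and> trg (prob_sqcap f g) q = Some y"
    by blast
qed

lemma name_rel_prob_sqcap:
  assumes "is_problem f" "is_problem g"
  shows "name_rel (prob_sqcap f g) = rsqcap (name_rel f) (name_rel g)"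
proof (intro ext)
  fix p q
  have "name_rel (prob_sqcap f g) p q \<longleftrightarrow> (\<exists>x u. src f (bfst p) = Some x \<and> src g (bsnd p) = Some u \<and>
      x \<in> mdom (val f) \<and> u \<in> mdom (val g) \<and>
      ((\<exists>y. q 0 = 0 \<and> trg f (btl q) = Some y \<and> y \<in> val f x) \<or>
       (\<exists>y. q 0 = 1 \<and> trg g (btl q) = Some y \<and> y \<in> val g u)))"
    unfolding name_rel_def prob_sqcap_def problem.simps prod_space_eq_Some
    by (force simp: sum_space_eq_Some)
  then show "name_rel (prob_sqcap f g) p q = rsqcap (name_rel f) (name_rel g) p q"
    unfolding rsqcap_def assms[THEN Domainp_name_rel] name_rel_def by auto
qed

lemma mem_mcomp_mv_of:
  "z \<in> mcomp (mv_of F) g x \<longleftrightarrow> (\<forall>y\<in>g x. F y \<noteq> None) \<and> (\<exists>y\<in>g x. F y = Some z)"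
proof -
  have mv: "mv_of F y = {z. F y = Some z}" for y
    by (cases "F y") (simp_all add: mv_of_def)
  have "g x \<subseteq> mdom (mv_of F) \<longleftrightarrow> (\<forall>y\<in>g x. F y \<noteq> None)"
    by (simp add: mdom_def mv subset_iff Ball_def)
  then show ?thesis
    by (simp add: mcomp_def mv)
qed

text \<open>The domain conditions of the two nested compositions merge into the universal clause:
  under the inner condition, the set of outputs of \<open>Phi p\<close> consists of its values at
  all names of x.\<close>

lemma mem_PhiXY:
  "y \<in> PhiXY dX dY p x \<longleftrightarrow>
     (\<forall>r. dX (bfst r) = Some x \<longrightarrow> (\<exists>w. Phi p r = Some w \<and> dY w \<noteq> None)) \<and>
     (\<exists>r w. dX (bfst r) = Some x \<and> Phi p r = Some w \<and> dY w = Some y)"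
  (is "_ \<longleftrightarrow> ?A \<and> ?B")
proof -
  let ?M = "mcomp (mv_of (Phi p)) (\<lambda>x. {r. cyl dX r = Some x}) x"
  have M: "w \<in> ?M \<longleftrightarrow> (\<forall>r. dX (bfst r) = Some x \<longrightarrow> (\<exists>v. Phi p r = Some v)) \<and>
      (\<exists>r. dX (bfst r) = Some x \<and> Phi p r = Some w)" for w
    unfolding mem_mcomp_mv_of cyl_def by simp
  have "y \<in> PhiXY dX dY p x \<longleftrightarrow> (\<forall>w\<in>?M. dY w \<noteq> None) \<and> (\<exists>w\<in>?M. dY w = Some y)"
    unfolding PhiXY_def by (rule mem_mcomp_mv_of)
  also have "\<dots> \<longleftrightarrow> ?A \<and> ?B"
  proof
    assume L: "(\<forall>w\<in>?M. dY w \<noteq> None) \<and> (\<exists>w\<in>?M. dY w = Some y)"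
    then obtain w where w: "w \<in> ?M" "dY w = Some y" by blast
    have ?A
    proof (intro allI impI)
      fix r assume r: "dX (bfst r) = Some x"
      with w(1) obtain v where v: "Phi p r = Some v" unfolding M by blast
      have "v \<in> ?M" using w(1) r v unfolding M by blast
      with L v show "\<exists>w. Phi p r = Some w \<and> dY w \<noteq> None" by blast
    qed
    moreover have ?B using w unfolding M by blast
    ultimately show "?A \<and> ?B" ..
  next
    assume R: "?A \<and> ?B"
    have "\<exists>v. Phi p r = Some v" if "dX (bfst r) = Some x" for r
      using R that by blast
    then have M': "w \<in> ?M \<longleftrightarrow> (\<exists>r. dX (bfst r) = Some x \<and> Phi p r = Some w)" for w
      unfolding M by blast
    have "dY w \<noteq> None" if "w \<in> ?M" for w
    proof -
      from that obtain r where r: "dX (bfst r) = Some x" "Phi p r = Some w"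
        unfolding M' by blast
      with R obtain v where "Phi p r = Some v" "dY v \<noteq> None" by blast
      with r show ?thesis by simp
    qed
    moreover from R have "\<exists>w. (\<exists>r. dX (bfst r) = Some x \<and> Phi p r = Some w) \<and> dY w = Some y"
      by blast
    then have "\<exists>w\<in>?M. dY w = Some y"
      by (simp only: M' Bex_def)
    ultimately show "(\<forall>w\<in>?M. dY w \<noteq> None) \<and> (\<exists>w\<in>?M. dY w = Some y)"
      by (intro conjI ballI)
  qed
  finally show ?thesis .
qed

lemma mem_mcomp_PhiXY:
  assumes g: "is_problem g"
  shows "z \<in> mcomp (PhiXY (trg g) dZ p) (val g) x \<longleftrightarrow>
     (\<forall>r y. trg g (bfst r) = Some y \<longrightarrow> y \<in> val g x \<longrightarrow> (\<exists>w. Phi p r = Some w \<and> dZ w \<noteq> None)) \<and>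
     (\<exists>r y w. trg g (bfst r) = Some y \<and> y \<in> val g x \<and> Phi p r = Some w \<and> dZ w = Some z)"
proof -
  have dom: "y \<in> mdom (PhiXY (trg g) dZ p) \<longleftrightarrow>
    (\<forall>r. trg g (bfst r) = Some y \<longrightarrow> (\<exists>w. Phi p r = Some w \<and> dZ w \<noteq> None))" (is "?L \<longleftrightarrow> ?R")
    if y: "y \<in> val g x" for y
  proof
    assume ?L
    then obtain z where "z \<in> PhiXY (trg g) dZ p y" by (auto simp: mdom_def)
    then show ?R unfolding mem_PhiXY by (rule conjunct1)
  next
    assume R: ?R
    obtain q where "trg g q = Some y" using is_problemD[OF g y] by blast
    \<comment> \<open>A name with its free half filled; any filling would do, and q is at
      hand.\<close>
    then have q: "trg g (bfst (bpair q q)) = Some y" by simp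
    with R obtain w where w: "Phi p (bpair q q) = Some w" "dZ w \<noteq> None" by blast
    then obtain z where "dZ w = Some z" by blast
    then have "z \<in> PhiXY (trg g) dZ p y"
      unfolding mem_PhiXY using R q w by blast
    then show ?L by (auto simp: mdom_def)
  qed
  show ?thesis (is "_ \<longleftrightarrow> ?A \<and> ?B")
  proof (cases "val g x \<subseteq> mdom (PhiXY (trg g) dZ p)")
    case True
    then have ?A using dom by blast
    have "z \<in> PhiXY (trg g) dZ p y \<longleftrightarrow>
        (\<exists>r w. trg g (bfst r) = Some y \<and> Phi p r = Some w \<and> dZ w = Some z)" if "y \<in> val g x" for y
      unfolding mem_PhiXY using \<open>?A\<close> that by blast
    then have "(\<exists>y\<in>val g x. z \<in> PhiXY (trg g) dZ p y) \<longleftrightarrow> ?B"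
      by blast
    moreover have "z \<in> mcomp (PhiXY (trg g) dZ p) (val g) x \<longleftrightarrow>
        (\<exists>y\<in>val g x. z \<in> PhiXY (trg g) dZ p y)"
      using True by (simp only: mcomp_def if_True UN_iff)
    ultimately show ?thesis using \<open>?A\<close> by blast
  next
    case False
    then have "\<not> ?A" using dom by blast
    with False show ?thesis by (simp only: mcomp_def if_False empty_iff simp_thms)
  qed
qed

lemma M_space_eq_Some: "M_space dX dY p = Some h \<longleftrightarrow> h = PhiXY dX dY p"
  by (auto simp: M_space_def)

lemma is_problem_prob_star:
  assumes "is_problem f" "is_problem g"
  shows "is_problem (prob_star f g)"
proof (rule is_problemI)
  fix hx bv assume "bv \<in> val (prob_star f g) hx"
  then obtain h x b v u y where hx: "hx = (h, x)" "bv = (b, v)"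
    and h: "h \<in> ran (M_space (trg g) (prod_space baire_space (src f)))"
    and v: "v \<in> val f u" and y: "y \<in> val g x"
    by (cases hx; cases bv)
      (auto simp: prob_star_def prob_comp_def prob_times_def prob_id_def prob_transpose_def
        mcomp_def split: if_splits)
  obtain k where "M_space (trg g) (prod_space baire_space (src f)) k = Some h"
    using h unfolding ran_def by blast
  moreover obtain p where "src g p = Some x"
    using is_problemD[OF assms(2) y] by blast
  moreover obtain q where "trg f q = Some v"
    using is_problemD[OF assms(1) v] by blast
  ultimately have "src (prob_star f g) (bpair k p) = Some hx"
    "trg (prob_star f g) (bpair b q) = Some bv"
    by (simp_all add: hx prob_star_def prob_comp_def prob_times_def prob_transpose_def prob_id_def
      prod_space_eq_Some baire_space_def)
  then show "\<exists>p q. src (prob_star f g) p = Some hx \<and> trg (prob_star f g) q = Some bv"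
    by blast
qed

lemma name_rel_prob_star:
  assumes f: "is_problem f" and g: "is_problem g"
  shows "name_rel (prob_star f g) = rstar (name_rel f) (name_rel g)"
proof (intro ext)
  fix p q
  let ?Z = "prod_space baire_space (src f)"
  \<comment> \<open>The possible results of the intermediate function: pairs of a point to be passed
    through and an instance of f.\<close>
  define T where "T = (\<lambda>x. mcomp (PhiXY (trg g) ?Z (bfst p)) (val g) x)"
  have Z: "?Z w = Some z \<longleftrightarrow> fst z = bfst w \<and> src f (bsnd w) = Some (snd z)" for w z
    by (auto simp: prod_space_eq_Some baire_space_def)
  have T: "z \<in> T x \<longleftrightarrow>
     (\<forall>r y. trg g (bfst r) = Some y \<longrightarrow> y \<in> val g x \<longrightarrow>
        (\<exists>w. Phi (bfst p) r = Some w \<and> src f (bsnd w) \<noteq> None)) \<and>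
     (\<exists>r y w. trg g (bfst r) = Some y \<and> y \<in> val g x \<and> Phi (bfst p) r = Some w \<and>
        fst z = bfst w \<and> src f (bsnd w) = Some (snd z))" for z x
  proof -
    have "?Z w \<noteq> None \<longleftrightarrow> src f (bsnd w) \<noteq> None" for w
      by (auto simp: prod_space_def baire_space_def split: option.splits)
    then show ?thesis
      unfolding T_def mem_mcomp_PhiXY[OF g] by (simp add: Z)
  qed
  have dom: "Domainp (name_rel f) w \<longleftrightarrow> (\<exists>u. src f w = Some u \<and> val f u \<noteq> {})" for w
    unfolding Domainp_name_rel[OF f] mdom_def by simp
  have "name_rel (prob_star f g) p q \<longleftrightarrow>
    (\<exists>x v. src g (bsnd p) = Some x \<and> trg f (bsnd q) = Some v \<and>
      (\<forall>z\<in>T x. val f (snd z) \<noteq> {}) \<and> (\<exists>u. (bfst q, u) \<in> T x \<and> v \<in> val f u))"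
  proof -
    have m: "mdom (\<lambda>(x, u). {x} \<times> val f u) = {z. val f (snd z) \<noteq> {}}"
      by (auto simp: mdom_def)
    have r: "PhiXY (trg g) ?Z (bfst p) \<in> ran (M_space (trg g) ?Z)"
      by (auto simp: ran_def M_space_def)
    have V: "(b, v) \<in> val (prob_star f g) (PhiXY (trg g) ?Z (bfst p), x) \<longleftrightarrow>
        (\<forall>z\<in>T x. val f (snd z) \<noteq> {}) \<and> (\<exists>u. (b, u) \<in> T x \<and> v \<in> val f u)" for b v x
      unfolding prob_star_def prob_comp_def prob_times_def prob_transpose_def prob_id_def
        problem.simps mcomp_def[of "\<lambda>(x, u). {x} \<times> val f u"] m
      using r by (auto simp: T_def)
    have S: "src (prob_star f g) p = Some z \<longleftrightarrow>
        fst z = PhiXY (trg g) ?Z (bfst p) \<and> src g (bsnd p) = Some (snd z)" for z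
      by (auto simp: prob_star_def prob_comp_def prob_transpose_def prod_space_eq_Some M_space_def)
    have Q: "trg (prob_star f g) q = Some z \<longleftrightarrow> fst z = bfst q \<and> trg f (bsnd q) = Some (snd z)" for z
      by (auto simp: prob_star_def prob_comp_def prob_times_def prob_id_def baire_space_def
        prod_space_eq_Some)
    show ?thesis
      unfolding name_rel_def S Q split_paired_Ex fst_conv snd_conv using V by blast
  qed
  also have "\<dots> \<longleftrightarrow> rstar (name_rel f) (name_rel g) p q"
    unfolding rstar_def
  proof (intro iffI conjI allI impI; (elim exE conjE)?)
    fix x v u r assume x: "src g (bsnd p) = Some x"
      and T1: "\<forall>z\<in>T x. val f (snd z) \<noteq> {}" and T2: "(bfst q, u) \<in> T x"
      and r: "name_rel g (bsnd p) (bfst r)"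
    from r x obtain y where y: "trg g (bfst r) = Some y" "y \<in> val g x"
      by (auto simp: name_rel_def)
    from T2 y obtain w u where w: "Phi (bfst p) r = Some w" "src f (bsnd w) = Some u"
      unfolding T by blast
    have "(bfst w, u) \<in> T x"
      using T2 w y unfolding T by auto
    with T1 w show "\<exists>w. Phi (bfst p) r = Some w \<and> Domainp (name_rel f) (bsnd w)"
      unfolding dom by auto
  next
    fix x v u assume "src g (bsnd p) = Some x" "trg f (bsnd q) = Some v"
      "(bfst q, u) \<in> T x" "v \<in> val f u"
    then show "\<exists>r w. name_rel g (bsnd p) (bfst r) \<and> Phi (bfst p) r = Some w \<and>
        bfst q = bfst w \<and> name_rel f (bsnd w) (bsnd q)"
      unfolding T name_rel_def by fastforce
  next
    fix r w
    assume D: "\<forall>r. name_rel g (bsnd p) (bfst r) \<longrightarrow>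
        (\<exists>w. Phi (bfst p) r = Some w \<and> Domainp (name_rel f) (bsnd w))"
      and r: "name_rel g (bsnd p) (bfst r)" and w: "Phi (bfst p) r = Some w"
      "bfst q = bfst w" "name_rel f (bsnd w) (bsnd q)"
    from r obtain x y where x: "src g (bsnd p) = Some x" "trg g (bfst r) = Some y" "y \<in> val g x"
      by (auto simp: name_rel_def)
    have N: "name_rel g (bsnd p) (bfst r) \<longleftrightarrow> (\<exists>y. trg g (bfst r) = Some y \<and> y \<in> val g x)" for r
      using x by (auto simp: name_rel_def)
    have D': "\<exists>w u. Phi (bfst p) r = Some w \<and> src f (bsnd w) = Some u \<and> val f u \<noteq> {}"
      if "trg g (bfst r) = Some y" "y \<in> val g x" for r y
      using D that unfolding N dom by blast
    \<comment> \<open>The first clause of \<open>rstar\<close> already guarantees the universal half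
      of membership in \<open>T x\<close>; what remains is the existential half.\<close>
    have T': "z \<in> T x \<longleftrightarrow>
      (\<exists>r y w. trg g (bfst r) = Some y \<and> y \<in> val g x \<and> Phi (bfst p) r = Some w \<and>
        fst z = bfst w \<and> src f (bsnd w) = Some (snd z))" for z
      unfolding T by (rule iffI, rule conjunct2, assumption, rule conjI, use D' in fastforce)
    have "\<forall>z\<in>T x. val f (snd z) \<noteq> {}"
    proof
      fix z assume "z \<in> T x"
      then obtain r y w where z: "trg g (bfst r) = Some y" "y \<in> val g x" "Phi (bfst p) r = Some w"
        "src f (bsnd w) = Some (snd z)"
        unfolding T' by blast
      from D'[OF z(1,2)] z(3,4) show "val f (snd z) \<noteq> {}" by auto
    qed
    moreover obtain u v where "src f (bsnd w) = Some u" "trg f (bsnd q) = Some v" "v \<in> val f u"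
      using w(3) by (auto simp: name_rel_def)
    moreover from this have "(bfst q, u) \<in> T x"
      unfolding T' using w x by auto
    ultimately show "\<exists>x v. src g (bsnd p) = Some x \<and> trg f (bsnd q) = Some v \<and>
      (\<forall>z\<in>T x. val f (snd z) \<noteq> {}) \<and> (\<exists>u. (bfst q, u) \<in> T x \<and> v \<in> val f u)"
      using x by blast
  qed
  finally show "name_rel (prob_star f g) p q \<longleftrightarrow> rstar (name_rel f) (name_rel g) p q" .
qed

lemma is_problem_prob_impl:
  assumes "is_problem f" "is_problem g"
  shows "is_problem (prob_impl g f)"
proof (rule is_problemI)
  fix u hx assume "hx \<in> val (prob_impl g f) u"
  then obtain h x where hx: "hx = (h, x)" and h: "h \<in> ran (M_space (trg g) (trg f))"
    and x: "x \<in> mdom (mcomp h (val g))" "mcomp h (val g) x \<subseteq> val f u"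
    by (auto simp: prob_impl_def)
  then obtain v y where "v \<in> val f u" "y \<in> val g x"
    unfolding mdom_def mcomp_def by (auto split: if_splits)
  then obtain p q where "src f p = Some u" "src g q = Some x"
    using assms[THEN is_problemD] by blast
  moreover obtain k where "M_space (trg g) (trg f) k = Some h"
    using h unfolding ran_def by blast
  ultimately have "src (prob_impl g f) p = Some u"
    "trg (prob_impl g f) (bpair k q) = Some hx"
    by (simp_all add: hx prob_impl_def prod_space_eq_Some)
  then show "\<exists>p q. src (prob_impl g f) p = Some u \<and> trg (prob_impl g f) q = Some hx"
    by blast
qed

lemma name_rel_prob_impl:
  assumes f: "is_problem f" and g: "is_problem g"
  shows "name_rel (prob_impl g f) = rimpl (name_rel g) (name_rel f)"
proof (intro ext)
  fix p q
  define T where "T = (\<lambda>x. mcomp (PhiXY (trg g) (trg f) (bfst q)) (val g) x)"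
  note T = mem_mcomp_PhiXY[OF g, of _ "trg f" "bfst q", folded T_def]
  have r: "PhiXY (trg g) (trg f) (bfst q) \<in> ran (M_space (trg g) (trg f))"
    by (auto simp: ran_def M_space_def)
  have dom_f: "Domainp (name_rel f) w \<longleftrightarrow> (\<exists>u. src f w = Some u \<and> val f u \<noteq> {})" for w
    unfolding Domainp_name_rel[OF f] mdom_def by simp
  have dom_g: "Domainp (name_rel g) w \<longleftrightarrow> (\<exists>u. src g w = Some u \<and> val g u \<noteq> {})" for w
    unfolding Domainp_name_rel[OF g] mdom_def by simp
  have "name_rel (prob_impl g f) p q \<longleftrightarrow>
    (\<exists>u x. src f p = Some u \<and> src g (bsnd q) = Some x \<and> T x \<noteq> {} \<and> T x \<subseteq> val f u)"
    unfolding name_rel_def prob_impl_def T_def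
    by (auto simp: prod_space_eq_Some M_space_eq_Some r mdom_def)
  also have "\<dots> \<longleftrightarrow> rimpl (name_rel g) (name_rel f) p q"
    unfolding rimpl_def dom_f dom_g
  proof (intro iffI conjI allI impI; (elim exE conjE)?)
    fix u x assume u: "src f p = Some u" and x: "src g (bsnd q) = Some x"
      and T1: "T x \<noteq> {}" and T2: "T x \<subseteq> val f u"
    show "\<exists>u. src f p = Some u \<and> val f u \<noteq> {}"
      using u T1 T2 by blast
    show "\<exists>u. src g (bsnd q) = Some u \<and> val g u \<noteq> {}"
      using x T1 unfolding T_def mcomp_def by (auto split: if_splits)
    fix r assume r: "name_rel g (bsnd q) (bfst r)"
    then obtain y where y: "trg g (bfst r) = Some y" "y \<in> val g x"
      using x by (auto simp: name_rel_def)
    from T1 y obtain w z where w: "Phi (bfst q) r = Some w" "trg f w = Some z"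
      unfolding ex_in_conv[symmetric] T by blast
    have "z \<in> T x"
      using T1 y w unfolding ex_in_conv[symmetric] T by blast
    then show "\<exists>w. Phi (bfst q) r = Some w \<and> name_rel f p w"
      using w u T2 by (auto simp: name_rel_def)
  next
    fix u x assume u: "src f p = Some u" and x: "src g (bsnd q) = Some x" "val g x \<noteq> {}"
      and D: "\<forall>r. name_rel g (bsnd q) (bfst r) \<longrightarrow> (\<exists>w. Phi (bfst q) r = Some w \<and> name_rel f p w)"
    have D': "\<exists>w v. Phi (bfst q) r = Some w \<and> trg f w = Some v \<and> v \<in> val f u"
      if "trg g (bfst r) = Some y" "y \<in> val g x" for r y
      using D that x u by (force simp: name_rel_def)
    from x(2) obtain y where y: "y \<in> val g x" by blast
    obtain s where "trg g (bfst (bpair s s)) = Some y"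
      using is_problemD[OF g y] by auto
    then have "T x \<noteq> {}"
      using D' y unfolding ex_in_conv[symmetric] T by (metis option.distinct(1))
    moreover have "T x \<subseteq> val f u"
      using D' unfolding subset_iff T by (metis option.inject)
    ultimately show "\<exists>u x. src f p = Some u \<and> src g (bsnd q) = Some x \<and> T x \<noteq> {} \<and> T x \<subseteq> val f u"
      using u x by blast
  qed
  finally show "name_rel (prob_impl g f) p q \<longleftrightarrow> rimpl (name_rel g) (name_rel f) p q" .
qed

section \<open>The algebra of problems up to reducibility\<close>

lemma recf_app:
  assumes "recf f" "recf e"
  shows "recf (\<lambda>r. f (e r))"
  using computable_app[OF computable_Some[OF assms(1)] assms(2)]
  unfolding computable_iff recf_def by simp

lemma redI:
  assumes "computable H" "computable K"
    and "\<And>p. Domainp R p \<Longrightarrow> \<exists>q. H p = Some q \<and> Domainp S q \<and>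
      (\<forall>s. S q s \<longrightarrow> (\<exists>t. K (bpair p s) = Some t \<and> R p t))"
  shows "red R S"
  using assms unfolding red_def by blast

section \<open>The reducibility preorder\<close>

lemma red_refl: "red R R"
  by (rule redI[of Some "\<lambda>z. Some (bsnd z)"]) (intro computable_intros | simp)+

lemma red_trans:
  assumes "red R S" "red S T"
  shows "red R T"
proof -
  obtain H1 K1 where 1: "computable H1" "computable K1"
    "\<And>p. Domainp R p \<Longrightarrow> \<exists>q. H1 p = Some q \<and> Domainp S q \<and>
      (\<forall>s. S q s \<longrightarrow> (\<exists>t. K1 (bpair p s) = Some t \<and> R p t))"
    using assms(1) unfolding red_def by blast
  obtain H2 K2 where 2: "computable H2" "computable K2"
    "\<And>p. Domainp S p \<Longrightarrow> \<exists>q. H2 p = Some q \<and> Domainp T q \<and>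
      (\<forall>s. T q s \<longrightarrow> (\<exists>t. K2 (bpair p s) = Some t \<and> S p t))"
    using assms(2) unfolding red_def by blast
  note C = 1(1) computable_app[OF 1(1)] computable_app[OF 1(2)]
    computable_app[OF 2(1)] computable_app[OF 2(2)]
  show ?thesis
  proof (rule redI[of "\<lambda>p. Option.bind (H1 p) (\<lambda>q. H2 q)"
      "\<lambda>z. Option.bind (H1 (bfst z)) (\<lambda>q. Option.bind (K2 (bpair q (bsnd z)))
        (\<lambda>s. K1 (bpair (bfst z) s)))"], goal_cases)
    case (3 p)
    from 1(3)[OF 3] obtain q where q: "H1 p = Some q" "Domainp S q"
      "\<And>s. S q s \<Longrightarrow> \<exists>t. K1 (bpair p s) = Some t \<and> R p t" by blast
    from 2(3)[OF q(2)] obtain n where n: "H2 q = Some n" "Domainp T n"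
      "\<And>s. T n s \<Longrightarrow> \<exists>t. K2 (bpair q s) = Some t \<and> S q t" by blast
    have "\<exists>t. Option.bind (K2 (bpair q s)) (\<lambda>s. K1 (bpair p s)) = Some t \<and> R p t"
      if "T n s" for s
      using n(3)[OF that] q(3) by force
    with q(1) n(1,2) show ?case by simp
  qed (intro computable_intros C)+
qed

section \<open>Two-query protocols for the compositional product\<close>

text \<open>\<open>H\<close> poses the query to G, \<open>P\<close> the query to F, and
  \<open>K\<close> assembles the solution. \<open>P\<close> and \<open>K\<close> may consult the
  input and all earlier answers, which takes the place of the function name in an instance of
  \<open>rstar F G\<close>.\<close>

definition red2 :: "baire_rel \<Rightarrow> baire_rel \<Rightarrow> baire_rel \<Rightarrow> bool" where
  "red2 X F G \<longleftrightarrow> (\<exists>H P K. computable H \<and> computable P \<and> computable K \<and>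
     (\<forall>x. Domainp X x \<longrightarrow> (\<exists>q. H x = Some q \<and> Domainp G q \<and>
       (\<forall>s. G q s \<longrightarrow> (\<exists>w. P (bpair x s) = Some w \<and> Domainp F w \<and>
         (\<forall>t. F w t \<longrightarrow> (\<exists>z. K (bpair (bpair x s) t) = Some z \<and> X x z)))))))"

lemma red2I:
  assumes "computable H" "computable P" "computable K"
    and "\<And>x. Domainp X x \<Longrightarrow> \<exists>q. H x = Some q \<and> Domainp G q \<and>
       (\<forall>s. G q s \<longrightarrow> (\<exists>w. P (bpair x s) = Some w \<and> Domainp F w \<and>
         (\<forall>t. F w t \<longrightarrow> (\<exists>z. K (bpair (bpair x s) t) = Some z \<and> X x z))))"
  shows "red2 X F G"
  using assms unfolding red2_def by blast

lemma Domainp_rstar: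
  "Domainp (rstar F G) p \<longleftrightarrow> Domainp G (bsnd p) \<and>
     (\<forall>r. G (bsnd p) (bfst r) \<longrightarrow> (\<exists>w. Phi (bfst p) r = Some w \<and> Domainp F (bsnd w)))"
    (is "?L \<longleftrightarrow> ?R")
proof
  assume R: ?R
  then obtain s where "G (bsnd p) s" by (auto elim: DomainpE)
  then have s: "G (bsnd p) (bfst (bpair s s))" by simp
  with R obtain w where w: "Phi (bfst p) (bpair s s) = Some w" "Domainp F (bsnd w)"
    by blast
  then obtain t where "F (bsnd w) t" by (auto elim: DomainpE)
  then have "F (bsnd w) (bsnd (bpair (bfst w) t))" "bfst (bpair (bfst w) t) = bfst w"
    by simp_all
  with R s w have "rstar F G p (bpair (bfst w) t)"
    unfolding rstar_def by blast
  then show ?L by (rule DomainPI[of "rstar F G"])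
qed (auto simp: rstar_def elim!: DomainpE)

text \<open>From left to right, \<open>P\<close> runs the function named in the instance on the
  first answer, filling the free half with that answer again. From right to left, the function name
  comes from \<open>P\<close> by the s-m-n theorem with parameter x. \<open>K\<close> also needs the
  first answer, which therefore travels through the identity factor of the product.\<close>

lemma red_rstar_iff: "red X (rstar F G) \<longleftrightarrow> red2 X F G"
proof
  assume "red X (rstar F G)"
  then obtain H K where c: "computable H" "computable K"
    and r: "\<And>x. Domainp X x \<Longrightarrow> \<exists>q. H x = Some q \<and> Domainp (rstar F G) q \<and>
      (\<forall>s. rstar F G q s \<longrightarrow> (\<exists>t. K (bpair x s) = Some t \<and> X x t))"
    unfolding red_def by blast
  note C = c(1) computable_app[OF c(1)] computable_app[OF c(2)]
  show "red2 X F G"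
  proof (rule red2I[of "\<lambda>x. Option.bind (H x) (\<lambda>q. Some (bsnd q))"
      "\<lambda>z. Option.bind (H (bfst z)) (\<lambda>q.
        Option.bind (Phi (bfst q) (bpair (bsnd z) (bsnd z))) (\<lambda>w. Some (bsnd w)))"
      "\<lambda>z. Option.bind (H (bfst (bfst z))) (\<lambda>q.
        Option.bind (Phi (bfst q) (bpair (bsnd (bfst z)) (bsnd (bfst z))))
          (\<lambda>w. K (bpair (bfst (bfst z)) (bpair (bfst w) (bsnd z)))))"], goal_cases)
    case (4 x)
    from r[OF 4] obtain q where q: "H x = Some q" "Domainp (rstar F G) q"
      and k: "\<And>s. rstar F G q s \<Longrightarrow> \<exists>t. K (bpair x s) = Some t \<and> X x t" by blast
    have D: "Domainp G (bsnd q)"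
      "\<And>r. G (bsnd q) (bfst r) \<Longrightarrow> \<exists>w. Phi (bfst q) r = Some w \<and> Domainp F (bsnd w)"
      using q(2) unfolding Domainp_rstar by blast+
    have "\<exists>w. Phi (bfst q) (bpair s s) = Some w \<and> Domainp F (bsnd w) \<and>
        (\<forall>t. F (bsnd w) t \<longrightarrow> (\<exists>z. K (bpair x (bpair (bfst w) t)) = Some z \<and> X x z))"
      if "G (bsnd q) s" for s
    proof -
      have s: "G (bsnd q) (bfst (bpair s s))" using that by simp
      with D(2) obtain w
        where w: "Phi (bfst q) (bpair s s) = Some w" "Domainp F (bsnd w)" by blast
      have "rstar F G q (bpair (bfst w) t)" if "F (bsnd w) t" for t
        unfolding rstar_def bfst_bpair bsnd_bpair using D(2) s w that by blast
      with w k show ?thesis by blast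
    qed
    with q(1) D(1) show ?case by fastforce
  qed (intro computable_intros C)+
next
  assume "red2 X F G"
  then obtain H P K where c: "computable H" "computable P" "computable K"
    and r: "\<And>x. Domainp X x \<Longrightarrow> \<exists>q. H x = Some q \<and> Domainp G q \<and>
       (\<forall>s. G q s \<longrightarrow> (\<exists>w. P (bpair x s) = Some w \<and> Domainp F w \<and>
         (\<forall>t. F w t \<longrightarrow> (\<exists>z. K (bpair (bpair x s) t) = Some z \<and> X x z))))"
    unfolding red2_def by blast
  \<comment> \<open>The named function outputs the answer of G for the identity factor, followed by
    the query to F.\<close>
  have "computable (\<lambda>z. Option.bind (P (bpair (bfst z) (bfst (bsnd z))))
      (\<lambda>w. Some (bpair (bfst (bsnd z)) w)))"
    by (intro computable_intros computable_app[OF c(2)])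
  then obtain T where T: "recf T"
    "\<And>x r v. Option.bind (P (bpair (bfst (bpair x r)) (bfst (bsnd (bpair x r)))))
      (\<lambda>w. Some (bpair (bfst (bsnd (bpair x r))) w)) = Some v \<Longrightarrow> Phi (T x) r = Some v"
    by (rule Phi_param) blast
  have T': "Phi (T x) r = Some (bpair (bfst r) w)" if "P (bpair x (bfst r)) = Some w" for x r w
    by (rule T(2)) (simp add: that)
  show "red X (rstar F G)"
  proof (rule redI[of "\<lambda>x. Option.bind (H x) (\<lambda>q. Some (bpair (T x) q))"
      "\<lambda>z. K (bpair (bpair (bfst z) (bfst (bsnd z))) (bsnd (bsnd z)))"], goal_cases)
    case (3 x)
    from r[OF this] obtain q where q: "H x = Some q" "Domainp G q"
      and s: "\<And>s. G q s \<Longrightarrow> \<exists>w. P (bpair x s) = Some w \<and> Domainp F w \<and>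
         (\<forall>t. F w t \<longrightarrow> (\<exists>z. K (bpair (bpair x s) t) = Some z \<and> X x z))"
      by blast
    have "\<exists>w. Phi (T x) r = Some w \<and> Domainp F (bsnd w)" if "G q (bfst r)" for r
      using s[OF that] T' by fastforce
    then have "Domainp (rstar F G) (bpair (T x) q)"
      unfolding Domainp_rstar bfst_bpair bsnd_bpair using q(2) by blast
    moreover have "\<exists>z. K (bpair (bpair x (bfst a)) (bsnd a)) = Some z \<and> X x z"
      if a: "rstar F G (bpair (T x) q) a" for a
    proof -
      obtain r w where rw: "G q (bfst r)" "Phi (T x) r = Some w" "bfst a = bfst w" "F (bsnd w) (bsnd a)"
        using a unfolding rstar_def bfst_bpair bsnd_bpair by blast
      from s[OF rw(1)] obtain w' where w': "P (bpair x (bfst r)) = Some w'"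
        "\<And>t. F w' t \<Longrightarrow> \<exists>z. K (bpair (bpair x (bfst r)) t) = Some z \<and> X x z" by blast
      from T'[OF w'(1)] rw have "w = bpair (bfst r) w'" by simp
      with rw w'(2) show ?thesis by simp
    qed
    ultimately show ?case using q(1) by simp
  qed (intro computable_intros computable_app[OF c(3)] c(1) recf_app[OF T(1)])+
qed

text \<open>Reflexivity provides a protocol that solves F * G with queries to G and F; each query
  and its answer are then translated by the given reductions.\<close>

lemma rstar_mono:
  assumes "red F F'" "red G G'"
  shows "red (rstar F G) (rstar F' G')"
proof -
  obtain H P K where c: "computable H" "computable P" "computable K"
    and r: "\<And>x. Domainp (rstar F G) x \<Longrightarrow> \<exists>q. H x = Some q \<and> Domainp G q \<and>
       (\<forall>s. G q s \<longrightarrow> (\<exists>w. P (bpair x s) = Some w \<and> Domainp F w \<and>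
         (\<forall>t. F w t \<longrightarrow> (\<exists>z. K (bpair (bpair x s) t) = Some z \<and> rstar F G x z))))"
    using red_refl[of "rstar F G"] unfolding red_rstar_iff red2_def by blast
  obtain H1 K1 where 1: "computable H1" "computable K1"
    "\<And>p. Domainp F p \<Longrightarrow> \<exists>q. H1 p = Some q \<and> Domainp F' q \<and>
      (\<forall>s. F' q s \<longrightarrow> (\<exists>t. K1 (bpair p s) = Some t \<and> F p t))"
    using assms(1) unfolding red_def by blast
  obtain H2 K2 where 2: "computable H2" "computable K2"
    "\<And>p. Domainp G p \<Longrightarrow> \<exists>q. H2 p = Some q \<and> Domainp G' q \<and>
      (\<forall>s. G' q s \<longrightarrow> (\<exists>t. K2 (bpair p s) = Some t \<and> G p t))"
    using assms(2) unfolding red_def by blast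
  note C = c(1) computable_app[OF c(1)] computable_app[OF c(2)] computable_app[OF c(3)]
    computable_app[OF 1(1)] computable_app[OF 1(2)] computable_app[OF 2(1)] computable_app[OF 2(2)]
  let ?s = "\<lambda>x s'. Option.bind (H x) (\<lambda>q. K2 (bpair q s'))"
  show ?thesis
    unfolding red_rstar_iff
  proof (rule red2I[of "\<lambda>x. Option.bind (H x) (\<lambda>q. H2 q)"
      "\<lambda>z. Option.bind (?s (bfst z) (bsnd z)) (\<lambda>s. Option.bind (P (bpair (bfst z) s)) (\<lambda>w. H1 w))"
      "\<lambda>z. Option.bind (?s (bfst (bfst z)) (bsnd (bfst z))) (\<lambda>s.
        Option.bind (P (bpair (bfst (bfst z)) s)) (\<lambda>w.
        Option.bind (K1 (bpair w (bsnd z))) (\<lambda>t. K (bpair (bpair (bfst (bfst z)) s) t))))"],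
      goal_cases)
    case (4 x)
    from r[OF 4] obtain q where q: "H x = Some q" "Domainp G q"
      and s: "\<And>s. G q s \<Longrightarrow> \<exists>w. P (bpair x s) = Some w \<and> Domainp F w \<and>
         (\<forall>t. F w t \<longrightarrow> (\<exists>z. K (bpair (bpair x s) t) = Some z \<and> rstar F G x z))"
      by blast
    from 2(3)[OF q(2)] obtain q' where q': "H2 q = Some q'" "Domainp G' q'"
      "\<And>s. G' q' s \<Longrightarrow> \<exists>t. K2 (bpair q s) = Some t \<and> G q t" by blast
    have "\<exists>s w w'. K2 (bpair q s') = Some s \<and> P (bpair x s) = Some w \<and> H1 w = Some w' \<and>
        Domainp F' w' \<and> (\<forall>t'. F' w' t' \<longrightarrow> (\<exists>t z. K1 (bpair w t') = Some t \<and>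
          K (bpair (bpair x s) t) = Some z \<and> rstar F G x z))" if "G' q' s'" for s'
    proof -
      from q'(3)[OF that] obtain s1 where s1: "K2 (bpair q s') = Some s1" "G q s1" by blast
      from s[OF s1(2)] obtain w where w: "P (bpair x s1) = Some w" "Domainp F w"
        "\<And>t. F w t \<Longrightarrow> \<exists>z. K (bpair (bpair x s1) t) = Some z \<and> rstar F G x z" by blast
      from 1(3)[OF w(2)] obtain w' where w': "H1 w = Some w'" "Domainp F' w'"
        "\<And>s. F' w' s \<Longrightarrow> \<exists>t. K1 (bpair w s) = Some t \<and> F w t" by blast
      then show ?thesis using s1 w by blast
    qed
    with q q' show ?case by fastforce
  qed (intro computable_intros C)+
qed

text \<open>Both bracketings pose queries to E, G and F in this order. To regroup them, an auxiliary
  problem Y with Y <= G * E and X <= F * Y is put between, and monotonicity finishes.\<close>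

lemma rstar_assoc_le: "red (rstar (rstar F G) E) (rstar F (rstar G E))"
proof -
  define W where "W = rstar F G"
  define X where "X = rstar W E"
  obtain H P K where c: "computable H" "computable P" "computable K"
    and r: "\<And>x. Domainp (X) x \<Longrightarrow> \<exists>q. H x = Some q \<and> Domainp (E) q \<and>
       (\<forall>s. E q s \<longrightarrow> (\<exists>w. P (bpair x s) = Some w \<and> Domainp (W) w \<and>
         (\<forall>t. W w t \<longrightarrow> (\<exists>z. K (bpair (bpair x s) t) = Some z \<and> X x z))))"
    using red_refl[of X] unfolding X_def red_rstar_iff red2_def by blast
  obtain H2 P2 K2 where c2: "computable H2" "computable P2" "computable K2"
    and r2: "\<And>x. Domainp (W) x \<Longrightarrow> \<exists>q. H2 x = Some q \<and> Domainp (G) q \<and>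
       (\<forall>s. G q s \<longrightarrow> (\<exists>w. P2 (bpair x s) = Some w \<and> Domainp (F) w \<and>
         (\<forall>t. F w t \<longrightarrow> (\<exists>z. K2 (bpair (bpair x s) t) = Some z \<and> W x z))))"
    using red_refl[of W] unfolding W_def red_rstar_iff red2_def by blast
  note C = c(1) computable_app[OF c(1)] computable_app[OF c(2)] computable_app[OF c(3)]
    computable_app[OF c2(1)] computable_app[OF c2(2)] computable_app[OF c2(3)]
  \<comment> \<open>\<open>Y\<close> asks for the answers to the queries to \<open>E\<close> and \<open>G\<close>.\<close>
  define Y where "Y = (\<lambda>x y. Domainp X x \<and> (\<exists>q w g. H x = Some q \<and> E q (bfst y) \<and>
    P (bpair x (bfst y)) = Some w \<and> H2 w = Some g \<and> G g (bsnd y)))"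
  have "red2 Y G E"
  proof (rule red2I[of H "\<lambda>z. Option.bind (P z) (\<lambda>w. H2 w)"
      "\<lambda>z. Some (bpair (bsnd (bfst z)) (bsnd z))"], goal_cases)
    case (4 x)
    then have x: "Domainp X x" by (auto simp: Y_def)
    from r[OF x] obtain q where q: "H x = Some q" "Domainp E q"
      and s: "\<And>s. E q s \<Longrightarrow> \<exists>w. P (bpair x s) = Some w \<and> Domainp W w"
      by blast
    have "\<exists>w g. P (bpair x s) = Some w \<and> H2 w = Some g \<and> Domainp G g" if "E q s" for s
      using s[OF that] r2 by blast
    with q x show ?case by (fastforce simp: Y_def)
  qed (intro computable_intros C c)+
  moreover have "red2 X F Y"
  proof (rule red2I[of Some "\<lambda>z. Option.bind (P (bpair (bfst z) (bfst (bsnd z))))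
        (\<lambda>w. P2 (bpair w (bsnd (bsnd z))))"
      "\<lambda>z. Option.bind (P (bpair (bfst (bfst z)) (bfst (bsnd (bfst z)))))
        (\<lambda>w. Option.bind (K2 (bpair (bpair w (bsnd (bsnd (bfst z)))) (bsnd z)))
        (\<lambda>v. K (bpair (bpair (bfst (bfst z)) (bfst (bsnd (bfst z)))) v)))"], goal_cases)
    case (4 x)
    from r[OF 4] obtain q where q: "H x = Some q" "Domainp E q"
      and s: "\<And>s. E q s \<Longrightarrow> \<exists>w. P (bpair x s) = Some w \<and> Domainp W w \<and>
         (\<forall>t. W w t \<longrightarrow> (\<exists>z. K (bpair (bpair x s) t) = Some z \<and> X x z))"
      by blast
    have "Domainp Y x"
    proof -
      obtain e where e: "E q e" using q(2) by (rule DomainpE)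
      from s[OF e] obtain w where w: "P (bpair x e) = Some w" "Domainp W w" by blast
      from r2[OF w(2)] obtain g where g: "H2 w = Some g" "Domainp G g" by blast
      from g(2) obtain t where "G g t" by (rule DomainpE)
      with 4 q e w g have "Y x (bpair e t)" by (simp add: Y_def)
      then show ?thesis by (rule DomainPI[of Y])
    qed
    moreover have "\<exists>w f. P (bpair x (bfst y)) = Some w \<and> P2 (bpair w (bsnd y)) = Some f \<and> Domainp F f \<and>
        (\<forall>t. F f t \<longrightarrow> (\<exists>v z. K2 (bpair (bpair w (bsnd y)) t) = Some v \<and>
          K (bpair (bpair x (bfst y)) v) = Some z \<and> X x z))" if y: "Y x y" for y
    proof -
      from y q obtain w g where w: "E q (bfst y)" "P (bpair x (bfst y)) = Some w" "H2 w = Some g" "G g (bsnd y)"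
        by (auto simp: Y_def)
      with s[OF w(1)] have k: "Domainp W w"
        "\<And>t. W w t \<Longrightarrow> \<exists>z. K (bpair (bpair x (bfst y)) t) = Some z \<and> X x z" by auto
      from r2[OF k(1)] w(3) have "\<forall>s. G g s \<longrightarrow> (\<exists>f. P2 (bpair w s) = Some f \<and> Domainp F f \<and>
          (\<forall>t. F f t \<longrightarrow> (\<exists>z. K2 (bpair (bpair w s) t) = Some z \<and> W w z)))" by simp
      with w(4) obtain f where f: "P2 (bpair w (bsnd y)) = Some f" "Domainp F f"
        "\<And>t. F f t \<Longrightarrow> \<exists>z. K2 (bpair (bpair w (bsnd y)) t) = Some z \<and> W w z" by blast
      have "\<exists>v z. K2 (bpair (bpair w (bsnd y)) t) = Some v \<and>
          K (bpair (bpair x (bfst y)) v) = Some z \<and> X x z" if t: "F f t" for t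
        using f(3)[OF t] k(2) by blast
      with w(2) f(1,2) show ?thesis by blast
    qed
    ultimately show ?case by fastforce
  qed (intro computable_intros C)+
  ultimately show ?thesis
    unfolding red_rstar_iff[symmetric] X_def W_def
    by (blast intro: red_trans rstar_mono red_refl)
qed

text \<open>The regrouping in the other direction: here the auxiliary problem satisfies X <= Y * E
  and Y <= F * G.\<close>

lemma rstar_assoc_ge: "red (rstar F (rstar G E)) (rstar (rstar F G) E)"
proof -
  define W where "W = rstar G E"
  define X where "X = rstar F W"
  obtain H P K where c: "computable H" "computable P" "computable K"
    and r: "\<And>x. Domainp (X) x \<Longrightarrow> \<exists>q. H x = Some q \<and> Domainp (W) q \<and>
       (\<forall>s. W q s \<longrightarrow> (\<exists>w. P (bpair x s) = Some w \<and> Domainp (F) w \<and>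
         (\<forall>t. F w t \<longrightarrow> (\<exists>z. K (bpair (bpair x s) t) = Some z \<and> X x z))))"
    using red_refl[of X] unfolding X_def red_rstar_iff red2_def by blast
  obtain H2 P2 K2 where c2: "computable H2" "computable P2" "computable K2"
    and r2: "\<And>x. Domainp (W) x \<Longrightarrow> \<exists>q. H2 x = Some q \<and> Domainp (E) q \<and>
       (\<forall>s. E q s \<longrightarrow> (\<exists>w. P2 (bpair x s) = Some w \<and> Domainp (G) w \<and>
         (\<forall>t. G w t \<longrightarrow> (\<exists>z. K2 (bpair (bpair x s) t) = Some z \<and> W x z))))"
    using red_refl[of W] unfolding W_def red_rstar_iff red2_def by blast
  note C = c(1) computable_app[OF c(1)] computable_app[OF c(2)] computable_app[OF c(3)]
    computable_app[OF c2(1)] computable_app[OF c2(2)] computable_app[OF c2(3)]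
  \<comment> \<open>\<open>Y\<close> is \<open>X\<close> with the answer to the query to \<open>E\<close> supplied as additional input.\<close>
  define Y where "Y = (\<lambda>p z. Domainp X (bfst p) \<and> (\<exists>n q. H (bfst p) = Some n \<and> H2 n = Some q \<and>
    E q (bsnd p)) \<and> X (bfst p) z)"
  have "red2 X Y E"
  \<comment> \<open>The query to Y is the pair of the input and the answer of E, so the second
    program is the identity.\<close>
  proof (rule red2I[of "\<lambda>x. Option.bind (H x) (\<lambda>n. H2 n)" Some "\<lambda>z. Some (bsnd z)"], goal_cases)
    case (4 x)
    from r[OF 4] obtain n where n: "H x = Some n" "Domainp W n" by blast
    from r2[OF n(2)] obtain q where q: "H2 n = Some q" "Domainp E q" by blast
    obtain z where z: "X x z" using 4 by (rule DomainpE)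
    have "Domainp Y (bpair x s)" if "E q s" for s
    proof (rule DomainPI[of Y])
      show "Y (bpair x s) z" using 4 n q z that by (simp add: Y_def)
    qed
    with n q show ?case by (simp add: Y_def)
  qed (intro computable_intros C)+
  moreover have "red2 Y F G"
  proof (rule red2I[of "\<lambda>p. Option.bind (H (bfst p)) (\<lambda>n. P2 (bpair n (bsnd p)))"
      "\<lambda>z. Option.bind (H (bfst (bfst z))) (\<lambda>n.
        Option.bind (K2 (bpair (bpair n (bsnd (bfst z))) (bsnd z))) (\<lambda>w. P (bpair (bfst (bfst z)) w)))"
      "\<lambda>z. Option.bind (H (bfst (bfst (bfst z)))) (\<lambda>n.
        Option.bind (K2 (bpair (bpair n (bsnd (bfst (bfst z)))) (bsnd (bfst z))))
          (\<lambda>w. K (bpair (bpair (bfst (bfst (bfst z))) w) (bsnd z))))"], goal_cases)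
    case (4 p)
    then obtain n q where x: "Domainp X (bfst p)"
      and n: "H (bfst p) = Some n" "H2 n = Some q" "E q (bsnd p)"
      by (auto simp: Y_def)
    have Y: "Y p z \<longleftrightarrow> X (bfst p) z" for z
      using x n by (simp add: Y_def)
    from r[OF x] n(1) have w: "Domainp W n"
      and s: "\<And>s. W n s \<Longrightarrow> \<exists>w. P (bpair (bfst p) s) = Some w \<and> Domainp F w \<and>
         (\<forall>t. F w t \<longrightarrow> (\<exists>z. K (bpair (bpair (bfst p) s) t) = Some z \<and> X (bfst p) z))"
      by auto
    from r2[OF w] n(2) have "\<forall>s. E q s \<longrightarrow> (\<exists>g. P2 (bpair n s) = Some g \<and> Domainp G g \<and>
        (\<forall>t. G g t \<longrightarrow> (\<exists>z. K2 (bpair (bpair n s) t) = Some z \<and> W n z)))" by simp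
    with n(3) obtain g where g: "P2 (bpair n (bsnd p)) = Some g" "Domainp G g"
      and t: "\<And>t. G g t \<Longrightarrow> \<exists>z. K2 (bpair (bpair n (bsnd p)) t) = Some z \<and> W n z" by blast
    have "\<exists>v w. K2 (bpair (bpair n (bsnd p)) t) = Some v \<and> P (bpair (bfst p) v) = Some w \<and> Domainp F w \<and>
        (\<forall>t. F w t \<longrightarrow> (\<exists>z. K (bpair (bpair (bfst p) v) t) = Some z \<and> X (bfst p) z))"
      if "G g t" for t
      using t[OF that] s by blast
    with n(1) g show ?case by (fastforce simp: Y)
  qed (intro computable_intros C)+
  ultimately show ?thesis
    unfolding red_rstar_iff[symmetric] X_def W_def
    by (blast intro: red_trans rstar_mono red_refl)
qed

section \<open>Products, meets and joins\<close>

lemma Domainp_rtimes: "Domainp (rtimes F G) p \<longleftrightarrow> Domainp F (bfst p) \<and> Domainp G (bsnd p)"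
proof
  assume "Domainp F (bfst p) \<and> Domainp G (bsnd p)"
  then obtain s t where "F (bfst p) s" "G (bsnd p) t" by (auto elim!: DomainpE)
  then have "rtimes F G p (bpair s t)" by (simp add: rtimes_def)
  then show "Domainp (rtimes F G) p" by (rule DomainPI[of "rtimes F G"])
qed (auto simp: rtimes_def elim!: DomainpE)

lemma Domainp_rsqcap: "Domainp (rsqcap F G) p \<longleftrightarrow> Domainp F (bfst p) \<and> Domainp G (bsnd p)"
proof
  assume d: "Domainp F (bfst p) \<and> Domainp G (bsnd p)"
  then obtain s where "F (bfst p) s" by (auto elim!: DomainpE)
  with d have "rsqcap F G p (case_nat 0 s)" by (simp add: rsqcap_def)
  then show "Domainp (rsqcap F G) p" by (rule DomainPI[of "rsqcap F G"])
qed (auto simp: rsqcap_def elim!: DomainpE)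

lemma Domainp_rsqcup:
  "Domainp (rsqcup F G) p \<longleftrightarrow> p 0 = 0 \<and> Domainp F (btl p) \<or> p 0 = 1 \<and> Domainp G (btl p)"
  (is "?L \<longleftrightarrow> ?R")
proof
  assume ?R
  then show ?L
  proof (elim disjE conjE)
    assume "p 0 = 0" "Domainp F (btl p)"
    then obtain s where "rsqcup F G p (case_nat 0 s)" by (auto simp: rsqcup_def elim!: DomainpE)
    then show ?L by (rule DomainPI[of "rsqcup F G"])
  next
    assume "p 0 = 1" "Domainp G (btl p)"
    then obtain s where "rsqcup F G p (case_nat 1 s)" by (auto simp: rsqcup_def elim!: DomainpE)
    then show ?L by (rule DomainPI[of "rsqcup F G"])
  qed
qed (auto simp: rsqcup_def elim!: DomainpE)

lemma rtimes_mono: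
  assumes "red F F'" "red G G'"
  shows "red (rtimes F G) (rtimes F' G')"
proof -
  obtain H K where c: "computable H" "computable K"
    and r: "\<And>p. Domainp F p \<Longrightarrow> \<exists>q. H p = Some q \<and> Domainp F' q \<and>
      (\<forall>s. F' q s \<longrightarrow> (\<exists>t. K (bpair p s) = Some t \<and> F p t))"
    using assms(1) unfolding red_def by blast
  obtain H2 K2 where c2: "computable H2" "computable K2"
    and r2: "\<And>p. Domainp G p \<Longrightarrow> \<exists>q. H2 p = Some q \<and> Domainp G' q \<and>
      (\<forall>s. G' q s \<longrightarrow> (\<exists>t. K2 (bpair p s) = Some t \<and> G p t))"
    using assms(2) unfolding red_def by blast
  note C = computable_app[OF c(1)] computable_app[OF c(2)] computable_app[OF c2(1)] computable_app[OF c2(2)]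
  show ?thesis
  proof (rule redI[of "\<lambda>p. Option.bind (H (bfst p)) (\<lambda>a. Option.bind (H2 (bsnd p)) (\<lambda>b. Some (bpair a b)))"
      "\<lambda>z. Option.bind (K (bpair (bfst (bfst z)) (bfst (bsnd z)))) (\<lambda>a.
        Option.bind (K2 (bpair (bsnd (bfst z)) (bsnd (bsnd z)))) (\<lambda>b. Some (bpair a b)))"], goal_cases)
    case (3 p)
    then have "Domainp F (bfst p)" "Domainp G (bsnd p)" by (simp_all add: Domainp_rtimes)
    from r[OF this(1)] r2[OF this(2)] show ?case
      by (fastforce simp: Domainp_rtimes rtimes_def)
  qed (intro computable_intros C)+
qed

text \<open>The protocols run side by side: both first queries are posed together, then both second
  ones.\<close>

lemma rtimes_rstar:
  "red (rtimes (rstar F C) (rstar G D)) (rstar (rtimes F G) (rtimes C D))"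
proof -
  define X where "X = rstar F C"
  define Y where "Y = rstar G D"
  obtain H P K where c: "computable H" "computable P" "computable K"
    and r: "\<And>x. Domainp (X) x \<Longrightarrow> \<exists>q. H x = Some q \<and> Domainp (C) q \<and>
       (\<forall>s. C q s \<longrightarrow> (\<exists>w. P (bpair x s) = Some w \<and> Domainp (F) w \<and>
         (\<forall>t. F w t \<longrightarrow> (\<exists>z. K (bpair (bpair x s) t) = Some z \<and> X x z))))"
    using red_refl[of X] unfolding X_def red_rstar_iff red2_def by blast
  obtain H2 P2 K2 where c2: "computable H2" "computable P2" "computable K2"
    and r2: "\<And>x. Domainp (Y) x \<Longrightarrow> \<exists>q. H2 x = Some q \<and> Domainp (D) q \<and>
       (\<forall>s. D q s \<longrightarrow> (\<exists>w. P2 (bpair x s) = Some w \<and> Domainp (G) w \<and>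
         (\<forall>t. G w t \<longrightarrow> (\<exists>z. K2 (bpair (bpair x s) t) = Some z \<and> Y x z))))"
    using red_refl[of Y] unfolding Y_def red_rstar_iff red2_def by blast
  note C = computable_app[OF c(1)] computable_app[OF c(2)] computable_app[OF c(3)]
    computable_app[OF c2(1)] computable_app[OF c2(2)] computable_app[OF c2(3)]
  have "red2 (rtimes X Y) (rtimes F G) (rtimes C D)"
  proof (rule red2I[of
      "\<lambda>p. Option.bind (H (bfst p)) (\<lambda>a. Option.bind (H2 (bsnd p)) (\<lambda>b. Some (bpair a b)))"
      "\<lambda>z. Option.bind (P (bpair (bfst (bfst z)) (bfst (bsnd z)))) (\<lambda>a.
        Option.bind (P2 (bpair (bsnd (bfst z)) (bsnd (bsnd z)))) (\<lambda>b. Some (bpair a b)))"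
      "\<lambda>z. Option.bind (K (bpair (bpair (bfst (bfst (bfst z))) (bfst (bsnd (bfst z)))) (bfst (bsnd z)))) (\<lambda>a.
        Option.bind (K2 (bpair (bpair (bsnd (bfst (bfst z))) (bsnd (bsnd (bfst z)))) (bsnd (bsnd z))))
          (\<lambda>b. Some (bpair a b)))"], goal_cases)
    case (4 p)
    then have "Domainp X (bfst p)" "Domainp Y (bsnd p)" by (simp_all add: Domainp_rtimes)
    from r[OF this(1)] r2[OF this(2)] show ?case
      by (fastforce simp: Domainp_rtimes rtimes_def)
  qed (intro computable_intros C)+
  then show ?thesis unfolding red_rstar_iff X_def Y_def .
qed

text \<open>An instance of the meet of F and G contains instances of both, so both first queries
  must be answered beforehand; this is why C and D are combined by a product. The tag of the last
  answer decides which protocol is completed.\<close>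

lemma rsqcap_rstar:
  "red (rsqcap (rstar F C) (rstar G D)) (rstar (rsqcap F G) (rtimes C D))"
proof -
  define X where "X = rstar F C"
  define Y where "Y = rstar G D"
  obtain H P K where c: "computable H" "computable P" "computable K"
    and r: "\<And>x. Domainp (X) x \<Longrightarrow> \<exists>q. H x = Some q \<and> Domainp (C) q \<and>
       (\<forall>s. C q s \<longrightarrow> (\<exists>w. P (bpair x s) = Some w \<and> Domainp (F) w \<and>
         (\<forall>t. F w t \<longrightarrow> (\<exists>z. K (bpair (bpair x s) t) = Some z \<and> X x z))))"
    using red_refl[of X] unfolding X_def red_rstar_iff red2_def by blast
  obtain H2 P2 K2 where c2: "computable H2" "computable P2" "computable K2"
    and r2: "\<And>x. Domainp (Y) x \<Longrightarrow> \<exists>q. H2 x = Some q \<and> Domainp (D) q \<and>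
       (\<forall>s. D q s \<longrightarrow> (\<exists>w. P2 (bpair x s) = Some w \<and> Domainp (G) w \<and>
         (\<forall>t. G w t \<longrightarrow> (\<exists>z. K2 (bpair (bpair x s) t) = Some z \<and> Y x z))))"
    using red_refl[of Y] unfolding Y_def red_rstar_iff red2_def by blast
  note C = computable_app[OF c(1)] computable_app[OF c(2)] computable_app[OF c(3)]
    computable_app[OF c2(1)] computable_app[OF c2(2)] computable_app[OF c2(3)]
  have "red2 (rsqcap X Y) (rsqcap F G) (rtimes C D)"
  proof (rule red2I[of
      "\<lambda>p. Option.bind (H (bfst p)) (\<lambda>a. Option.bind (H2 (bsnd p)) (\<lambda>b. Some (bpair a b)))"
      "\<lambda>z. Option.bind (P (bpair (bfst (bfst z)) (bfst (bsnd z)))) (\<lambda>a.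
        Option.bind (P2 (bpair (bsnd (bfst z)) (bsnd (bsnd z)))) (\<lambda>b. Some (bpair a b)))"
      "\<lambda>z. if bsnd z 0 = 0
        then Option.bind (K (bpair (bpair (bfst (bfst (bfst z))) (bfst (bsnd (bfst z)))) (btl (bsnd z))))
          (\<lambda>a. Some (case_nat 0 a))
        else Option.bind (K2 (bpair (bpair (bsnd (bfst (bfst z))) (bsnd (bsnd (bfst z)))) (btl (bsnd z))))
          (\<lambda>a. Some (case_nat 1 a))"], goal_cases)
    case (4 p)
    then have "Domainp X (bfst p)" "Domainp Y (bsnd p)" by (simp_all add: Domainp_rsqcap)
    with r[OF this(1)] r2[OF this(2)] show ?case
      by (fastforce simp: Domainp_rtimes Domainp_rsqcap rtimes_def rsqcap_def)
  qed (intro computable_intros C)+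
  then show ?thesis unfolding red_rstar_iff X_def Y_def .
qed

lemma rsqcap_le1: "red (rsqcap F G) F"
  by (rule redI[of "\<lambda>p. Some (bfst p)" "\<lambda>z. Some (case_nat 0 (bsnd z))"], (intro computable_intros)+)
    (auto simp: Domainp_rsqcap rsqcap_def)

lemma rsqcap_le2: "red (rsqcap F G) G"
  by (rule redI[of "\<lambda>p. Some (bsnd p)" "\<lambda>z. Some (case_nat 1 (bsnd z))"], (intro computable_intros)+)
    (auto simp: Domainp_rsqcap rsqcap_def)

lemma rsqcap_greatest:
  assumes "red X F" "red X G"
  shows "red X (rsqcap F G)"
proof -
  obtain H K where c: "computable H" "computable K"
    and r: "\<And>p. Domainp X p \<Longrightarrow> \<exists>q. H p = Some q \<and> Domainp F q \<and>
      (\<forall>s. F q s \<longrightarrow> (\<exists>t. K (bpair p s) = Some t \<and> X p t))"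
    using assms(1) unfolding red_def by blast
  obtain H2 K2 where c2: "computable H2" "computable K2"
    and r2: "\<And>p. Domainp X p \<Longrightarrow> \<exists>q. H2 p = Some q \<and> Domainp G q \<and>
      (\<forall>s. G q s \<longrightarrow> (\<exists>t. K2 (bpair p s) = Some t \<and> X p t))"
    using assms(2) unfolding red_def by blast
  note C = c(1) c2(1) computable_app[OF c(1)] computable_app[OF c(2)] computable_app[OF c2(1)] computable_app[OF c2(2)]
  show ?thesis
  proof (rule redI[of "\<lambda>p. Option.bind (H p) (\<lambda>a. Option.bind (H2 p) (\<lambda>b. Some (bpair a b)))"
      "\<lambda>z. if bsnd z 0 = 0 then K (bpair (bfst z) (btl (bsnd z))) else K2 (bpair (bfst z) (btl (bsnd z)))"],
      goal_cases)
    case (3 p)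
    from r[OF this] r2[OF this] show ?case
      by (fastforce simp: Domainp_rsqcap rsqcap_def)
  qed (intro computable_intros C)+
qed

lemma rsqcup_ge1: "red F (rsqcup F G)"
  by (rule redI[of "\<lambda>p. Some (case_nat 0 p)" "\<lambda>z. Some (btl (bsnd z))"], (intro computable_intros)+)
    (auto simp: Domainp_rsqcup rsqcup_def)

lemma rsqcup_ge2: "red G (rsqcup F G)"
  by (rule redI[of "\<lambda>p. Some (case_nat 1 p)" "\<lambda>z. Some (btl (bsnd z))"], (intro computable_intros)+)
    (auto simp: Domainp_rsqcup rsqcup_def)

lemma rsqcup_least:
  assumes "red F X" "red G X"
  shows "red (rsqcup F G) X"
proof -
  obtain H K where c: "computable H" "computable K"
    and r: "\<And>p. Domainp F p \<Longrightarrow> \<exists>q. H p = Some q \<and> Domainp X q \<and>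
      (\<forall>s. X q s \<longrightarrow> (\<exists>t. K (bpair p s) = Some t \<and> F p t))"
    using assms(1) unfolding red_def by blast
  obtain H2 K2 where c2: "computable H2" "computable K2"
    and r2: "\<And>p. Domainp G p \<Longrightarrow> \<exists>q. H2 p = Some q \<and> Domainp X q \<and>
      (\<forall>s. X q s \<longrightarrow> (\<exists>t. K2 (bpair p s) = Some t \<and> G p t))"
    using assms(2) unfolding red_def by blast
  note C = computable_app[OF c(1)] computable_app[OF c(2)] computable_app[OF c2(1)] computable_app[OF c2(2)]
  show ?thesis
  proof (rule redI[of "\<lambda>p. if p 0 = 0 then H (btl p) else H2 (btl p)"
      "\<lambda>z. if bfst z 0 = 0
        then Option.bind (K (bpair (btl (bfst z)) (bsnd z))) (\<lambda>a. Some (case_nat 0 a))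
        else Option.bind (K2 (bpair (btl (bfst z)) (bsnd z))) (\<lambda>a. Some (case_nat 1 a))"],
      goal_cases)
    case (3 p)
    then consider "p 0 = 0" "Domainp F (btl p)" | "p 0 = 1" "Domainp G (btl p)"
      by (auto simp: Domainp_rsqcup)
    then show ?case
    proof cases
      case 1
      then show ?thesis using r[OF 1(2)] by (fastforce simp: rsqcup_def)
    next
      case 2
      then show ?thesis using r2[OF 2(2)] by (fastforce simp: rsqcup_def)
    qed
  qed (intro computable_intros C)+
qed

lemma rtimes_le_rstar: "red (rtimes F G) (rstar F G)"
  unfolding red_rstar_iff
  \<comment> \<open>The query to F is posed without looking at the answer of G.\<close>
  by (rule red2I[of "\<lambda>p. Some (bsnd p)" "\<lambda>z. Some (bfst (bfst z))" "\<lambda>z. Some (bpair (bsnd z) (bsnd (bfst z)))"],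
      (intro computable_intros)+) (auto simp: Domainp_rtimes rtimes_def)

lemma rtimes_diag: "red F (rtimes F F)"
  by (rule redI[of "\<lambda>p. Some (bpair p p)" "\<lambda>z. Some (bfst (bsnd z))"], (intro computable_intros)+)
    (auto simp: Domainp_rtimes rtimes_def)

lemma red_rstar_id: "red F (rstar F (=))"
  unfolding red_rstar_iff
  by (rule red2I[of Some "\<lambda>z. Some (bfst z)" "\<lambda>z. Some (bsnd z)"], (intro computable_intros)+) auto

section \<open>Implication as a residual\<close>

text \<open>A solution of the implication is a function name with an instance of G. The protocol
  obtains it first, queries G at this instance and applies the function to the answer.\<close>

lemma red_rstar_rimpl:
  assumes D: "\<And>p. Domainp F p \<Longrightarrow> \<exists>x. Domainp G x"
  shows "red F (rstar G (rimpl G F))"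
  unfolding red_rstar_iff
proof (rule red2I[of Some "\<lambda>z. Some (bsnd (bsnd z))"
      "\<lambda>z. Phi (bfst (bsnd (bfst z))) (bpair (bsnd z) (bsnd z))"], goal_cases)
  case (4 x)
  \<comment> \<open>Names of constant functions. At a solution y of x, paired with any instance of
    G, they show that the implication has a solution at x.\<close>
  obtain T where T: "\<And>y r. Phi (T y) r = Some y"
    using Phi_param[of "\<lambda>z. Some (bfst z)"] computable_Some[OF recf_bfst[OF recf_ident]]
    by (metis bfst_bpair)
  obtain g where g: "Domainp G g" using D[OF 4] by blast
  obtain y where "F x y" using 4 by (rule DomainpE)
  then have "rimpl G F x (bpair (T y) g)"
    using 4 g by (simp add: rimpl_def T)
  then have "Domainp (rimpl G F) x" by (rule DomainPI[of "rimpl G F"])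
  then show ?case by (auto simp: rimpl_def)
qed (intro computable_intros)+

text \<open>After its query to X, a protocol for F is itself a solution of the implication:
  \<open>P\<close> yields the instance of G, and the rest of the computation is a function of the
  answer of G, named by the s-m-n theorem with the input and the answer of X as parameter.\<close>

lemma rimpl_least:
  assumes "red F (rstar G X)"
  shows "red (rimpl G F) X"
proof -
  obtain H P K where c: "computable H" "computable P" "computable K"
    and r: "\<And>x. Domainp (F) x \<Longrightarrow> \<exists>q. H x = Some q \<and> Domainp (X) q \<and>
       (\<forall>s. X q s \<longrightarrow> (\<exists>w. P (bpair x s) = Some w \<and> Domainp (G) w \<and>
         (\<forall>t. G w t \<longrightarrow> (\<exists>z. K (bpair (bpair x s) t) = Some z \<and> F x z))))"
    using assms unfolding red_rstar_iff red2_def by blast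
  have "computable (\<lambda>z. K (bpair (bfst z) (bfst (bsnd z))))"
    by (intro computable_intros computable_app[OF c(3)])
  then obtain T where T: "recf T"
    "\<And>x y z. K (bpair (bfst (bpair x y)) (bfst (bsnd (bpair x y)))) = Some z \<Longrightarrow> Phi (T x) y = Some z"
    by (rule Phi_param) blast
  show ?thesis
  proof (rule redI[of H "\<lambda>z. Option.bind (P z) (\<lambda>w. Some (bpair (T z) w))"], goal_cases)
    case (3 x)
    then have "Domainp F x" by (auto simp: rimpl_def)
    from r[OF this] this show ?case using T(2) by (fastforce simp: rimpl_def)
  qed (intro computable_intros c recf_app[OF T(1)])+
qed

lemma red_Domainp:
  assumes "red R S" "Domainp R p"
  shows "\<exists>q. Domainp S q"
  using assms unfolding red_def by blast

section \<open>Weihrauch degrees\<close>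

definition degree_rel :: "degree \<Rightarrow> baire_rel" where
  "degree_rel d = name_rel (repr d)"

lemma mem_degree_class_self: "is_problem f \<Longrightarrow> f \<in> degree_class f"
  by (simp add: degree_class_def weihrauch_le_iff_red red_refl)

lemma repr_mem_Rep_degree: "repr d \<in> Rep_degree d"
proof -
  obtain f :: "(baire, baire) problem" where "Rep_degree d = degree_class f" "is_problem f"
    using Rep_degree[of d] by blast
  then have "\<exists>f. f \<in> Rep_degree d" using mem_degree_class_self by blast
  then show ?thesis unfolding repr_def by (rule someI_ex)
qed

lemma is_problem_repr: "is_problem (repr d)"
proof -
  obtain f :: "(baire, baire) problem" where "Rep_degree d = degree_class f"
    using Rep_degree[of d] by blast
  with repr_mem_Rep_degree[of d] show ?thesis by (simp add: degree_class_def)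
qed

text \<open>\<open>repr\<close> may return any member of the class, so operations on degrees are
  accessible only up to mutual reducibility; the elimination rules for the operations supply both
  reductions.\<close>

lemma wdegE:
  assumes "is_problem f"
  obtains d where "wdeg f = Deg d" "red (degree_rel d) (name_rel f)" "red (name_rel f) (degree_rel d)"
proof (rule that[of "Abs_degree (degree_class f)"])
  let ?d = "Abs_degree (degree_class f)"
  show "wdeg f = Deg ?d" by (simp add: wdeg_def)
  have "repr ?d \<in> degree_class f"
    using repr_mem_Rep_degree[of ?d] Abs_degree_inverse[OF degree_class_in_range[OF assms]] by simp
  then show "red (degree_rel ?d) (name_rel f)" "red (name_rel f) (degree_rel ?d)"
    by (simp_all add: degree_class_def degree_rel_def weihrauch_le_iff_red[symmetric] assms)
qed

lemma Deg_le_Deg: "Deg a \<le>\<^sub>W Deg b \<longleftrightarrow> red (degree_rel a) (degree_rel b)"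
  by (simp add: degree_rel_def weihrauch_le_iff_red is_problem_repr)

lemma wle_refl: "a \<le>\<^sub>W a"
  by (cases a) (simp_all add: Deg_le_Deg red_refl del: wle.simps(3))

lemma wle_trans [trans]: "a \<le>\<^sub>W b \<Longrightarrow> b \<le>\<^sub>W c \<Longrightarrow> a \<le>\<^sub>W c"
  by (cases a; cases b; cases c) (auto simp: Deg_le_Deg simp del: wle.simps(3) intro: red_trans)

section \<open>Operations on degrees in terms of name relations\<close>

lemma wtimesE:
  obtains d where "wtimes (Deg a) (Deg b) = Deg d"
    "red (degree_rel d) (rtimes (degree_rel a) (degree_rel b))"
    "red (rtimes (degree_rel a) (degree_rel b)) (degree_rel d)"
  using wdegE[OF is_problem_prob_times[OF is_problem_repr[of a] is_problem_repr[of b]]]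
  by (auto simp: name_rel_prob_times degree_rel_def)

lemma wsqcupE:
  obtains d where "wsqcup (Deg a) (Deg b) = Deg d"
    "red (degree_rel d) (rsqcup (degree_rel a) (degree_rel b))"
    "red (rsqcup (degree_rel a) (degree_rel b)) (degree_rel d)"
  using wdegE[OF is_problem_prob_sqcup[OF is_problem_repr[of a] is_problem_repr[of b]]]
  by (auto simp: name_rel_prob_sqcup degree_rel_def)

lemma wsqcapE:
  obtains d where "wsqcap (Deg a) (Deg b) = Deg d"
    "red (degree_rel d) (rsqcap (degree_rel a) (degree_rel b))"
    "red (rsqcap (degree_rel a) (degree_rel b)) (degree_rel d)"
  using wdegE[OF is_problem_prob_sqcap[OF is_problem_repr[of a] is_problem_repr[of b]]]
  by (auto simp: name_rel_prob_sqcap is_problem_repr degree_rel_def)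

lemma wstarE:
  obtains d where "wstar (Deg a) (Deg b) = Deg d"
    "red (degree_rel d) (rstar (degree_rel a) (degree_rel b))"
    "red (rstar (degree_rel a) (degree_rel b)) (degree_rel d)"
  using wdegE[OF is_problem_prob_star[OF is_problem_repr[of a] is_problem_repr[of b]]]
  by (auto simp: name_rel_prob_star is_problem_repr degree_rel_def)

lemma mdom_repr_eq_empty: "mdom (val (repr d)) = {} \<longleftrightarrow> (\<forall>p. \<not> Domainp (degree_rel d) p)"
proof -
  have "mdom (val (repr d)) \<subseteq> ran (src (repr d))"
    using is_problem_repr[of d] by (simp add: is_problem_def)
  then show ?thesis
    unfolding degree_rel_def Domainp_name_rel[OF is_problem_repr] by (auto simp: ran_def)
qed

lemma wimplE:
  assumes "\<And>p. Domainp (degree_rel b) p \<Longrightarrow> \<exists>x. Domainp (degree_rel a) x"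
  obtains d where "wimpl (Deg a) (Deg b) = Deg d"
    "red (degree_rel d) (rimpl (degree_rel a) (degree_rel b))"
    "red (rimpl (degree_rel a) (degree_rel b)) (degree_rel d)"
proof -
  have "\<not> (mdom (val (repr a)) = {} \<and> mdom (val (repr b)) \<noteq> {})"
    using assms unfolding mdom_repr_eq_empty by blast
  then have "wimpl (Deg a) (Deg b) = wdeg (prob_impl (repr a) (repr b))"
    by auto
  with wdegE[OF is_problem_prob_impl[OF is_problem_repr[of b] is_problem_repr[of a]]] that
  show ?thesis
    by (auto simp: name_rel_prob_impl is_problem_repr degree_rel_def)
qed

lemma wstar_Infty [simp]: "wstar a Infty = Infty" "wstar Infty a = Infty"
  by (cases a; simp)+

lemma wtimes_Infty [simp]: "wtimes a Infty = Infty" "wtimes Infty a = Infty"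
  by (cases a; simp)+

lemma wsqcup_Infty [simp]: "wsqcup a Infty = Infty" "wsqcup Infty a = Infty"
  by (cases a; simp)+

lemma wsqcap_Infty [simp]: "wsqcap a Infty = a" "wsqcap Infty a = a"
  by (cases a; simp)+

section \<open>Laws of the degrees with top element\<close>

lemma wstar_mono:
  assumes "a \<le>\<^sub>W a'" "b \<le>\<^sub>W b'"
  shows "wstar a b \<le>\<^sub>W wstar a' b'"
proof (cases "a' = Infty \<or> b' = Infty")
  case False
  then obtain x' y' where 1: "a' = Deg x'" "b' = Deg y'" by (cases a'; cases b') auto
  with assms obtain x y where 2: "a = Deg x" "b = Deg y" by (cases a; cases b) auto
  obtain d where d: "wstar a b = Deg d" "red (degree_rel d) (rstar (degree_rel x) (degree_rel y))"
    unfolding 2 by (rule wstarE)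
  obtain d' where d': "wstar a' b' = Deg d'" "red (rstar (degree_rel x') (degree_rel y')) (degree_rel d')"
    unfolding 1 by (rule wstarE)
  have "red (rstar (degree_rel x) (degree_rel y)) (rstar (degree_rel x') (degree_rel y'))"
    using assms unfolding 1 2 Deg_le_Deg by (rule rstar_mono)
  then show ?thesis
    unfolding d d' Deg_le_Deg using d(2) d'(2) by (blast intro: red_trans)
qed auto

lemma wstar_assoc_le: "wstar (wstar a b) c \<le>\<^sub>W wstar a (wstar b c)"
proof (cases "a = Infty \<or> b = Infty \<or> c = Infty")
  case False
  then obtain x y z where 1: "a = Deg x" "b = Deg y" "c = Deg z" by (cases a; cases b; cases c) auto
  obtain p where p: "wstar a b = Deg p" "red (degree_rel p) (rstar (degree_rel x) (degree_rel y))"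
    unfolding 1 by (rule wstarE)
  obtain q where q: "wstar b c = Deg q" "red (rstar (degree_rel y) (degree_rel z)) (degree_rel q)"
    unfolding 1 by (rule wstarE)
  obtain d where d: "wstar (Deg p) c = Deg d" "red (degree_rel d) (rstar (degree_rel p) (degree_rel z))"
    unfolding 1 by (rule wstarE)
  obtain e where e: "wstar a (Deg q) = Deg e" "red (rstar (degree_rel x) (degree_rel q)) (degree_rel e)"
    unfolding 1 by (rule wstarE)
  show ?thesis
    unfolding p(1) q(1) d(1) e(1) Deg_le_Deg
    by (rule d(2)[THEN red_trans, OF rstar_mono[OF p(2) red_refl, THEN red_trans,
        OF rstar_assoc_le[THEN red_trans, OF rstar_mono[OF red_refl q(2), THEN red_trans, OF e(2)]]]])
qed auto

lemma wstar_assoc_ge: "wstar a (wstar b c) \<le>\<^sub>W wstar (wstar a b) c"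
proof (cases "a = Infty \<or> b = Infty \<or> c = Infty")
  case False
  then obtain x y z where 1: "a = Deg x" "b = Deg y" "c = Deg z" by (cases a; cases b; cases c) auto
  obtain p where p: "wstar a b = Deg p" "red (rstar (degree_rel x) (degree_rel y)) (degree_rel p)"
    unfolding 1 by (rule wstarE)
  obtain q where q: "wstar b c = Deg q" "red (degree_rel q) (rstar (degree_rel y) (degree_rel z))"
    unfolding 1 by (rule wstarE)
  obtain d where d: "wstar (Deg p) c = Deg d" "red (rstar (degree_rel p) (degree_rel z)) (degree_rel d)"
    unfolding 1 by (rule wstarE)
  obtain e where e: "wstar a (Deg q) = Deg e" "red (degree_rel e) (rstar (degree_rel x) (degree_rel q))"
    unfolding 1 by (rule wstarE)
  show ?thesis
    unfolding p(1) q(1) d(1) e(1) Deg_le_Deg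
    by (rule e(2)[THEN red_trans, OF rstar_mono[OF red_refl q(2), THEN red_trans,
        OF rstar_assoc_ge[THEN red_trans, OF rstar_mono[OF p(2) red_refl, THEN red_trans, OF d(2)]]]])
qed auto

lemma wle_wstar_wone: "a \<le>\<^sub>W wstar a wone"
proof (cases a)
  case (Deg x)
  have i: "is_problem prob_id"
    by (auto simp: is_problem_iff prob_id_def baire_space_def)
  have "name_rel prob_id = (=)"
    by (auto simp: fun_eq_iff name_rel_def prob_id_def baire_space_def)
  with wdegE[OF i] obtain u where u: "wone = Deg u" "red (=) (degree_rel u)"
    unfolding wone_def by metis
  obtain d where d: "wstar a wone = Deg d" "red (rstar (degree_rel x) (degree_rel u)) (degree_rel d)"
    unfolding Deg u(1) by (rule wstarE)
  show ?thesis
    unfolding d(1) unfolding Deg Deg_le_Deg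
    by (rule red_rstar_id[THEN red_trans, OF rstar_mono[OF red_refl u(2), THEN red_trans, OF d(2)]])
qed simp

lemma wsqcap_le1: "wsqcap a b \<le>\<^sub>W a"
proof (cases "a = Infty \<or> b = Infty")
  case False
  then obtain x y where 1: "a = Deg x" "b = Deg y" by (cases a; cases b) auto
  obtain d where d: "wsqcap a b = Deg d" "red (degree_rel d) (rsqcap (degree_rel x) (degree_rel y))"
    unfolding 1 by (rule wsqcapE)
  show ?thesis
    unfolding d(1) unfolding 1 Deg_le_Deg using d(2) rsqcap_le1 by (rule red_trans)
qed (auto simp: wle_refl)

lemma wsqcap_le2: "wsqcap a b \<le>\<^sub>W b"
proof (cases "a = Infty \<or> b = Infty")
  case False
  then obtain x y where 1: "a = Deg x" "b = Deg y" by (cases a; cases b) auto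
  obtain d where d: "wsqcap a b = Deg d" "red (degree_rel d) (rsqcap (degree_rel x) (degree_rel y))"
    unfolding 1 by (rule wsqcapE)
  show ?thesis
    unfolding d(1) unfolding 1 Deg_le_Deg using d(2) rsqcap_le2 by (rule red_trans)
qed (auto simp: wle_refl)

lemma wsqcap_greatest:
  assumes "c \<le>\<^sub>W a" "c \<le>\<^sub>W b"
  shows "c \<le>\<^sub>W wsqcap a b"
proof (cases "a = Infty \<or> b = Infty")
  case False
  then obtain x y where 1: "a = Deg x" "b = Deg y" by (cases a; cases b) auto
  with assms obtain z where 2: "c = Deg z" by (cases c) auto
  obtain d where d: "wsqcap a b = Deg d" "red (rsqcap (degree_rel x) (degree_rel y)) (degree_rel d)"
    unfolding 1 by (rule wsqcapE)
  show ?thesis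
    using assms unfolding d(1) unfolding 1 2 Deg_le_Deg
    by (blast intro: red_trans[OF _ d(2)] rsqcap_greatest)
qed (use assms in auto)

lemma wsqcup_ge1: "a \<le>\<^sub>W wsqcup a b"
proof (cases "a = Infty \<or> b = Infty")
  case False
  then obtain x y where 1: "a = Deg x" "b = Deg y" by (cases a; cases b) auto
  obtain d where d: "wsqcup a b = Deg d" "red (rsqcup (degree_rel x) (degree_rel y)) (degree_rel d)"
    unfolding 1 by (rule wsqcupE)
  show ?thesis
    unfolding d(1) unfolding 1 Deg_le_Deg using rsqcup_ge1 d(2) by (rule red_trans)
qed auto

lemma wsqcup_ge2: "b \<le>\<^sub>W wsqcup a b"
proof (cases "a = Infty \<or> b = Infty")
  case False
  then obtain x y where 1: "a = Deg x" "b = Deg y" by (cases a; cases b) auto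
  obtain d where d: "wsqcup a b = Deg d" "red (rsqcup (degree_rel x) (degree_rel y)) (degree_rel d)"
    unfolding 1 by (rule wsqcupE)
  show ?thesis
    unfolding d(1) unfolding 1 Deg_le_Deg using rsqcup_ge2 d(2) by (rule red_trans)
qed auto

lemma wsqcup_least:
  assumes "a \<le>\<^sub>W c" "b \<le>\<^sub>W c"
  shows "wsqcup a b \<le>\<^sub>W c"
proof (cases c)
  case (Deg z)
  with assms obtain x y where 1: "a = Deg x" "b = Deg y" by (cases a; cases b) auto
  obtain d where d: "wsqcup a b = Deg d" "red (degree_rel d) (rsqcup (degree_rel x) (degree_rel y))"
    unfolding 1 by (rule wsqcupE)
  show ?thesis
    using assms unfolding d(1) unfolding 1 Deg Deg_le_Deg
    by (blast intro: red_trans[OF d(2)] rsqcup_least)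
qed simp

lemma wtimes_mono:
  assumes "a \<le>\<^sub>W a'" "b \<le>\<^sub>W b'"
  shows "wtimes a b \<le>\<^sub>W wtimes a' b'"
proof (cases "a' = Infty \<or> b' = Infty")
  case False
  then obtain x' y' where 1: "a' = Deg x'" "b' = Deg y'" by (cases a'; cases b') auto
  with assms obtain x y where 2: "a = Deg x" "b = Deg y" by (cases a; cases b) auto
  obtain d where d: "wtimes a b = Deg d" "red (degree_rel d) (rtimes (degree_rel x) (degree_rel y))"
    unfolding 2 by (rule wtimesE)
  obtain d' where d': "wtimes a' b' = Deg d'" "red (rtimes (degree_rel x') (degree_rel y')) (degree_rel d')"
    unfolding 1 by (rule wtimesE)
  have "red (rtimes (degree_rel x) (degree_rel y)) (rtimes (degree_rel x') (degree_rel y'))"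
    using assms unfolding 1 2 Deg_le_Deg by (rule rtimes_mono)
  then show ?thesis
    unfolding d d' Deg_le_Deg using d(2) d'(2) by (blast intro: red_trans)
qed auto

lemma wtimes_wstar: "wtimes (wstar a c) (wstar b d) \<le>\<^sub>W wstar (wtimes a b) (wtimes c d)"
proof (cases "a = Infty \<or> b = Infty \<or> c = Infty \<or> d = Infty")
  case False
  then obtain x y z w where 1: "a = Deg x" "b = Deg y" "c = Deg z" "d = Deg w"
    by (cases a; cases b; cases c; cases d) auto
  obtain p where p: "wstar a c = Deg p" "red (degree_rel p) (rstar (degree_rel x) (degree_rel z))"
    unfolding 1 by (rule wstarE)
  obtain q where q: "wstar b d = Deg q" "red (degree_rel q) (rstar (degree_rel y) (degree_rel w))"
    unfolding 1 by (rule wstarE)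
  obtain l where l: "wtimes (Deg p) (Deg q) = Deg l" "red (degree_rel l) (rtimes (degree_rel p) (degree_rel q))"
    by (rule wtimesE)
  obtain s where s: "wtimes a b = Deg s" "red (rtimes (degree_rel x) (degree_rel y)) (degree_rel s)"
    unfolding 1 by (rule wtimesE)
  obtain t where t: "wtimes c d = Deg t" "red (rtimes (degree_rel z) (degree_rel w)) (degree_rel t)"
    unfolding 1 by (rule wtimesE)
  obtain r where r: "wstar (Deg s) (Deg t) = Deg r" "red (rstar (degree_rel s) (degree_rel t)) (degree_rel r)"
    by (rule wstarE)
  show ?thesis
    unfolding p(1) q(1) l(1) s(1) t(1) r(1) Deg_le_Deg
    by (rule l(2)[THEN red_trans, OF rtimes_mono[OF p(2) q(2), THEN red_trans,
        OF rtimes_rstar[THEN red_trans, OF rstar_mono[OF s(2) t(2), THEN red_trans, OF r(2)]]]])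
qed auto

lemma wle_wtimes_self: "a \<le>\<^sub>W wtimes a a"
proof (cases a)
  case (Deg x)
  obtain d where d: "wtimes a a = Deg d" "red (rtimes (degree_rel x) (degree_rel x)) (degree_rel d)"
    unfolding Deg by (rule wtimesE)
  show ?thesis
    unfolding d(1) unfolding Deg Deg_le_Deg using rtimes_diag d(2) by (rule red_trans)
qed simp

lemma wtimes_le_wstar: "wtimes a b \<le>\<^sub>W wstar a b"
proof (cases "a = Infty \<or> b = Infty")
  case False
  then obtain x y where 1: "a = Deg x" "b = Deg y" by (cases a; cases b) auto
  obtain d where d: "wtimes a b = Deg d" "red (degree_rel d) (rtimes (degree_rel x) (degree_rel y))"
    unfolding 1 by (rule wtimesE)
  obtain e where e: "wstar a b = Deg e" "red (rstar (degree_rel x) (degree_rel y)) (degree_rel e)"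
    unfolding 1 by (rule wstarE)
  show ?thesis
    unfolding d(1) e(1) Deg_le_Deg
    by (rule d(2)[THEN red_trans, OF rtimes_le_rstar[THEN red_trans, OF e(2)]])
qed auto

text \<open>
  Only one degree \<open>c\<close> is allowed on the left: with two of them, \<open>b = \<infinity>\<close> would require
  \<open>c \<le> c \<times> d\<close>, which fails for \<open>d = 0\<close>.
\<close>

lemma wsqcap_wstar: "wsqcap (wstar a c) (wstar b c) \<le>\<^sub>W wstar (wsqcap a b) (wtimes c c)"
proof (cases "a = Infty \<or> b = Infty \<or> c = Infty")
  case False
  then obtain x y z where 1: "a = Deg x" "b = Deg y" "c = Deg z" by (cases a; cases b; cases c) auto
  obtain p where p: "wstar a c = Deg p" "red (degree_rel p) (rstar (degree_rel x) (degree_rel z))"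
    unfolding 1 by (rule wstarE)
  obtain q where q: "wstar b c = Deg q" "red (degree_rel q) (rstar (degree_rel y) (degree_rel z))"
    unfolding 1 by (rule wstarE)
  obtain l where l: "wsqcap (Deg p) (Deg q) = Deg l" "red (degree_rel l) (rsqcap (degree_rel p) (degree_rel q))"
    by (rule wsqcapE)
  obtain s where s: "wsqcap a b = Deg s" "red (rsqcap (degree_rel x) (degree_rel y)) (degree_rel s)"
    unfolding 1 by (rule wsqcapE)
  obtain t where t: "wtimes c c = Deg t" "red (rtimes (degree_rel z) (degree_rel z)) (degree_rel t)"
    unfolding 1 by (rule wtimesE)
  obtain r where r: "wstar (Deg s) (Deg t) = Deg r" "red (rstar (degree_rel s) (degree_rel t)) (degree_rel r)"
    by (rule wstarE)
  \<comment> \<open>Monotonicity of the meet, obtained from its being the greatest lower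
    bound.\<close>
  have "red (rsqcap (degree_rel p) (degree_rel q))
      (rsqcap (rstar (degree_rel x) (degree_rel z)) (rstar (degree_rel y) (degree_rel z)))"
    using red_trans[OF rsqcap_le1 p(2)] red_trans[OF rsqcap_le2 q(2)] by (rule rsqcap_greatest)
  then show ?thesis
    unfolding p(1) q(1) l(1) s(1) t(1) r(1) Deg_le_Deg
    by (rule l(2)[THEN red_trans, OF red_trans, OF _
        rsqcap_rstar[THEN red_trans, OF rstar_mono[OF s(2) t(2), THEN red_trans, OF r(2)]]])
qed (elim disjE; simp add: wstar_mono wle_refl wle_wtimes_self)

lemma wle_wstar_wimpl: "b \<le>\<^sub>W wstar a (wimpl a b)"
proof (cases "a = Infty \<or> b = Infty")
  case True
  then show ?thesis by (cases a) auto
next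
  case False
  then obtain x y where 1: "a = Deg x" "b = Deg y" by (cases a; cases b) auto
  show ?thesis
  \<comment> \<open>In the first case the implication is \<open>Infty\<close> by convention, and so
    is the right side.\<close>
  proof (cases "(\<forall>p. \<not> Domainp (degree_rel x) p) \<and> (\<exists>p. Domainp (degree_rel y) p)")
    case True
    then show ?thesis unfolding 1 by (simp add: mdom_repr_eq_empty)
  next
    case False
    then have D: "\<exists>q. Domainp (degree_rel x) q" if "Domainp (degree_rel y) p" for p
      using that by blast
    then obtain d where d: "wimpl a b = Deg d" "red (rimpl (degree_rel x) (degree_rel y)) (degree_rel d)"
      unfolding 1 by (rule wimplE)
    obtain e where e: "wstar a (Deg d) = Deg e" "red (rstar (degree_rel x) (degree_rel d)) (degree_rel e)"
      unfolding 1 by (rule wstarE)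
    show ?thesis
      unfolding d(1) e(1) unfolding 1 Deg_le_Deg
      by (rule red_rstar_rimpl[OF D, THEN red_trans, OF _
          rstar_mono[OF red_refl d(2), THEN red_trans, OF e(2)]])
  qed
qed

lemma wzero_le: "wzero \<le>\<^sub>W a"
proof (cases a)
  case (Deg x)
  have p: "is_problem prob_zero" and "name_rel prob_zero = (\<lambda>_ _. False)"
    by (auto simp: is_problem_iff prob_zero_def name_rel_def fun_eq_iff)
  with wdegE[OF p] obtain d where d: "wzero = Deg d" "red (degree_rel d) (\<lambda>_ _. False)"
    unfolding wzero_def by metis
  have "red (\<lambda>_ _. False) (degree_rel x)"
    by (rule redI[of Some Some]) (auto intro: computable_intros)
  with d(2) show ?thesis unfolding Deg d(1) Deg_le_Deg by (rule red_trans)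
qed simp

lemma wimpl_least:
  assumes "b \<le>\<^sub>W wstar a c"
  shows "wimpl a b \<le>\<^sub>W c"
proof (cases "a = Infty \<or> c = Infty")
  case True
  then show ?thesis by (auto simp: wzero_le)
next
  case False
  then obtain x z where 1: "a = Deg x" "c = Deg z" by (cases a; cases c) auto
  obtain e where e: "wstar a c = Deg e" "red (degree_rel e) (rstar (degree_rel x) (degree_rel z))"
    unfolding 1 by (rule wstarE)
  with assms obtain y where 2: "b = Deg y" by (cases b) auto
  have r: "red (degree_rel y) (rstar (degree_rel x) (degree_rel z))"
    using assms e(2) unfolding e(1) 2 Deg_le_Deg by (rule red_trans)
  \<comment> \<open>An instance of b is mapped to an instance of a * c, and solving that passes
    through an instance of a. Hence the implication does not take the value
    \<open>Infty\<close>.\<close>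
  have "\<exists>q. Domainp (degree_rel x) q" if p: "Domainp (degree_rel y) p" for p
  proof -
    obtain n where "Domainp (rstar (degree_rel x) (degree_rel z)) n"
      using red_Domainp[OF r p] by blast
    then obtain t where "rstar (degree_rel x) (degree_rel z) n t"
      by (rule DomainpE)
    then obtain w where "degree_rel x (bsnd w) (bsnd t)"
      unfolding rstar_def by blast
    then show ?thesis
      by (intro exI[of _ "bsnd w"] DomainPI[of "degree_rel x"])
  qed
  then obtain d where d: "wimpl a b = Deg d" "red (degree_rel d) (rimpl (degree_rel x) (degree_rel y))"
    unfolding 1 2 by (rule wimplE)
  show ?thesis
    unfolding d(1) unfolding 1 Deg_le_Deg using d(2) rimpl_least[OF r] by (rule red_trans)
qed

section \<open>The quotient by a preideal\<close>

text \<open>By monotonicity of \<open>wstar\<close>, a witness may be replaced by anything above it.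
  This makes the ideal axioms of the closure available.\<close>

lemma rel_le_iff: "(a, b) \<in> rel_le A \<longleftrightarrow> (\<exists>c\<in>down_closure A. a \<le>\<^sub>W wstar b c)"
proof
  assume "(a, b) \<in> rel_le A"
  then obtain c where "c \<in> A" "a \<le>\<^sub>W wstar b c" by (auto simp: rel_le_def)
  moreover from this have "c \<in> down_closure A" unfolding down_closure_def using wle_refl by blast
  ultimately show "\<exists>c\<in>down_closure A. a \<le>\<^sub>W wstar b c" by blast
next
  assume "\<exists>c\<in>down_closure A. a \<le>\<^sub>W wstar b c"
  then obtain c c' where "c' \<in> A" "c \<le>\<^sub>W c'" "a \<le>\<^sub>W wstar b c" by (auto simp: down_closure_def)
  then show "(a, b) \<in> rel_le A"
    unfolding rel_le_def by (blast intro: wle_trans wstar_mono wle_refl)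
qed

context
  fixes A :: "wdegree set"
  assumes preideal: "star_preideal A"
begin

lemma down_closure_closed:
  "wone \<in> down_closure A"
  "b \<in> down_closure A \<Longrightarrow> a \<le>\<^sub>W b \<Longrightarrow> a \<in> down_closure A"
  "a \<in> down_closure A \<Longrightarrow> b \<in> down_closure A \<Longrightarrow> wstar a b \<in> down_closure A"
  "a \<in> down_closure A \<Longrightarrow> b \<in> down_closure A \<Longrightarrow> wsqcup a b \<in> down_closure A"
  using preideal unfolding star_preideal_def star_ideal_def by blast+

section \<open>Inequalities modulo the ideal\<close>

lemma rel_le_of_wle: "a \<le>\<^sub>W b \<Longrightarrow> (a, b) \<in> rel_le A"
  unfolding rel_le_iff using down_closure_closed(1) wle_wstar_wone wle_trans by blast

lemma rel_le_refl: "(a, a) \<in> rel_le A"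
  by (rule rel_le_of_wle[OF wle_refl])

lemma rel_le_trans:
  assumes "(a, b) \<in> rel_le A" "(b, c) \<in> rel_le A"
  shows "(a, c) \<in> rel_le A"
proof -
  obtain d e where d: "d \<in> down_closure A" "a \<le>\<^sub>W wstar b d"
    and e: "e \<in> down_closure A" "b \<le>\<^sub>W wstar c e"
    using assms unfolding rel_le_iff by blast
  have "a \<le>\<^sub>W wstar (wstar c e) d"
    using d(2) wstar_mono[OF e(2) wle_refl] by (rule wle_trans)
  then have "a \<le>\<^sub>W wstar c (wstar e d)"
    using wstar_assoc_le by (rule wle_trans)
  then show ?thesis
    unfolding rel_le_iff using down_closure_closed(3)[OF e(1) d(1)] by blast
qed

text \<open>Closure under joins lets two inequalities share one witness. Least upper bounds and
  \<open>wsqcap_wstar\<close> require the same c on both sides.\<close>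

lemma rel_le_common:
  assumes "(a, b) \<in> rel_le A" "(a', b') \<in> rel_le A"
  obtains c where "c \<in> down_closure A" "a \<le>\<^sub>W wstar b c" "a' \<le>\<^sub>W wstar b' c"
proof -
  obtain d e where d: "d \<in> down_closure A" "a \<le>\<^sub>W wstar b d"
    and e: "e \<in> down_closure A" "a' \<le>\<^sub>W wstar b' e"
    using assms unfolding rel_le_iff by blast
  show ?thesis
  proof (rule that[of "wsqcup d e"])
    show "wsqcup d e \<in> down_closure A" using d(1) e(1) by (rule down_closure_closed)
    show "a \<le>\<^sub>W wstar b (wsqcup d e)"
      using d(2) wstar_mono[OF wle_refl wsqcup_ge1] by (rule wle_trans)
    show "a' \<le>\<^sub>W wstar b' (wsqcup d e)"
      using e(2) wstar_mono[OF wle_refl wsqcup_ge2] by (rule wle_trans)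
  qed
qed

lemma wtimes_mem_down_closure:
  "a \<in> down_closure A \<Longrightarrow> b \<in> down_closure A \<Longrightarrow> wtimes a b \<in> down_closure A"
  using down_closure_closed(2)[OF down_closure_closed(3) wtimes_le_wstar] .

text \<open>Serves twice: as the infimum property in the quotient and, through it, for the
  compatibility of the meet with the equivalence.\<close>

lemma rel_le_wsqcap:
  assumes "(x, a) \<in> rel_le A" "(x, b) \<in> rel_le A"
  shows "(x, wsqcap a b) \<in> rel_le A"
proof -
  obtain c where c: "c \<in> down_closure A" "x \<le>\<^sub>W wstar a c" "x \<le>\<^sub>W wstar b c"
    using assms by (rule rel_le_common)
  have "x \<le>\<^sub>W wstar (wsqcap a b) (wtimes c c)"
    using wsqcap_greatest[OF c(2,3)] wsqcap_wstar by (rule wle_trans)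
  then show ?thesis
    unfolding rel_le_iff using wtimes_mem_down_closure[OF c(1) c(1)] by blast
qed

lemma rel_le_wsqcup:
  assumes "(a, x) \<in> rel_le A" "(b, x) \<in> rel_le A"
  shows "(wsqcup a b, x) \<in> rel_le A"
proof -
  obtain c where c: "c \<in> down_closure A" "a \<le>\<^sub>W wstar x c" "b \<le>\<^sub>W wstar x c"
    using assms by (rule rel_le_common)
  then show ?thesis unfolding rel_le_iff using wsqcup_least by blast
qed

lemma rel_le_wtimes:
  assumes "(a, a') \<in> rel_le A" "(b, b') \<in> rel_le A"
  shows "(wtimes a b, wtimes a' b') \<in> rel_le A"
proof -
  obtain c where c: "c \<in> down_closure A" "a \<le>\<^sub>W wstar a' c" "b \<le>\<^sub>W wstar b' c"
    using assms by (rule rel_le_common)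
  have "wtimes a b \<le>\<^sub>W wstar (wtimes a' b') (wtimes c c)"
    using wtimes_mono[OF c(2,3)] wtimes_wstar by (rule wle_trans)
  then show ?thesis
    unfolding rel_le_iff using wtimes_mem_down_closure[OF c(1) c(1)] by blast
qed

lemma etherE:
  assumes "etheric_star_preideal A" "c \<in> down_closure A"
  obtains c' where "c' \<in> down_closure A" "wstar c b \<le>\<^sub>W wstar b c'"
  using assms unfolding etheric_star_preideal_def etheric_star_ideal_def by blast

lemma rel_le_wstar:
  assumes ether: "etheric_star_preideal A"
    and "(a, a') \<in> rel_le A" "(b, b') \<in> rel_le A"
  shows "(wstar a b, wstar a' b') \<in> rel_le A"
proof -
  obtain c where c: "c \<in> down_closure A" "a \<le>\<^sub>W wstar a' c" "b \<le>\<^sub>W wstar b' c"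
    using assms(2,3) by (rule rel_le_common)
  \<comment> \<open>The whole product b' * c is taken as the second factor, so that the c belonging
    to a' passes it in one move.\<close>
  obtain c' where c': "c' \<in> down_closure A" "wstar c (wstar b' c) \<le>\<^sub>W wstar (wstar b' c) c'"
    using ether c(1) by (rule etherE)
  have "wstar a b \<le>\<^sub>W wstar (wstar a' c) (wstar b' c)"
    by (rule wstar_mono[OF c(2,3)])
  also have "wstar (wstar a' c) (wstar b' c) \<le>\<^sub>W wstar a' (wstar c (wstar b' c))"
    by (rule wstar_assoc_le)
  also have "wstar a' (wstar c (wstar b' c)) \<le>\<^sub>W wstar a' (wstar (wstar b' c) c')"
    by (rule wstar_mono[OF wle_refl c'(2)])
  also have "wstar a' (wstar (wstar b' c) c') \<le>\<^sub>W wstar a' (wstar b' (wstar c c'))"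
    by (rule wstar_mono[OF wle_refl wstar_assoc_le])
  also have "wstar a' (wstar b' (wstar c c')) \<le>\<^sub>W wstar (wstar a' b') (wstar c c')"
    by (rule wstar_assoc_ge)
  finally show ?thesis
    unfolding rel_le_iff using down_closure_closed(3)[OF c(1) c'(1)] by blast
qed

text \<open>The implication is antitone in its first argument, so the first assumption points
  backwards. With i for a' -> b', residuation reduces a -> b <= (i * c) * c' to b <= a * ((i * c) *
  c'). Here b <= b' * c <= a' * (i * c), then a' is bounded by a * c, and the ether condition moves
  this c behind i * c.\<close>

lemma rel_le_wimpl:
  assumes ether: "etheric_star_preideal A"
    and "(a', a) \<in> rel_le A" "(b, b') \<in> rel_le A"
  shows "(wimpl a b, wimpl a' b') \<in> rel_le A"
proof -
  obtain c where c: "c \<in> down_closure A" "a' \<le>\<^sub>W wstar a c" "b \<le>\<^sub>W wstar b' c"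
    using assms(2,3) by (rule rel_le_common)
  let ?i = "wimpl a' b'"
  obtain c' where c': "c' \<in> down_closure A" "wstar c (wstar ?i c) \<le>\<^sub>W wstar (wstar ?i c) c'"
    using ether c(1) by (rule etherE)
  note c(3)
  also have "wstar b' c \<le>\<^sub>W wstar (wstar a' ?i) c"
    by (rule wstar_mono[OF wle_wstar_wimpl wle_refl])
  also have "wstar (wstar a' ?i) c \<le>\<^sub>W wstar a' (wstar ?i c)"
    by (rule wstar_assoc_le)
  also have "wstar a' (wstar ?i c) \<le>\<^sub>W wstar (wstar a c) (wstar ?i c)"
    by (rule wstar_mono[OF c(2) wle_refl])
  also have "wstar (wstar a c) (wstar ?i c) \<le>\<^sub>W wstar a (wstar c (wstar ?i c))"
    by (rule wstar_assoc_le)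
  also have "wstar a (wstar c (wstar ?i c)) \<le>\<^sub>W wstar a (wstar (wstar ?i c) c')"
    by (rule wstar_mono[OF wle_refl c'(2)])
  finally have "wimpl a b \<le>\<^sub>W wstar (wstar ?i c) c'"
    by (rule wimpl_least)
  then have "wimpl a b \<le>\<^sub>W wstar ?i (wstar c c')"
    using wstar_assoc_le by (rule wle_trans)
  then show ?thesis
    unfolding rel_le_iff using down_closure_closed(3)[OF c(1) c'(1)] by blast
qed

section \<open>The quotient lattice\<close>

lemma equiv_rel_equiv: "equiv UNIV (rel_equiv A)"
proof (rule equivI)
  show "refl (rel_equiv A)"
    by (simp add: refl_on_def rel_equiv_def rel_le_refl)
  show "sym (rel_equiv A)"
    by (simp add: sym_def rel_equiv_def)
  show "trans (rel_equiv A)"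
    unfolding trans_def rel_equiv_def mem_Collect_eq prod.case using rel_le_trans by blast
qed simp

text \<open>The order on classes asks for some pair of representatives; by transitivity every pair
  gives the same answer.\<close>

lemma le_quotient_order_class:
  "le (quotient_order A) (rel_equiv A `` {a}) (rel_equiv A `` {b}) \<longleftrightarrow> (a, b) \<in> rel_le A"
proof
  assume "le (quotient_order A) (rel_equiv A `` {a}) (rel_equiv A `` {b})"
  then obtain a' b' where "(a, a') \<in> rel_le A" "(a', b') \<in> rel_le A" "(b', b) \<in> rel_le A"
    by (auto simp: quotient_order_def rel_equiv_def)
  then show "(a, b) \<in> rel_le A" using rel_le_trans by blast
next
  assume "(a, b) \<in> rel_le A"
  moreover have "a \<in> rel_equiv A `` {a}" "b \<in> rel_equiv A `` {b}"
    by (simp_all add: rel_equiv_def rel_le_refl)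
  ultimately show "le (quotient_order A) (rel_equiv A `` {a}) (rel_equiv A `` {b})"
    unfolding quotient_order_def by auto
qed

lemma carrier_quotient_order: "carrier (quotient_order A) = range (\<lambda>a. rel_equiv A `` {a})"
  by (auto simp: quotient_order_def quotient_def)

lemma induced_operation_class:
  assumes "induces_operation A f"
  shows "induced_operation A f (rel_equiv A `` {a}) (rel_equiv A `` {b}) = rel_equiv A `` {f a b}"
proof -
  have "rel_equiv A `` {f a' b'} = rel_equiv A `` {f a b}"
    if "(a, a') \<in> rel_equiv A" "(b, b') \<in> rel_equiv A" for a' b'
    using assms that equiv_class_eq[OF equiv_rel_equiv, of "f a b" "f a' b'"]
    unfolding induces_operation_def by metis
  moreover have "(a, a) \<in> rel_equiv A" "(b, b) \<in> rel_equiv A"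
    by (simp_all add: rel_equiv_def rel_le_refl)
  ultimately show ?thesis
    unfolding induced_operation_def by blast
qed

lemma partial_order_quotient_order: "partial_order (quotient_order A)"
proof -
  have eq: "eq (quotient_order A) = (=)"
    by (simp add: quotient_order_def)
  show ?thesis
  proof (unfold_locales, unfold eq carrier_quotient_order)
    fix x y
    assume "x \<in> range (\<lambda>a. rel_equiv A `` {a})" "y \<in> range (\<lambda>a. rel_equiv A `` {a})"
      "le (quotient_order A) x y" "le (quotient_order A) y x"
    then obtain a b where "x = rel_equiv A `` {a}" "y = rel_equiv A `` {b}"
      "(a, b) \<in> rel_le A" "(b, a) \<in> rel_le A"
      by (auto simp: le_quotient_order_class)
    then show "x = y"
      using equiv_class_eq[OF equiv_rel_equiv, of a b] by (simp add: rel_equiv_def)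
  next
    fix x y z
    assume "x \<in> range (\<lambda>a. rel_equiv A `` {a})" "y \<in> range (\<lambda>a. rel_equiv A `` {a})"
      "z \<in> range (\<lambda>a. rel_equiv A `` {a})"
      and xyz: "le (quotient_order A) x y" "le (quotient_order A) y z"
    then obtain a b c where abc: "x = rel_equiv A `` {a}" "y = rel_equiv A `` {b}" "z = rel_equiv A `` {c}"
      by blast
    show "le (quotient_order A) x z"
      using xyz rel_le_trans unfolding abc le_quotient_order_class by blast
  qed (auto simp: le_quotient_order_class rel_le_refl)
qed

lemma is_glb_wsqcap:
  "is_glb (quotient_order A) (rel_equiv A `` {wsqcap a b}) {rel_equiv A `` {a}, rel_equiv A `` {b}}"
proof (rule greatest_LowerI)
  fix x assume "x \<in> {rel_equiv A `` {a}, rel_equiv A `` {b}}"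
  then consider "x = rel_equiv A `` {a}" | "x = rel_equiv A `` {b}" by blast
  then show "le (quotient_order A) (rel_equiv A `` {wsqcap a b}) x"
    by cases (simp_all only: le_quotient_order_class rel_le_of_wle wsqcap_le1 wsqcap_le2)
next
  fix y assume y: "y \<in> Lower (quotient_order A) {rel_equiv A `` {a}, rel_equiv A `` {b}}"
  then obtain c where c: "y = rel_equiv A `` {c}"
    unfolding Lower_def carrier_quotient_order by blast
  have "le (quotient_order A) y (rel_equiv A `` {a})" "le (quotient_order A) y (rel_equiv A `` {b})"
    using y unfolding Lower_def carrier_quotient_order by blast+
  then show "le (quotient_order A) y (rel_equiv A `` {wsqcap a b})"
    unfolding c le_quotient_order_class by (rule rel_le_wsqcap)
qed (auto simp only: carrier_quotient_order)

lemma is_lub_wsqcup: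
  "is_lub (quotient_order A) (rel_equiv A `` {wsqcup a b}) {rel_equiv A `` {a}, rel_equiv A `` {b}}"
proof (rule least_UpperI)
  fix x assume "x \<in> {rel_equiv A `` {a}, rel_equiv A `` {b}}"
  then consider "x = rel_equiv A `` {a}" | "x = rel_equiv A `` {b}" by blast
  then show "le (quotient_order A) x (rel_equiv A `` {wsqcup a b})"
    by cases (simp_all only: le_quotient_order_class rel_le_of_wle wsqcup_ge1 wsqcup_ge2)
next
  fix y assume y: "y \<in> Upper (quotient_order A) {rel_equiv A `` {a}, rel_equiv A `` {b}}"
  then obtain c where c: "y = rel_equiv A `` {c}"
    unfolding Upper_def carrier_quotient_order by blast
  have "le (quotient_order A) (rel_equiv A `` {a}) y" "le (quotient_order A) (rel_equiv A `` {b}) y"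
    using y unfolding Upper_def carrier_quotient_order by blast+
  then show "le (quotient_order A) (rel_equiv A `` {wsqcup a b}) y"
    unfolding c le_quotient_order_class by (rule rel_le_wsqcup)
qed (auto simp only: carrier_quotient_order)

lemma lattice_quotient_order: "lattice (quotient_order A)"
proof -
  interpret partial_order "quotient_order A" by (rule partial_order_quotient_order)
  show ?thesis
  proof
    fix x y assume "x \<in> carrier (quotient_order A)" "y \<in> carrier (quotient_order A)"
    then obtain a b where "x = rel_equiv A `` {a}" "y = rel_equiv A `` {b}"
      unfolding carrier_quotient_order by blast
    then show "\<exists>s. least (quotient_order A) s (Upper (quotient_order A) {x, y})"
      "\<exists>s. greatest (quotient_order A) s (Lower (quotient_order A) {x, y})"
      using is_lub_wsqcup is_glb_wsqcap by blast+
  qed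
qed

text \<open>\<open>meet\<close> is chosen by \<open>SOME\<close> among the greatest lower bounds,
  and antisymmetry leaves only one.\<close>

lemma meet_quotient_order:
  "meet (quotient_order A) (rel_equiv A `` {a}) (rel_equiv A `` {b}) = rel_equiv A `` {wsqcap a b}"
proof -
  interpret partial_order "quotient_order A" by (rule partial_order_quotient_order)
  show ?thesis
    unfolding meet_def inf_def
    by (rule some_equality, rule is_glb_wsqcap, erule greatest_unique, rule is_glb_wsqcap)
qed

lemma join_quotient_order:
  "join (quotient_order A) (rel_equiv A `` {a}) (rel_equiv A `` {b}) = rel_equiv A `` {wsqcup a b}"
proof -
  interpret partial_order "quotient_order A" by (rule partial_order_quotient_order)
  show ?thesis
    unfolding join_def sup_def
    by (rule some_equality, rule is_lub_wsqcup, erule least_unique, rule is_lub_wsqcup)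
qed

lemma induces_wsqcap: "induces_operation A wsqcap"
proof -
  have "(wsqcap a b, wsqcap a' b') \<in> rel_le A" if "(a, a') \<in> rel_le A" "(b, b') \<in> rel_le A" for a a' b b'
    using rel_le_trans[OF rel_le_of_wle[OF wsqcap_le1] that(1)]
      rel_le_trans[OF rel_le_of_wle[OF wsqcap_le2] that(2)] by (rule rel_le_wsqcap)
  then show ?thesis
    unfolding induces_operation_def rel_equiv_def by simp
qed

lemma induces_wsqcup: "induces_operation A wsqcup"
proof -
  have "(wsqcup a b, wsqcup a' b') \<in> rel_le A" if "(a, a') \<in> rel_le A" "(b, b') \<in> rel_le A" for a a' b b'
    using rel_le_trans[OF that(1) rel_le_of_wle[OF wsqcup_ge1]]
      rel_le_trans[OF that(2) rel_le_of_wle[OF wsqcup_ge2]] by (rule rel_le_wsqcup)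
  then show ?thesis
    unfolding induces_operation_def rel_equiv_def by simp
qed

end

theorem theorem5p6:
  fixes A :: "wdegree set"
  assumes "star_preideal A"
  shows "preorder_on UNIV (rel_le A) \<and>
    induces_operation A wsqcap \<and>
    induces_operation A wsqcup \<and>
    induces_operation A wtimes \<and>
    lattice (quotient_order A) \<and>
    (\<forall>C \<in> UNIV // rel_equiv A. \<forall>D \<in> UNIV // rel_equiv A.
       induced_operation A wsqcap C D = meet (quotient_order A) C D \<and>
       induced_operation A wsqcup C D = join (quotient_order A) C D) \<and>
    (etheric_star_preideal A \<longrightarrow>
       induces_operation A wstar \<and> induces_operation A wimpl)"
proof (intro conjI ballI impI)
  show "preorder_on UNIV (rel_le A)"
    using rel_le_refl[OF assms] rel_le_trans[OF assms]
    by (auto simp: preorder_on_def refl_on_def trans_def)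
  show "induces_operation A wsqcap" "induces_operation A wsqcup"
    by (rule induces_wsqcap[OF assms] induces_wsqcup[OF assms])+
  show "induces_operation A wtimes"
    unfolding induces_operation_def rel_equiv_def by (simp add: rel_le_wtimes[OF assms])
  show "lattice (quotient_order A)"
    by (rule lattice_quotient_order[OF assms])
next
  fix C D assume "C \<in> UNIV // rel_equiv A" "D \<in> UNIV // rel_equiv A"
  then obtain a b where C: "C = rel_equiv A `` {a}" and D: "D = rel_equiv A `` {b}"
    by (auto elim!: quotientE)
  show "induced_operation A wsqcap C D = meet (quotient_order A) C D"
    unfolding C D meet_quotient_order[OF assms]
    by (rule induced_operation_class[OF assms induces_wsqcap[OF assms]])
  show "induced_operation A wsqcup C D = join (quotient_order A) C D"
    unfolding C D join_quotient_order[OF assms]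
    by (rule induced_operation_class[OF assms induces_wsqcup[OF assms]])
next
  assume ether: "etheric_star_preideal A"
  show "induces_operation A wstar"
    unfolding induces_operation_def rel_equiv_def by (simp add: rel_le_wstar[OF assms ether])
  \<comment> \<open>Equivalence gives both inequalities in each argument, so the antitone first
    argument is covered as well.\<close>
  show "induces_operation A wimpl"
    unfolding induces_operation_def rel_equiv_def by (simp add: rel_le_wimpl[OF assms ether])
qed

end
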